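(* Let $d\ge 2$ and $n\ge 2$ be integers. For a holomorphic matrix concomitant $\phi\in Hol(\mathcal V(d,n),M_n(\mathbb C))^G$ let $\sigma_\phi$ be the cross section of $\mathfrak M(d,n)$ given by $\sigma_\phi([\mathfrak z])=[\mathfrak z,\phi(\mathfrak z)]$, $\mathfrak z\in\mathcal V(d,n)$; for a cross section $\sigma$ of $\mathfrak M(d,n)$ let $\phi_\sigma$ be the matrix concomitant on $\mathcal V(d,n)$ determined by $\sigma([\mathfrak z])=[\mathfrak z,\phi_\sigma(\mathfrak z)]$. Then: (1) The correspondence $\phi\mapsto\sigma_\phi$ defines an algebra isomorphism $\Psi$ from $Hol(\mathcal V(d,n),M_n(\mathbb C))^G$ onto $\Gamma_h(Q_0(d,n),\mathfrak M(d,n))$, with inverse given by $\sigma\mapsto\phi_\sigma$. (2) If, in addition, $d$ or $n$ is greater than $2$, then every concomitant in $Hol(\mathcal V(d,n),M_n(\mathbb C))^G$ admits a unique extension to a concomitant in $Hol(M_n(\mathbb C)^d,M_n(\mathbb C))^G$. (3) The domain $\mathcal V(2,2)\subseteq M_2(\mathbb C)^2$ is a domain of holomorphy, and there are concomitants in $Hol(\mathcal V(2,2),M_2(\mathbb C))^G$ that do not extend to concomitants in $Hol(M_2(\mathbb C)^2,M_2(\mathbb C))^G$.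
   Context: $G=PGL(n,\mathbb C)$, viewed as the automorphism group of $M_n(\mathbb C)$: for $s\in G$ (represented by an invertible matrix) and $A\in M_n(\mathbb C)$, $s\cdot A=sAs^{-1}$. $G$ acts on the right on $d$-tuples $\mathfrak z=(Z_1,\dots,Z_d)\in M_n(\mathbb C)^d$ by $\mathfrak z\cdot s=s^{-1}\mathfrak z s=(s^{-1}Z_1s,\dots,s^{-1}Z_ds)$. For a $G$-invariant domain $\mathcal D\subseteq M_n(\mathbb C)^d$, a matrix concomitant on $\mathcal D$ is a function $f:\mathcal D\to M_n(\mathbb C)$ with $f(s^{-1}\mathfrak z s)=s^{-1}f(\mathfrak z)s$ for all $s\in G$, $\mathfrak z\in\mathcal D$. $Hol(\mathcal D,M_n(\mathbb C))^G$ is the algebra (pointwise operations) of all holomorphic matrix concomitants on $\mathcal D$. $\mathcal V(d,n)$ is the set of $\mathfrak z=(Z_1,\dots,Z_d)\in M_n(\mathbb C)^d$ such that $Z_1,\dots,Z_d$ generate $M_n(\mathbb C)$ as an algebra over $\mathbb C$; it is a $G$-invariant Zariski-open set. $\mathbb I_0(d,n)$ is the algebra of polynomial functions $p:M_n(\mathbb C)^d\to\mathbb C$ with $p(s^{-1}\mathfrak z s)=p(\mathfrak z)$ for all $s\in G$; it is finitely generated, and $Q(d,n)$ is its spectrum (an affine variety over $\mathbb C$). $\pi_0:M_n(\mathbb C)^d\to Q(d,n)$ is the surjective regular map dual to the inclusion of $\mathbb I_0(d,n)$ in the polynomial functions on $M_n(\mathbb C)^d$, and $Q_0(d,n):=\pi_0(\mathcal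 V(d,n))$. By a theorem of Procesi (which may be assumed), $Q_0(d,n)$ is an open subset of the smooth points of $Q(d,n)$ and $\pi_0:\mathcal V(d,n)\to Q_0(d,n)$ is a holomorphic principal $G$-bundle. In particular the points of $Q_0(d,n)$ are identified with the $G$-orbits $[\mathfrak z]=\pi_0(\mathfrak z)$, $\mathfrak z\in\mathcal V(d,n)$. $\mathfrak M(d,n)$ is the associated holomorphic fibre bundle over $Q_0(d,n)$ with fibre $M_n(\mathbb C)$: its total space is $\mathcal V(d,n)\times_G M_n(\mathbb C)$, the quotient of $\mathcal V(d,n)\times M_n(\mathbb C)$ by the action $(\mathfrak z,A)\cdot s=(s^{-1}\mathfrak z s,s^{-1}As)$, and its projection is $\pi([\mathfrak z,A])=[\mathfrak z]$. Each fibre is an algebra isomorphic to $M_n(\mathbb C)$ via $A\mapsto[\mathfrak z,A]$. $\Gamma_h(Q_0(d,n),\mathfrak M(d,n))$ is the algebra of holomorphic cross sections of $\mathfrak M(d,n)$ over $Q_0(d,n)$, with pointwise (fibrewise) operations. For every cross section $\sigma$ and $\mathfrak z\in\mathcal V(d,n)$ there is exactly one matrix $\phi_\sigma(\mathfrak z)$ with $\sigma([\mathfrak z])=[\mathfrak z,\phi_\sigma(\mathfrak z)]$. *)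

theory Defs
  imports "HOL-Analysis.Analysis" "HOL-Algebra.Module" "HOL-Algebra.QuotRing"
begin

section \<open>Matrices, tuples and the action of the projective linear group\<close>

text \<open>The index types \<open>'n\<close> and \<open>'d\<close> have \<open>n\<close> and \<open>d\<close> elements. Elements of \<open>PGL(n)\<close> are
  represented by invertible matrices throughout; all the actions below are insensitive to scalars.\<close>

type_synonym 'n cmat = "complex^'n^'n"
type_synonym ('d, 'n) mtuple = "complex^'n^'n^'d"

definition mat_scale :: "complex \<Rightarrow> 'n::finite cmat \<Rightarrow> 'n cmat" where
  "mat_scale c A = (\<chi> i j. c * A $ i $ j)"

definition tuple_scale :: "complex \<Rightarrow> ('d::finite, 'n::finite) mtuple \<Rightarrow> ('d, 'n) mtuple" where
  "tuple_scale c z = (\<chi> k. mat_scale c (z $ k))"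

definition conj_mat :: "'n::finite cmat \<Rightarrow> 'n cmat \<Rightarrow> 'n cmat" where
  "conj_mat s A = matrix_inv s ** A ** s"

definition conj_tuple :: "'n::finite cmat \<Rightarrow> ('d::finite, 'n) mtuple \<Rightarrow> ('d, 'n) mtuple" where
  "conj_tuple s z = (\<chi> k. conj_mat s (z $ k))"

inductive_set generated_algebra :: "('d::finite, 'n::finite) mtuple \<Rightarrow> 'n cmat set"
  for z :: "('d, 'n) mtuple" where
  gen: "z $ k \<in> generated_algebra z"
| one: "mat 1 \<in> generated_algebra z"
| scale: "A \<in> generated_algebra z \<Longrightarrow> mat_scale c A \<in> generated_algebra z"
| add: "A \<in> generated_algebra z \<Longrightarrow> B \<in> generated_algebra z \<Longrightarrow> A + B \<in> generated_algebra z"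
| mult: "A \<in> generated_algebra z \<Longrightarrow> B \<in> generated_algebra z \<Longrightarrow> A ** B \<in> generated_algebra z"

definition generating_tuples :: "('d::finite, 'n::finite) mtuple set" where
  "generating_tuples = {z. generated_algebra z = UNIV}"


section \<open>Holomorphic functions and domains of holomorphy in the space of tuples\<close>

text \<open>Only used for open \<open>D\<close>: Frechet differentiability with complex linear derivative at every
  point of \<open>D\<close>.\<close>

definition holomorphic_fun ::
    "('d::finite, 'n::finite) mtuple set \<Rightarrow> (('d, 'n) mtuple \<Rightarrow> complex) \<Rightarrow> bool" where
  "holomorphic_fun D f \<longleftrightarrow>
     (\<forall>z\<in>D. \<exists>f'. (f has_derivative f') (at z) \<and> (\<forall>c v. f' (tuple_scale c v) = c * f' v))"

definition holomorphic_mat ::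
    "('d::finite, 'n::finite) mtuple set \<Rightarrow> (('d, 'n) mtuple \<Rightarrow> 'n cmat) \<Rightarrow> bool" where
  "holomorphic_mat D f \<longleftrightarrow> (\<forall>i j. holomorphic_fun D (\<lambda>z. f z $ i $ j))"

text \<open>There is no open set \<open>W\<close>, connected and not contained in \<open>D\<close>, to which every holomorphic
  function on \<open>D\<close> can be continued from some nonempty open part \<open>W'\<close> of \<open>W \<inter> D\<close>. (\<open>W'\<close> need not
  be a component of \<open>W \<inter> D\<close>, so that multivalued continuation is covered.)\<close>

definition domain_of_holomorphy :: "('d::finite, 'n::finite) mtuple set \<Rightarrow> bool" where
  "domain_of_holomorphy D \<longleftrightarrow> open D \<and> connected D \<and> D \<noteq> {} \<and>
     \<not> (\<exists>W' W. open W' \<and> open W \<and> W' \<noteq> {} \<and> W' \<subseteq> W \<inter> D \<and> connected W \<and> \<not> W \<subseteq> D \<and>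
          (\<forall>f. holomorphic_fun D f \<longrightarrow>
             (\<exists>g. holomorphic_fun W g \<and> (\<forall>z\<in>W'. g z = f z))))"


section \<open>Complex algebras\<close>

definition complex_ring :: "complex ring" where
  "complex_ring = \<lparr>carrier = UNIV, monoid.mult = (*), one = 1, zero = 0, add = (+)\<rparr>"

definition complex_algebra :: "(complex, 'a) module \<Rightarrow> bool" where
  "complex_algebra A \<longleftrightarrow> Ring.ring A \<and> Module.module complex_ring A \<and>
     (\<forall>c. \<forall>x\<in>carrier A. \<forall>y\<in>carrier A.
        (c \<odot>\<^bsub>A\<^esub> x) \<otimes>\<^bsub>A\<^esub> y = c \<odot>\<^bsub>A\<^esub> (x \<otimes>\<^bsub>A\<^esub> y) \<and>
        x \<otimes>\<^bsub>A\<^esub> (c \<odot>\<^bsub>A\<^esub> y) = c \<odot>\<^bsub>A\<^esub> (x \<otimes>\<^bsub>A\<^esub> y))"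

definition complex_algebra_iso ::
    "(complex, 'a) module \<Rightarrow> (complex, 'b) module \<Rightarrow> ('a \<Rightarrow> 'b) set" where
  "complex_algebra_iso A B =
     {h \<in> ring_iso A B. \<forall>c. \<forall>x\<in>carrier A. h (c \<odot>\<^bsub>A\<^esub> x) = c \<odot>\<^bsub>B\<^esub> h x}"


section \<open>Matrix concomitants\<close>

text \<open>Functions on a subset \<open>D\<close> of the space of tuples are represented by functions that are
  \<open>undefined\<close> outside \<open>D\<close>, so that equality of functions on \<open>D\<close> is HOL equality.\<close>

definition concomitants ::
    "('d::finite, 'n::finite) mtuple set \<Rightarrow> (('d, 'n) mtuple \<Rightarrow> 'n cmat) set" where
  "concomitants D = {f \<in> extensional D.
     \<forall>s z. invertible s \<longrightarrow> z \<in> D \<longrightarrow> f (conj_tuple s z) = conj_mat s (f z)}"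

definition hol_concomitants ::
    "('d::finite, 'n::finite) mtuple set \<Rightarrow> (('d, 'n) mtuple \<Rightarrow> 'n cmat) set" where
  "hol_concomitants D = {f \<in> concomitants D. holomorphic_mat D f}"

definition hol_concomitant_algebra ::
    "('d::finite, 'n::finite) mtuple set \<Rightarrow> (complex, ('d, 'n) mtuple \<Rightarrow> 'n cmat) module" where
  "hol_concomitant_algebra D =
     \<lparr>carrier = hol_concomitants D,
      monoid.mult = (\<lambda>f g. \<lambda>z\<in>D. f z ** g z), one = (\<lambda>z\<in>D. mat 1),
      zero = (\<lambda>z\<in>D. 0), add = (\<lambda>f g. \<lambda>z\<in>D. f z + g z),
      smult = (\<lambda>c f. \<lambda>z\<in>D. mat_scale c (f z))\<rparr>"


section \<open>The affine quotient variety\<close>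

inductive polynomial_fun :: "(('d::finite, 'n::finite) mtuple \<Rightarrow> complex) \<Rightarrow> bool" where
  const: "polynomial_fun (\<lambda>z. c)"
| coord: "polynomial_fun (\<lambda>z. z $ k $ i $ j)"
| add: "polynomial_fun p \<Longrightarrow> polynomial_fun q \<Longrightarrow> polynomial_fun (\<lambda>z. p z + q z)"
| mult: "polynomial_fun p \<Longrightarrow> polynomial_fun q \<Longrightarrow> polynomial_fun (\<lambda>z. p z * q z)"

definition invariants :: "(('d::finite, 'n::finite) mtuple \<Rightarrow> complex) set" where
  "invariants = {p. polynomial_fun p \<and> (\<forall>s z. invertible s \<longrightarrow> p (conj_tuple s z) = p z)}"

text \<open>The points of the affine variety with coordinate ring \<open>invariants\<close> are the unital complex
  algebra homomorphisms from \<open>invariants\<close> to the complex numbers; the value of the regular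
  function \<open>p\<close> at the point \<open>x\<close> is \<open>x p\<close>.\<close>

type_synonym ('d, 'n) qpoint = "(('d, 'n) mtuple \<Rightarrow> complex) \<Rightarrow> complex"

definition quotient_variety :: "('d::finite, 'n::finite) qpoint set" where
  "quotient_variety = {x \<in> extensional invariants.
     (\<forall>c. x (\<lambda>z. c) = c) \<and>
     (\<forall>p\<in>invariants. \<forall>q\<in>invariants. x (\<lambda>z. p z + q z) = x p + x q) \<and>
     (\<forall>p\<in>invariants. \<forall>q\<in>invariants. x (\<lambda>z. p z * q z) = x p * x q)}"

text \<open>The Euclidean topology of the variety: the coarsest one making all regular functions
  continuous.\<close>

definition quotient_topology :: "('d::finite, 'n::finite) qpoint topology" where
  "quotient_topology =
     subtopology (product_topology (\<lambda>p. euclidean) invariants) quotient_variety"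

definition pi0 :: "('d::finite, 'n::finite) mtuple \<Rightarrow> ('d, 'n) qpoint" where
  "pi0 z = (\<lambda>p\<in>invariants. p z)"

definition Q0 :: "('d::finite, 'n::finite) qpoint set" where
  "Q0 = pi0 ` generating_tuples"

text \<open>Complex differentiability at \<open>a\<close> of a function of the first \<open>N\<close> coordinates (the number of
  variables has to be quantified over, so it cannot be a type). Near \<open>a\<close> such an \<open>F\<close> does
  not depend on the coordinates from \<open>N\<close> on.\<close>

definition complex_differentiable_at ::
    "nat \<Rightarrow> ((nat \<Rightarrow> complex) \<Rightarrow> complex) \<Rightarrow> (nat \<Rightarrow> complex) \<Rightarrow> bool" where
  "complex_differentiable_at N F a \<longleftrightarrow>
     (\<exists>c. \<forall>\<epsilon>>0. \<exists>\<delta>>0. \<forall>y. (\<forall>i<N. cmod (y i - a i) < \<delta>) \<longrightarrow>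
        cmod (F y - F a - (\<Sum>i<N. c i * (y i - a i))) \<le> \<epsilon> * (\<Sum>i<N. cmod (y i - a i)))"

text \<open>Holomorphic functions on a subset of the variety: locally they are holomorphic
  functions of finitely many regular functions, i.e. restrictions of holomorphic functions from an
  affine embedding. On the smooth locus this is the complex manifold structure.\<close>

definition holomorphic_on_quotient ::
    "('d::finite, 'n::finite) qpoint set \<Rightarrow> (('d, 'n) qpoint \<Rightarrow> complex) \<Rightarrow> bool" where
  "holomorphic_on_quotient U h \<longleftrightarrow>
     (\<forall>x\<in>U. \<exists>N p F r. r > 0 \<and> (\<forall>i<N. p i \<in> invariants) \<and>
        (\<forall>y. (\<forall>i<N. cmod (y i - x (p i)) < r) \<longrightarrow> complex_differentiable_at N F y) \<and>
        (\<forall>u\<in>U. (\<forall>i<N. cmod (u (p i) - x (p i)) < r) \<longrightarrow> h u = F (\<lambda>i. u (p i))))"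


section \<open>The associated matrix bundle and its holomorphic sections\<close>

text \<open>\<open>bundle_class z A\<close> is the orbit \<open>[z, A]\<close>.\<close>

definition bundle_class ::
    "('d::finite, 'n::finite) mtuple \<Rightarrow> 'n cmat \<Rightarrow> (('d, 'n) mtuple \<times> 'n cmat) set" where
  "bundle_class z A = {(conj_tuple s z, conj_mat s A) | s. invertible s}"

definition bundle_space :: "(('d::finite, 'n::finite) mtuple \<times> 'n cmat) set set" where
  "bundle_space = {bundle_class z A | z A. z \<in> generating_tuples}"

definition bundle_proj ::
    "(('d::finite, 'n::finite) mtuple \<times> 'n cmat) set \<Rightarrow> ('d, 'n) qpoint" where
  "bundle_proj x =
     (THE q. \<exists>z A. z \<in> generating_tuples \<and> x = bundle_class z A \<and> q = pi0 z)"

text \<open>Algebra operations in a fibre. Since the action on generating tuples is free, an orbit is the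
  graph of a function on an orbit in \<open>generating_tuples\<close>, and e.g.
  \<open>[z, A] + [z, B] = [z, A + B]\<close>.\<close>

definition fibre_add :: "(('d::finite, 'n::finite) mtuple \<times> 'n cmat) set \<Rightarrow>
    (('d, 'n) mtuple \<times> 'n cmat) set \<Rightarrow> (('d, 'n) mtuple \<times> 'n cmat) set" where
  "fibre_add x y = {(z, A + B) | z A B. (z, A) \<in> x \<and> (z, B) \<in> y}"

definition fibre_mult :: "(('d::finite, 'n::finite) mtuple \<times> 'n cmat) set \<Rightarrow>
    (('d, 'n) mtuple \<times> 'n cmat) set \<Rightarrow> (('d, 'n) mtuple \<times> 'n cmat) set" where
  "fibre_mult x y = {(z, A ** B) | z A B. (z, A) \<in> x \<and> (z, B) \<in> y}"

definition fibre_scale :: "complex \<Rightarrow> (('d::finite, 'n::finite) mtuple \<times> 'n cmat) set \<Rightarrow>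
    (('d, 'n) mtuple \<times> 'n cmat) set" where
  "fibre_scale c x = {(z, mat_scale c A) | z A. (z, A) \<in> x}"

definition fibre_zero ::
    "('d::finite, 'n::finite) qpoint \<Rightarrow> (('d, 'n) mtuple \<times> 'n cmat) set" where
  "fibre_zero q = {(z, 0) | z. z \<in> generating_tuples \<and> pi0 z = q}"

definition fibre_one ::
    "('d::finite, 'n::finite) qpoint \<Rightarrow> (('d, 'n) mtuple \<times> 'n cmat) set" where
  "fibre_one q = {(z, mat 1) | z. z \<in> generating_tuples \<and> pi0 z = q}"

definition cross_sections ::
    "(('d::finite, 'n::finite) qpoint \<Rightarrow> (('d, 'n) mtuple \<times> 'n cmat) set) set" where
  "cross_sections =
     {\<sigma> \<in> extensional Q0. \<forall>q\<in>Q0. \<sigma> q \<in> bundle_space \<and> bundle_proj (\<sigma> q) = q}"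

text \<open>A holomorphic local section \<open>s\<close> of the principal bundle over \<open>U\<close> is the same thing as a local
  trivialisation; it induces the trivialisation \<open>(q, A) \<mapsto> [s q, A]\<close> of the associated
  bundle over \<open>U\<close>.\<close>

definition local_trivialisation ::
    "('d::finite, 'n::finite) qpoint set \<Rightarrow> (('d, 'n) qpoint \<Rightarrow> ('d, 'n) mtuple) \<Rightarrow> bool" where
  "local_trivialisation U s \<longleftrightarrow>
     openin (subtopology quotient_topology Q0) U \<and>
     (\<forall>q\<in>U. s q \<in> generating_tuples \<and> pi0 (s q) = q) \<and>
     (\<forall>k i j. holomorphic_on_quotient U (\<lambda>q. s q $ k $ i $ j))"

text \<open>A cross section is holomorphic if around each point of \<open>Q0\<close> it is given by a
  holomorphic matrix function \<open>a\<close> in some local trivialisation.\<close>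

definition hol_sections ::
    "(('d::finite, 'n::finite) qpoint \<Rightarrow> (('d, 'n) mtuple \<times> 'n cmat) set) set" where
  "hol_sections = {\<sigma> \<in> cross_sections. \<forall>q0\<in>Q0. \<exists>U s a.
     q0 \<in> U \<and> local_trivialisation U s \<and>
     (\<forall>i j. holomorphic_on_quotient U (\<lambda>q. a q $ i $ j)) \<and>
     (\<forall>q\<in>U. \<sigma> q = bundle_class (s q) (a q))}"

definition hol_section_algebra ::
    "(complex, ('d::finite, 'n::finite) qpoint \<Rightarrow> (('d, 'n) mtuple \<times> 'n cmat) set) module" where
  "hol_section_algebra =
     \<lparr>carrier = hol_sections,
      monoid.mult = (\<lambda>\<sigma> \<tau>. \<lambda>q\<in>Q0. fibre_mult (\<sigma> q) (\<tau> q)), one = (\<lambda>q\<in>Q0. fibre_one q),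
      zero = (\<lambda>q\<in>Q0. fibre_zero q), add = (\<lambda>\<sigma> \<tau>. \<lambda>q\<in>Q0. fibre_add (\<sigma> q) (\<tau> q)),
      smult = (\<lambda>c \<sigma>. \<lambda>q\<in>Q0. fibre_scale c (\<sigma> q))\<rparr>"

definition section_of :: "(('d::finite, 'n::finite) mtuple \<Rightarrow> 'n cmat) \<Rightarrow>
    ('d, 'n) qpoint \<Rightarrow> (('d, 'n) mtuple \<times> 'n cmat) set" where
  "section_of \<phi> =
     (\<lambda>q\<in>Q0. THE x. \<exists>z\<in>generating_tuples. pi0 z = q \<and> x = bundle_class z (\<phi> z))"

definition concomitant_of ::
    "(('d::finite, 'n::finite) qpoint \<Rightarrow> (('d, 'n) mtuple \<times> 'n cmat) set) \<Rightarrow>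
     ('d, 'n) mtuple \<Rightarrow> 'n cmat" where
  "concomitant_of \<sigma> = (\<lambda>z\<in>generating_tuples. THE A. \<sigma> (pi0 z) = bundle_class z A)"

end

theory Submission
  imports Defs "HOL-Complex_Analysis.Conformal_Mappings"
begin

text \<open>
  \<^bold>\<open>Orbits and local sections.\<close> The values of noncommutative polynomials at a generating tuple \<open>z\<close>
  are all matrices. So there are noncommutative polynomials \<open>X\<close>, \<open>C\<close> such that \<open>X z\<close> is diagonal
  with distinct eigenvalues and all entries of \<open>C z\<close> are \<open>1\<close>. The coefficients of the characteristic
  polynomial of \<open>X\<close> are invariants, so that near \<open>pi0 z\<close> the eigenvalues of \<open>X\<close> are
  holomorphic functions on the quotient, by the inverse function theorem
  (\<open>simple_root_holomorphic\<close>, \<open>eigenvalue_local_section\<close>). With respect to an eigenbasis of \<open>X\<close> that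
  is normalised by means of \<open>C\<close>, a tuple has entries that are quotients of traces of products of its
  components, of values of \<open>C\<close> and of spectral idempotents of \<open>X\<close>; these are holomorphic on the
  quotient as well. This gives a holomorphic choice of representatives of the orbits near \<open>[z]\<close>
  (\<open>exists_local_section\<close>). Hence invariants separate the orbits of generating tuples
  (\<open>pi0_eq_imp_conj\<close>), and the principal bundle has local trivialisations.

  \<^bold>\<open>The isomorphism.\<close> That \<open>section_of\<close> and \<open>concomitant_of\<close> are inverse to each other is then formal,
  and they respect the pointwise operations. A holomorphic concomitant composed with a holomorphic
  local section is holomorphic, which gives \<open>section_of_holomorphic\<close>. Conversely, let a cross section
  be given by \<open>a\<close> in a trivialisation \<open>s\<close>. The coordinates of \<open>a\<close> with respect to a basis consisting
  of values of noncommutative polynomials at \<open>s\<close> are those of the concomitant with respect to the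
  basis of values at \<open>z\<close>, because a noncommutative polynomial is itself a concomitant. By Cramer's
  rule they are holomorphic (\<open>concomitant_of_holomorphic\<close>).

  \<^bold>\<open>Extension.\<close> If \<open>d\<close> or \<open>n\<close> is greater than \<open>2\<close>, there is a complex line \<open>z0 + t v\<close> that consists of
  generating tuples and whose direction \<open>v\<close> generates too (\<open>exists_generating_line\<close>); so the line,
  with its point at infinity, avoids the closed cone of tuples that do not generate. The mean of a
  holomorphic function over a circle in the direction of \<open>v\<close> is defined and holomorphic on a given
  ball if the radius of the circle is large; it equals the function near \<open>z0\<close> by Cauchy's formula, and on all generating tuples by
  the identity theorem (\<open>extension_of_avoiding_line\<close>). Generating tuples are dense, so the extension
  is unique and is a concomitant.

  \<^bold>\<open>Pairs of two by two matrices.\<close> A pair generates if and only if the trace \<open>\<Delta>\<close> of the square of its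
  commutator does not vanish (\<open>generating_pairs\<close>). Thus generating pairs are the complement of a
  hypersurface with an invariant equation, across which \<open>1 / \<Delta>\<close> has no continuation, and
  \<open>1 / \<Delta>\<close> times the unit matrix is a concomitant.
\<close>

section \<open>Matrices and conjugation\<close>

lemma matrix_inv_inverse:
  fixes s :: "'n::finite cmat"
  assumes "invertible s"
  shows "s ** matrix_inv s = mat 1" "matrix_inv s ** s = mat 1"
proof -
  have "\<exists>t. s ** t = mat 1 \<and> t ** s = mat 1" using assms by (simp add: invertible_def)
  then have "s ** matrix_inv s = mat 1 \<and> matrix_inv s ** s = mat 1"
    unfolding matrix_inv_def by (rule someI_ex)
  then show "s ** matrix_inv s = mat 1" "matrix_inv s ** s = mat 1" by auto
qed

lemma matrix_inv_unique:
  fixes s t :: "'n::finite cmat"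
  assumes "s ** t = mat 1" "t ** s = mat 1"
  shows "matrix_inv s = t"
proof -
  have "invertible s" using assms by (auto simp: invertible_def)
  from matrix_inv_inverse[OF this] show ?thesis
    by (metis assms(2) matrix_mul_assoc matrix_mul_lid matrix_mul_rid)
qed

lemma invertible_matrix_inv:
  "invertible (s :: 'n::finite cmat) \<Longrightarrow> invertible (matrix_inv s)"
  using matrix_inv_inverse[of s] by (auto simp: invertible_def)

lemma mat_scale_nth [simp]: "mat_scale c A $ i $ j = c * A $ i $ j"
  by (simp add: mat_scale_def)

lemma tuple_scale_nth [simp]: "tuple_scale c z $ k = mat_scale c (z $ k)"
  by (simp add: tuple_scale_def)

lemma conj_tuple_nth [simp]: "conj_tuple s z $ k = conj_mat s (z $ k)"
  by (simp add: conj_tuple_def)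

lemma matrix_mult_nth: "(A ** B) $ i $ j = (\<Sum>k\<in>UNIV. A $ i $ k * B $ k $ j)"
  by (simp add: matrix_matrix_mult_def)

lemma mat_nth: "mat c $ i $ j = (if i = j then c else 0)"
  by (simp add: mat_def)

lemma mat_scale_mult_left: "mat_scale c A ** B = mat_scale c (A ** B)"
  by (simp add: vec_eq_iff matrix_mult_nth sum_distrib_left mult.assoc)

lemma mat_scale_mult_right: "A ** mat_scale c B = mat_scale c (A ** B)"
  by (simp add: vec_eq_iff matrix_mult_nth sum_distrib_left algebra_simps)

lemma mat_scale_simps [simp]: "mat_scale 1 A = A" "mat_scale 0 A = 0" "mat_scale c 0 = 0"
    "mat_scale c (mat_scale d A) = mat_scale (c * d) A"
  by (simp_all add: vec_eq_iff)

lemma mat_scale_add: "mat_scale c (A + B) = mat_scale c A + mat_scale c B"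
  by (simp add: vec_eq_iff algebra_simps)

lemma mat_scale_add_left: "mat_scale (c + d) A = mat_scale c A + mat_scale d A"
  by (simp add: vec_eq_iff algebra_simps)

lemma matrix_add_rdistrib: "(A + B) ** C = A ** C + B ** (C :: 'n::finite cmat)"
  by (simp add: vec_eq_iff matrix_mult_nth sum.distrib algebra_simps)

lemma matrix_mult_sum_left: "sum f S ** (B::'n::finite cmat) = (\<Sum>x\<in>S. f x ** B)"
  by (induction S rule: infinite_finite_induct) (auto simp: matrix_add_rdistrib)

lemma matrix_mult_sum_right: "(B::'n::finite cmat) ** sum f S = (\<Sum>x\<in>S. B ** f x)"
  by (induction S rule: infinite_finite_induct) (auto simp: matrix_add_ldistrib)

lemma tuple_scale_simps [simp]: "tuple_scale 1 z = z" "tuple_scale 0 z = 0" "tuple_scale c 0 = 0"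
    "tuple_scale c (tuple_scale d z) = tuple_scale (c * d) z"
  by (simp_all add: vec_eq_iff)

lemma tuple_scale_add: "tuple_scale c (z + w) = tuple_scale c z + tuple_scale c w"
  by (simp add: vec_eq_iff algebra_simps)

lemma tuple_scale_add_left: "tuple_scale (c + d) z = tuple_scale c z + tuple_scale d z"
  by (simp add: vec_eq_iff algebra_simps)

lemma norm_tuple_scale: "norm (tuple_scale c z) = cmod c * norm z"
proof -
  have vec: "norm (\<chi> i. f c (x $ i)) = cmod c * norm x"
    if "\<And>y. norm (f c y) = cmod c * norm y" for f :: "complex \<Rightarrow> 'x::real_normed_vector \<Rightarrow> 'x"
      and x :: "'x^'m::finite"
    by (simp add: norm_vec_def that L2_set_right_distrib)
  have 1: "norm (\<chi> j. c * x $ j) = cmod c * norm x" for x :: "complex^'m::finite"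
    by (rule vec[of "(*)"]) (rule norm_mult)
  have 2: "norm (mat_scale c A) = cmod c * norm A" for A
    unfolding mat_scale_def
    by (rule vec[of "\<lambda>c x. \<chi> j. c * x $ j"]) (rule 1)
  show ?thesis unfolding tuple_scale_def by (rule vec[of mat_scale]) (rule 2)
qed

lemma bounded_linear_tuple_scale: "bounded_linear (\<lambda>c. tuple_scale c z)"
proof (rule bounded_linear_intro[where K = "norm z"])
  show "tuple_scale (r *\<^sub>R x) z = r *\<^sub>R tuple_scale x z" for r x
    by (simp add: vec_eq_iff)
qed (auto simp: tuple_scale_add_left norm_tuple_scale)

lemma conj_mat_one [simp]: "invertible s \<Longrightarrow> conj_mat s (mat 1) = mat 1"
  by (simp add: conj_mat_def matrix_inv_inverse)

lemma conj_mat_zero [simp]: "conj_mat s 0 = 0"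
  by (simp add: conj_mat_def)

lemma conj_mat_add: "conj_mat s (A + B) = conj_mat s A + conj_mat s B"
  by (simp add: conj_mat_def matrix_add_ldistrib matrix_add_rdistrib)

lemma conj_mat_scale: "conj_mat s (mat_scale c A) = mat_scale c (conj_mat s A)"
  by (simp add: conj_mat_def mat_scale_mult_left mat_scale_mult_right)

lemma conj_mat_mult: "invertible s \<Longrightarrow> conj_mat s (A ** B) = conj_mat s A ** conj_mat s B"
  unfolding conj_mat_def
  by (metis matrix_inv_inverse(1) matrix_mul_assoc matrix_mul_rid)

lemma conj_mat_compose:
  assumes "invertible s" "invertible t"
  shows "conj_mat t (conj_mat s A) = conj_mat (s ** t) A"
proof -
  have "matrix_inv (s ** t) = matrix_inv t ** matrix_inv s"
  proof (rule matrix_inv_unique)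
    have "s ** t ** (matrix_inv t ** matrix_inv s) = s ** (t ** matrix_inv t) ** matrix_inv s"
      by (simp only: matrix_mul_assoc)
    then show "s ** t ** (matrix_inv t ** matrix_inv s) = mat 1"
      by (simp add: matrix_inv_inverse assms)
    have "matrix_inv t ** matrix_inv s ** (s ** t) = matrix_inv t ** (matrix_inv s ** s) ** t"
      by (simp only: matrix_mul_assoc)
    then show "matrix_inv t ** matrix_inv s ** (s ** t) = mat 1"
      by (simp add: matrix_inv_inverse assms)
  qed
  then show ?thesis by (simp add: conj_mat_def matrix_mul_assoc)
qed

lemma conj_mat_id [simp]: "conj_mat (mat 1) A = A"
  by (simp add: conj_mat_def matrix_inv_unique)

lemma conj_mat_cancel [simp]:
  assumes "invertible s"
  shows "conj_mat (matrix_inv s) (conj_mat s A) = A" "conj_mat s (conj_mat (matrix_inv s) A) = A"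
  using assms by (simp_all add: conj_mat_compose invertible_matrix_inv matrix_inv_inverse)

lemma conj_tuple_compose:
  "invertible s \<Longrightarrow> invertible t \<Longrightarrow> conj_tuple t (conj_tuple s z) = conj_tuple (s ** t) z"
  by (simp add: vec_eq_iff conj_mat_compose)

lemma conj_tuple_id [simp]: "conj_tuple (mat 1) z = z"
  by (simp add: vec_eq_iff)

lemma conj_tuple_cancel [simp]:
  assumes "invertible s"
  shows "conj_tuple (matrix_inv s) (conj_tuple s z) = z"
    "conj_tuple s (conj_tuple (matrix_inv s) z) = z"
  using assms by (simp_all add: vec_eq_iff)

lemma invertible_mat_one [simp]: "invertible (mat 1 :: 'n::finite cmat)"
  by (metis invertible_def matrix_mul_lid)

lemma trace_conj_mat: "invertible s \<Longrightarrow> trace (conj_mat s A) = trace A"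
  unfolding conj_mat_def
  by (metis matrix_inv_inverse(1) matrix_mul_assoc matrix_mul_lid trace_mul_sym)

lemma det_conj_mat: "invertible s \<Longrightarrow> det (conj_mat s A) = det A"
  unfolding conj_mat_def
  by (metis det_mul matrix_inv_inverse(1) matrix_mul_lid matrix_mul_assoc mult.commute)

text \<open>The matrix unit with its entry \<open>1\<close> in row \<open>a\<close> and column \<open>b\<close>.\<close>

definition matrix_unit :: "'n \<Rightarrow> 'n \<Rightarrow> 'n::finite cmat" where
  "matrix_unit a b = (\<chi> i j. if i = a \<and> j = b then 1 else 0)"

lemma matrix_unit_nth: "matrix_unit a b $ i $ j = (if i = a \<and> j = b then 1 else 0)"
  by (simp add: matrix_unit_def)

lemma matrix_unit_mult: "matrix_unit a b ** matrix_unit c d = (if b = c then matrix_unit a d else 0)"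
proof (cases "b = c")
  case True
  then have "(\<Sum>k\<in>UNIV. (if i = a \<and> k = b then 1 else 0) * (if k = c \<and> j = d then 1 else (0::complex)))
      = (\<Sum>k\<in>UNIV. if k = b then (if i = a \<and> j = d then 1 else 0) else 0)" for i j
    by (intro sum.cong) auto
  then show ?thesis using True by (simp add: vec_eq_iff matrix_mult_nth matrix_unit_nth)
next
  case False
  then have "(\<Sum>k\<in>UNIV. (if i = a \<and> k = b then 1 else 0) * (if k = c \<and> j = d then 1 else (0::complex)))
      = 0" for i j
    by (intro sum.neutral) auto
  then show ?thesis using False by (simp add: vec_eq_iff matrix_mult_nth matrix_unit_nth)
qed

lemma matrix_unit_decomposition:
  "A = (\<Sum>i\<in>UNIV. \<Sum>j\<in>UNIV. mat_scale (A $ i $ j) (matrix_unit i j))"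
proof -
  have "(\<Sum>i\<in>UNIV. \<Sum>j\<in>UNIV. A $ i $ j * (if a = i \<and> b = j then 1 else 0)) = A $ a $ b" for a b
  proof -
    have "(\<Sum>i\<in>UNIV. \<Sum>j\<in>UNIV. A $ i $ j * (if a = i \<and> b = j then 1 else 0))
      = (\<Sum>i\<in>UNIV. \<Sum>j\<in>UNIV. if j = b then if i = a then A $ i $ j else 0 else 0)"
      by (intro sum.cong) auto
    then show ?thesis by simp
  qed
  then show ?thesis by (simp add: vec_eq_iff matrix_unit_nth)
qed


section \<open>Noncommutative polynomials and generating tuples\<close>

text \<open>The functions of \<open>z\<close> given by noncommutative polynomials in the components of \<open>z\<close>. They
  are polynomial concomitants, and their values at \<open>z\<close> form the algebra generated by \<open>z\<close>.\<close>

inductive nc_polynomial :: "(('d::finite, 'n::finite) mtuple \<Rightarrow> 'n cmat) \<Rightarrow> bool" where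
  gen: "nc_polynomial (\<lambda>z. z $ k)"
| one: "nc_polynomial (\<lambda>z. mat 1)"
| scale: "nc_polynomial X \<Longrightarrow> nc_polynomial (\<lambda>z. mat_scale c (X z))"
| add: "nc_polynomial X \<Longrightarrow> nc_polynomial Y \<Longrightarrow> nc_polynomial (\<lambda>z. X z + Y z)"
| mult: "nc_polynomial X \<Longrightarrow> nc_polynomial Y \<Longrightarrow> nc_polynomial (\<lambda>z. X z ** Y z)"

lemma nc_polynomial_conj:
  "nc_polynomial X \<Longrightarrow> invertible s \<Longrightarrow> X (conj_tuple s z) = conj_mat s (X z)"
  by (induction rule: nc_polynomial.induct) (auto simp: conj_mat_add conj_mat_mult conj_mat_scale)

lemma generated_algebra_nc_polynomial:
  "A \<in> generated_algebra z \<longleftrightarrow> (\<exists>X. nc_polynomial X \<and> A = X z)"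
proof
  assume "A \<in> generated_algebra z"
  then show "\<exists>X. nc_polynomial X \<and> A = X z"
    by (induction rule: generated_algebra.induct) (blast intro: nc_polynomial.intros)+
next
  have "nc_polynomial X \<Longrightarrow> X z \<in> generated_algebra z" for X
    by (induction rule: nc_polynomial.induct) (auto intro: generated_algebra.intros)
  then show "\<exists>X. nc_polynomial X \<and> A = X z \<Longrightarrow> A \<in> generated_algebra z" by auto
qed

lemma generating_tuples_nc_polynomial:
  assumes "z \<in> generating_tuples"
  obtains X where "nc_polynomial X" "X z = A"
  using assms generated_algebra_nc_polynomial[of A z] unfolding generating_tuples_def by auto

lemma generated_algebra_zero: "0 \<in> generated_algebra z"
  using generated_algebra.scale[OF generated_algebra.one, where c = 0] by simp

lemma generated_algebra_sum:
  "(\<And>x. x \<in> S \<Longrightarrow> f x \<in> generated_algebra z) \<Longrightarrow> sum f S \<in> generated_algebra z"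
  by (induction S rule: infinite_finite_induct)
    (auto intro: generated_algebra_zero generated_algebra.add)

lemma generating_tuplesI_units:
  assumes "\<And>i j. matrix_unit i j \<in> generated_algebra z"
  shows "z \<in> generating_tuples"
proof -
  have "A \<in> generated_algebra z" for A
    by (subst matrix_unit_decomposition)
      (intro generated_algebra_sum generated_algebra.scale assms)
  then show ?thesis by (auto simp: generating_tuples_def)
qed

lemma generated_algebra_mono:
  assumes "\<And>k. w $ k \<in> generated_algebra z"
  shows "generated_algebra w \<subseteq> generated_algebra z"
proof
  fix A assume "A \<in> generated_algebra w"
  then show "A \<in> generated_algebra z"
    by induction (auto intro: generated_algebra.intros assms)
qed

lemma generating_tuples_scale:
  assumes "z \<in> generating_tuples" "c \<noteq> 0"
  shows "tuple_scale c z \<in> generating_tuples"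
proof -
  have "z $ k \<in> generated_algebra (tuple_scale c z)" for k
    using generated_algebra.scale[OF generated_algebra.gen[of "tuple_scale c z" k], of "1/c"]
      assms(2) by simp
  from generated_algebra_mono[OF this] show ?thesis
    using assms(1) by (auto simp: generating_tuples_def)
qed

lemma generating_tuples_conj:
  assumes "z \<in> generating_tuples" "invertible s"
  shows "conj_tuple s z \<in> generating_tuples"
proof -
  have "A \<in> generated_algebra (conj_tuple s z)" for A
  proof -
    obtain X where "nc_polynomial X" "X z = conj_mat (matrix_inv s) A"
      by (rule generating_tuples_nc_polynomial[OF assms(1)])
    then have "nc_polynomial X \<and> A = X (conj_tuple s z)"
      by (simp add: nc_polynomial_conj assms(2))
    then show ?thesis by (auto simp: generated_algebra_nc_polynomial)
  qed
  then show ?thesis by (auto simp: generating_tuples_def)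
qed

text \<open>The projective linear group acts freely on generating tuples: matrices with the same action on \<open>z\<close>
  define the same automorphism of the matrix algebra.\<close>

lemma conj_mat_eqI_generating:
  assumes "z \<in> generating_tuples" "invertible s" "invertible t" "conj_tuple s z = conj_tuple t z"
  shows "conj_mat s A = conj_mat t A"
proof -
  obtain X where "nc_polynomial X" "X z = A"
    by (rule generating_tuples_nc_polynomial[OF assms(1)])
  then show ?thesis using nc_polynomial_conj assms by metis
qed


section \<open>Polynomial and holomorphic functions\<close>

lemma polynomial_fun_sum:
  "(\<And>x. x \<in> S \<Longrightarrow> polynomial_fun (f x)) \<Longrightarrow> polynomial_fun (\<lambda>z. \<Sum>x\<in>S. f x z)"
  by (induction S rule: infinite_finite_induct)
    (auto intro: polynomial_fun.const polynomial_fun.add)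

lemma polynomial_fun_prod:
  "(\<And>x. x \<in> S \<Longrightarrow> polynomial_fun (f x)) \<Longrightarrow> polynomial_fun (\<lambda>z. \<Prod>x\<in>S. f x z)"
  by (induction S rule: infinite_finite_induct)
    (auto intro: polynomial_fun.const polynomial_fun.mult)

lemma polynomial_fun_det:
  assumes "\<And>i j. polynomial_fun (\<lambda>z. M z $ i $ j)"
  shows "polynomial_fun (\<lambda>z. det (M z))"
  unfolding det_def
  by (intro polynomial_fun_sum polynomial_fun.mult polynomial_fun.const polynomial_fun_prod assms)

lemma nc_polynomial_entry: "nc_polynomial X \<Longrightarrow> polynomial_fun (\<lambda>z. X z $ i $ j)"
proof (induction arbitrary: i j rule: nc_polynomial.induct)
  case (mult X Y)
  show ?case unfolding matrix_mult_nth
    by (intro polynomial_fun_sum polynomial_fun.mult mult.IH)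
qed (auto intro: polynomial_fun.intros)

lemma polynomial_fun_on_line:
  "polynomial_fun f \<Longrightarrow> \<exists>p. \<forall>t. f (z + tuple_scale t v) = poly p t"
proof (induction rule: polynomial_fun.induct)
  case (const c)
  show ?case by (rule exI[of _ "[:c:]"]) simp
next
  case (coord k i j)
  show ?case by (rule exI[of _ "[:z $ k $ i $ j, v $ k $ i $ j:]"]) simp
next
  case (add f g)
  then obtain p q where "\<forall>t. f (z + tuple_scale t v) = poly p t" "\<forall>t. g (z + tuple_scale t v) = poly q t"
    by auto
  then show ?case by (intro exI[of _ "p + q"]) simp
next
  case (mult f g)
  then obtain p q where "\<forall>t. f (z + tuple_scale t v) = poly p t" "\<forall>t. g (z + tuple_scale t v) = poly q t"
    by auto
  then show ?case by (intro exI[of _ "p * q"]) simp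
qed

text \<open>Frechet differentiability at \<open>z\<close> with complex linear derivative.\<close>

definition holo_at :: "(('d::finite, 'n::finite) mtuple \<Rightarrow> complex) \<Rightarrow> ('d, 'n) mtuple \<Rightarrow> bool" where
  "holo_at f z \<longleftrightarrow> (\<exists>f'. (f has_derivative f') (at z) \<and> (\<forall>c v. f' (tuple_scale c v) = c * f' v))"

lemma holomorphic_fun_iff: "holomorphic_fun D f \<longleftrightarrow> (\<forall>z\<in>D. holo_at f z)"
  by (simp add: holomorphic_fun_def holo_at_def)

lemma holo_at_const: "holo_at (\<lambda>z. c) z"
  unfolding holo_at_def by (intro exI[of _ "\<lambda>v. 0"]) auto

lemma holo_at_coord: "holo_at (\<lambda>z. z $ k $ i $ j) z"
  unfolding holo_at_def
  by (intro exI[of _ "\<lambda>z. z $ k $ i $ j"] conjI bounded_linear_imp_has_derivative)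
    (auto intro!: bounded_linear_compose[OF bounded_linear_vec_nth] bounded_linear_vec_nth)

lemma holo_at_add: "holo_at f z \<Longrightarrow> holo_at g z \<Longrightarrow> holo_at (\<lambda>z. f z + g z) z"
  unfolding holo_at_def
  apply (elim exE conjE)
  subgoal for f' g'
    by (rule exI[of _ "\<lambda>v. f' v + g' v"]) (auto intro: has_derivative_add simp: algebra_simps)
  done

lemma holo_at_mult: "holo_at f z \<Longrightarrow> holo_at g z \<Longrightarrow> holo_at (\<lambda>z. f z * g z) z"
  unfolding holo_at_def
  apply (elim exE conjE)
  subgoal for f' g'
    by (rule exI[of _ "\<lambda>v. f z * g' v + f' v * g z"])
      (auto intro: has_derivative_mult simp: algebra_simps)
  done

lemma holo_at_inverse: "holo_at f z \<Longrightarrow> f z \<noteq> 0 \<Longrightarrow> holo_at (\<lambda>z. inverse (f z)) z"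
  unfolding holo_at_def
  apply (elim exE conjE)
  subgoal for f'
    by (rule exI[of _ "\<lambda>v. - (inverse (f z) * f' v * inverse (f z))"])
      (auto intro: has_derivative_inverse)
  done

lemma holo_at_divide: "holo_at f z \<Longrightarrow> holo_at g z \<Longrightarrow> g z \<noteq> 0 \<Longrightarrow> holo_at (\<lambda>z. f z / g z) z"
  unfolding divide_inverse by (intro holo_at_mult holo_at_inverse)

lemma holo_at_diff: "holo_at f z \<Longrightarrow> holo_at g z \<Longrightarrow> holo_at (\<lambda>z. f z - g z) z"
  using holo_at_add[of f z "\<lambda>z. (-1) * g z"] holo_at_mult[OF holo_at_const, of g z "-1"] by simp

lemma holo_at_sum: "(\<And>x. x \<in> S \<Longrightarrow> holo_at (f x) z) \<Longrightarrow> holo_at (\<lambda>z. \<Sum>x\<in>S. f x z) z"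
  by (induction S rule: infinite_finite_induct) (auto intro: holo_at_const holo_at_add)

lemma holo_at_prod: "(\<And>x. x \<in> S \<Longrightarrow> holo_at (f x) z) \<Longrightarrow> holo_at (\<lambda>z. \<Prod>x\<in>S. f x z) z"
  by (induction S rule: infinite_finite_induct) (auto intro: holo_at_const holo_at_mult)

lemma holo_at_det: "(\<And>i j. holo_at (\<lambda>z. M z $ i $ j) z) \<Longrightarrow> holo_at (\<lambda>z. det (M z)) z"
  unfolding det_def by (intro holo_at_sum holo_at_mult holo_at_const holo_at_prod) auto

lemma holo_at_polynomial: "polynomial_fun f \<Longrightarrow> holo_at f z"
  by (induction rule: polynomial_fun.induct)
    (auto intro: holo_at_const holo_at_coord holo_at_add holo_at_mult)

lemma holo_at_cong:
  assumes "holo_at f z" "open S" "z \<in> S" "\<And>w. w \<in> S \<Longrightarrow> f w = g w"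
  shows "holo_at g z"
  using assms has_derivative_transform_within_open[of f _ z UNIV S g]
  unfolding holo_at_def by auto

lemma holo_at_continuous: "holo_at f z \<Longrightarrow> isCont f z"
  unfolding holo_at_def by (auto intro: has_derivative_continuous)

lemma holomorphic_fun_continuous_on: "holomorphic_fun D f \<Longrightarrow> continuous_on D f"
  by (auto simp: holomorphic_fun_iff intro: continuous_at_imp_continuous_on holo_at_continuous)

lemma polynomial_fun_continuous: "polynomial_fun f \<Longrightarrow> continuous_on S f"
  by (auto intro!: continuous_at_imp_continuous_on holo_at_continuous holo_at_polynomial)

lemma holo_at_line:
  assumes "holo_at f (z + tuple_scale t v)"
  shows "(\<lambda>t. f (z + tuple_scale t v)) field_differentiable (at t)"
proof -
  obtain f' where f': "(f has_derivative f') (at (z + tuple_scale t v))"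
    "\<And>c v. f' (tuple_scale c v) = c * f' v"
    using assms by (auto simp: holo_at_def)
  have "((\<lambda>t. z + tuple_scale t v) has_derivative (\<lambda>t. tuple_scale t v)) (at t)"
    by (rule derivative_eq_intros bounded_linear.has_derivative[OF bounded_linear_tuple_scale] refl)+ simp
  from has_derivative_compose[OF this f'(1)]
  have "((\<lambda>t. f (z + tuple_scale t v)) has_derivative (\<lambda>t. f' v * t)) (at t)"
    by (simp add: f'(2) mult.commute)
  then show ?thesis
    by (auto simp: field_differentiable_def has_field_derivative_def)
qed

lemma continuous_on_line: "continuous_on S (\<lambda>t. z + tuple_scale t v)"
  by (intro continuous_intros linear_continuous_on bounded_linear_tuple_scale)

lemma holomorphic_on_line:
  assumes "holomorphic_fun D f" "open D"
  shows "(\<lambda>t. f (z + tuple_scale t v)) holomorphic_on {t. z + tuple_scale t v \<in> D}"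
    and "open {t. z + tuple_scale t v \<in> D}"
proof -
  show "open {t. z + tuple_scale t v \<in> D}"
    using open_vimage[OF assms(2), of "\<lambda>t. z + tuple_scale t v"] continuous_on_line
    by (auto simp: vimage_def)
  show "(\<lambda>t. f (z + tuple_scale t v)) holomorphic_on {t. z + tuple_scale t v \<in> D}"
    using assms by (auto simp: holomorphic_on_def holomorphic_fun_iff
        intro!: field_differentiable_at_within holo_at_line)
qed


text \<open>The values at \<open>z\<close> of a family of \<open>n\<^sup>2\<close> matrix functions, as the rows of a matrix.\<close>

definition value_matrix ::
    "('n \<times> 'n \<Rightarrow> ('d::finite, 'n::finite) mtuple \<Rightarrow> 'n cmat) \<Rightarrow> ('d, 'n) mtuple \<Rightarrow> ('n \<times> 'n) cmat" where
  "value_matrix X z = (\<chi> p q. X p z $ fst q $ snd q)"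

lemma exists_value_matrix:
  fixes z :: "('d::finite, 'n::finite) mtuple"
  assumes "z \<in> generating_tuples"
  obtains X :: "'n \<times> 'n \<Rightarrow> ('d, 'n) mtuple \<Rightarrow> 'n cmat"
  where "\<forall>p. nc_polynomial (X p)" "det (value_matrix X z) \<noteq> 0"
proof -
  have "\<forall>p. \<exists>X. nc_polynomial X \<and> X z = matrix_unit (fst p) (snd p)"
    using generating_tuples_nc_polynomial[OF assms] by metis
  then obtain X where X: "\<And>p. nc_polynomial (X p)" "\<And>p. X p z = matrix_unit (fst p) (snd p)"
    by metis
  have "value_matrix X z = mat 1"
    by (auto simp: vec_eq_iff value_matrix_def X matrix_unit_nth mat_nth)
  then show ?thesis using that[of X] X(1) by simp
qed

lemma polynomial_fun_det_value_matrix: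
  "(\<And>p. nc_polynomial (X p)) \<Longrightarrow> polynomial_fun (\<lambda>z. det (value_matrix X z))"
  by (rule polynomial_fun_det) (simp add: value_matrix_def nc_polynomial_entry)

text \<open>The coordinates of a matrix with respect to the basis \<open>X p z\<close>, by Cramer's rule.\<close>

definition value_coord :: "('n \<times> 'n \<Rightarrow> ('d::finite, 'n::finite) mtuple \<Rightarrow> 'n cmat) \<Rightarrow>
    ('d, 'n) mtuple \<Rightarrow> 'n cmat \<Rightarrow> 'n \<times> 'n \<Rightarrow> complex" where
  "value_coord X z A p =
     det (\<chi> i j. if j = p then A $ fst i $ snd i else X j z $ fst i $ snd i) / det (value_matrix X z)"

lemma value_coord:
  fixes X :: "'n \<times> 'n \<Rightarrow> ('d::finite, 'n::finite) mtuple \<Rightarrow> 'n cmat"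
  assumes "det (value_matrix X z) \<noteq> 0"
  shows "A = (\<Sum>p\<in>UNIV. mat_scale (value_coord X z A p) (X p z))"
proof -
  define b :: "complex^('n \<times> 'n)" where "b = (\<chi> q. A $ fst q $ snd q)"
  define x :: "complex^('n \<times> 'n)" where "x = (\<chi> p. value_coord X z A p)"
  let ?W = "transpose (value_matrix X z)"
  have "det ?W \<noteq> 0" using assms by (simp add: det_transpose)
  moreover have eq: "(\<chi> i j. if j = k then b $ i else ?W $ i $ j)
      = (\<chi> i j. if j = k then A $ fst i $ snd i else X j z $ fst i $ snd i)" for k
    by (auto simp: vec_eq_iff b_def transpose_def value_matrix_def)
  have "x = (\<chi> k. det (\<chi> i j. if j = k then b $ i else ?W $ i $ j) / det ?W)"
    by (simp only: x_def value_coord_def eq det_transpose)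
  ultimately have "?W *v x = b" using cramer[of ?W x b] by blast
  then have "(\<Sum>p\<in>UNIV. value_coord X z A p * X p z $ i $ j) = A $ i $ j" for i j
    by (simp add: vec_eq_iff matrix_vector_mult_def transpose_def value_matrix_def b_def x_def
        mult.commute)
  then show ?thesis by (simp add: vec_eq_iff)
qed

lemma value_matrix_generating:
  fixes X :: "'n \<times> 'n \<Rightarrow> ('d::finite, 'n::finite) mtuple \<Rightarrow> 'n cmat"
  assumes "\<And>p. nc_polynomial (X p)" "det (value_matrix X z) \<noteq> 0"
  shows "z \<in> generating_tuples"
proof -
  have "A \<in> generated_algebra z" for A
    by (subst value_coord[OF assms(2), of A], intro generated_algebra_sum generated_algebra.scale)
      (use assms(1) generated_algebra_nc_polynomial in blast)
  then show ?thesis by (auto simp: generating_tuples_def)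
qed

lemma exists_polynomial_generating:
  assumes "z \<in> (generating_tuples :: ('d::finite, 'n::finite) mtuple set)"
  obtains D :: "('d::finite, 'n::finite) mtuple \<Rightarrow> complex"
  where "polynomial_fun D" "D z \<noteq> 0" "\<And>w. D w \<noteq> 0 \<Longrightarrow> w \<in> generating_tuples"
proof -
  from exists_value_matrix[OF assms] obtain X :: "'n \<times> 'n \<Rightarrow> ('d, 'n) mtuple \<Rightarrow> 'n cmat"
    where X: "\<forall>p. nc_polynomial (X p)" "det (value_matrix X z) \<noteq> 0" .
  show ?thesis
  proof (rule that)
    show "polynomial_fun (\<lambda>z. det (value_matrix X z))"
      by (rule polynomial_fun_det_value_matrix) (use X in auto)
    show "w \<in> generating_tuples" if "det (value_matrix X w) \<noteq> 0" for w
      by (rule value_matrix_generating[OF _ that]) (use X in auto)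
  qed (rule X)
qed

lemma open_generating_tuples: "open (generating_tuples :: ('d::finite, 'n::finite) mtuple set)"
proof (subst open_subopen, safe)
  fix z :: "('d, 'n) mtuple" assume "z \<in> generating_tuples"
  from exists_polynomial_generating[OF this] obtain D :: "('d, 'n) mtuple \<Rightarrow> complex"
    where D: "polynomial_fun D" "D z \<noteq> 0" "\<And>w. D w \<noteq> 0 \<Longrightarrow> w \<in> generating_tuples" by metis
  have "open {w. D w \<noteq> 0}"
    using polynomial_fun_continuous[OF D(1)] by (intro open_Collect_neq) auto
  then show "\<exists>T. open T \<and> z \<in> T \<and> T \<subseteq> generating_tuples"
    using D by (intro exI[of _ "{w. D w \<noteq> 0}"]) auto
qed

lemma finite_line_nongenerating:
  assumes "z \<in> generating_tuples"
  shows "finite {t. z + tuple_scale t v \<notin> generating_tuples}"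
proof -
  from exists_polynomial_generating[OF assms]
  obtain D where D: "polynomial_fun D" "D z \<noteq> 0" "\<And>w. D w \<noteq> 0 \<Longrightarrow> w \<in> generating_tuples" by metis
  obtain p where p: "\<And>t. D (z + tuple_scale t v) = poly p t"
    using polynomial_fun_on_line[OF D(1)] by metis
  have "p \<noteq> 0" using p[of 0] D(2) by auto
  moreover have "{t. z + tuple_scale t v \<notin> generating_tuples} \<subseteq> {t. poly p t = 0}"
    using D(3) p by (metis (mono_tags, lifting) Collect_mono)
  ultimately show ?thesis
    using finite_subset poly_roots_finite by blast
qed

lemma closure_generating_tuples:
  assumes "(w :: ('d::finite, 'n::finite) mtuple) \<in> generating_tuples"
  shows "closure (generating_tuples :: ('d::finite, 'n::finite) mtuple set) = UNIV"
proof -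
  have "z \<in> closure generating_tuples" for z :: "('d, 'n) mtuple"
  proof -
    \<comment> \<open>the line through \<open>w\<close> and \<open>z\<close> contains generating tuples arbitrarily close to \<open>z\<close>\<close>
    define T where "T = {t. w + tuple_scale t (z - w) \<notin> generating_tuples}"
    have "finite T" unfolding T_def by (rule finite_line_nongenerating[OF assms])
    then have "open (- (T - {1}))" by (intro open_Compl finite_imp_closed finite_Diff)
    then have "\<forall>\<^sub>F t in at 1. t \<notin> T"
      unfolding eventually_at_topological by (intro exI[of _ "- (T - {1})"]) auto
    then have ev: "\<forall>\<^sub>F t in at 1. w + tuple_scale t (z - w) \<in> closure generating_tuples"
      by (rule eventually_mono) (use closure_subset in \<open>auto simp: T_def\<close>)
    have "isCont (\<lambda>t. w + tuple_scale t (z - w)) 1"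
      using continuous_on_line[of UNIV w "z - w"] by (simp add: continuous_on_eq_continuous_at)
    then have "((\<lambda>t. w + tuple_scale t (z - w)) \<longlongrightarrow> z) (at 1)"
      by (simp add: isCont_def)
    from Lim_in_closed_set[OF closed_closure ev _ this] show ?thesis by simp
  qed
  then show ?thesis by auto
qed


section \<open>Identity theorem and extension\<close>

text \<open>Continuation along the complex line through \<open>w\<close> and \<open>z\<close>, on which \<open>w\<close> and \<open>z\<close> are the points with
  parameters \<open>0\<close> and \<open>1\<close>.\<close>

lemma holo_zero_on_line:
  assumes h: "holomorphic_fun D h" "open D"
    and W: "open W" "w \<in> W" "W \<subseteq> D" "\<And>x. x \<in> W \<Longrightarrow> h x = 0"
    and conn: "connected {t. w + tuple_scale t (z - w) \<in> D}"
    and z: "z \<in> D"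
  shows "h z = 0"
proof -
  let ?l = "\<lambda>t. w + tuple_scale t (z - w)"
  have op: "open (?l -` W)"
    by (rule open_vimage[OF W(1)]) (rule continuous_on_line)
  have "0 \<in> ?l -` W" using W by simp
  then have ne: "?l -` W \<noteq> {}" by blast
  have "h (?l 1) = (\<lambda>t. 0) (1::complex)"
    by (intro analytic_continuation_open[of "?l -` W" "{t. ?l t \<in> D}" "\<lambda>t. h (?l t)" "\<lambda>t. 0" 1]
        holomorphic_on_line[OF h] conn) (use W z op ne in auto)
  then show ?thesis by simp
qed

lemma convex_line_preimage:
  assumes "convex B"
  shows "convex {t. w + tuple_scale t v \<in> B}"
proof (rule convexI, clarify)
  fix x y u r assume *: "w + tuple_scale x v \<in> B" "w + tuple_scale y v \<in> B"
    "0 \<le> u" "0 \<le> r" "u + r = (1::real)"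
  have "w = u *\<^sub>R w + r *\<^sub>R w" using *(5) by (simp flip: scaleR_add_left)
  moreover have "tuple_scale (u *\<^sub>R x + r *\<^sub>R y) v = u *\<^sub>R tuple_scale x v + r *\<^sub>R tuple_scale y v"
    by (simp add: vec_eq_iff algebra_simps)
  ultimately have "w + tuple_scale (u *\<^sub>R x + r *\<^sub>R y) v
      = u *\<^sub>R (w + tuple_scale x v) + r *\<^sub>R (w + tuple_scale y v)"
    by (simp add: scaleR_add_right)
  then show "w + tuple_scale (u *\<^sub>R x + r *\<^sub>R y) v \<in> B"
    using convexD[OF assms *(1,2,3,4,5)] by simp
qed

lemma holo_identity_connected:
  assumes h: "holomorphic_fun D h" "open D" "connected D"
    and W: "open W" "W \<noteq> {}" "W \<subseteq> D" "\<And>x. x \<in> W \<Longrightarrow> h x = 0"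
    and z: "z \<in> D"
  shows "h z = 0"
proof -
  define A where "A = interior {z \<in> D. h z = 0}"
  have A: "open A" "A \<subseteq> D" "\<And>x. x \<in> A \<Longrightarrow> h x = 0"
    using interior_subset unfolding A_def by auto
  have "W \<subseteq> A" unfolding A_def by (rule interior_maximal) (use W in auto)
  have "open (D - A)"
  proof (subst open_subopen, safe)
    fix x assume x: "x \<in> D" "x \<notin> A"
    then obtain e where e: "e > 0" "ball x e \<subseteq> D" using h(2) by (auto simp: open_contains_ball)
    have "ball x e \<inter> A = {}"
    proof (rule ccontr)
      assume "ball x e \<inter> A \<noteq> {}"
      then obtain w where w: "w \<in> ball x e \<inter> A" by blast
      have "h y = 0" if "y \<in> ball x e" for y
      proof (rule holo_zero_on_line[where D = "ball x e" and W = "ball x e \<inter> A"])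
        show "holomorphic_fun (ball x e) h" using h(1) e by (auto simp: holomorphic_fun_iff)
        show "connected {t. w + tuple_scale t (y - w) \<in> ball x e}"
          by (intro convex_connected convex_line_preimage) auto
      qed (use w A that in auto)
      then have "ball x e \<subseteq> A" unfolding A_def by (intro interior_maximal) (use e in auto)
      then show False using x e centre_in_ball[of x e] by blast
    qed
    then show "\<exists>T. open T \<and> x \<in> T \<and> T \<subseteq> D - A"
      using e by (intro exI[of _ "ball x e"]) auto
  qed
  moreover have "D \<subseteq> A \<union> (D - A)" "A \<inter> (D - A) \<inter> D = {}" "A \<inter> D \<noteq> {}"
    using A W \<open>W \<subseteq> A\<close> by auto
  ultimately have "(D - A) \<inter> D = {}" using connectedD[OF h(3) A(1)] by blast
  then show ?thesis using z A(3) by auto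
qed

lemma connected_line_generating:
  assumes "w \<in> generating_tuples" "convex B" "open B"
  shows "connected {t. w + tuple_scale t v \<in> generating_tuples \<inter> B}"
proof -
  have eq: "{t. w + tuple_scale t v \<in> generating_tuples \<inter> B}
      = {t. w + tuple_scale t v \<in> B} - {t. w + tuple_scale t v \<notin> generating_tuples}"
    by auto
  have "open {t. w + tuple_scale t v \<in> B}"
    using open_vimage[OF assms(3) continuous_on_line[of UNIV w v]] by (simp add: vimage_def)
  then show ?thesis unfolding eq
    by (intro connected_open_diff_countable convex_connected convex_line_preimage assms
        countable_finite finite_line_nongenerating) auto
qed

text \<open>The identity theorem for the generating tuples in a convex open set. Such a set need not be known to
  be connected: each complex line through a point of it meets it in a connected set.\<close>

lemma holo_identity_generating:
  assumes B: "convex B" "open B"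
    and f: "holomorphic_fun (generating_tuples \<inter> B) f"
    and g: "holomorphic_fun (generating_tuples \<inter> B) g"
    and W: "open W" "W \<noteq> {}" "W \<subseteq> generating_tuples \<inter> B" "\<And>x. x \<in> W \<Longrightarrow> f x = g x"
    and z: "z \<in> generating_tuples \<inter> B"
  shows "f z = g z"
proof -
  obtain w where w: "w \<in> W" using W by auto
  have "f z - g z = 0"
  proof (rule holo_zero_on_line[OF _ _ W(1) w W(3) _ connected_line_generating z])
    show "holomorphic_fun (generating_tuples \<inter> B) (\<lambda>z. f z - g z)"
      using f g by (auto simp: holomorphic_fun_iff intro: holo_at_diff)
  qed (use B w W open_generating_tuples in auto)
  then show ?thesis by simp
qed

lemma connected_generating_tuples: "connected (generating_tuples :: ('d::finite, 'n::finite) mtuple set)"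
proof (subst connected_iff_connected_component, clarify)
  fix w z :: "('d, 'n) mtuple" assume wz: "w \<in> generating_tuples" "z \<in> generating_tuples"
  let ?T = "{t. w + tuple_scale t (z - w) \<in> generating_tuples \<inter> UNIV}"
  let ?C = "(\<lambda>t. w + tuple_scale t (z - w)) ` ?T"
  have "connected ?C"
    by (intro connected_continuous_image continuous_on_line connected_line_generating wz) auto
  moreover have "w \<in> ?C" by (rule image_eqI[of _ _ 0]) (use wz in auto)
  moreover have "z \<in> ?C" by (rule image_eqI[of _ _ 1]) (use wz in auto)
  moreover have "?C \<subseteq> generating_tuples" by auto
  ultimately show "connected_component generating_tuples w z"
    unfolding connected_component_def by blast
qed

lemma continuous_eq_on_dense:
  fixes f g :: "'a::topological_space \<Rightarrow> 'b::t2_space"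
  assumes "open U" "continuous_on U f" "continuous_on U g" "closure V = UNIV"
    "\<And>z. z \<in> U \<inter> V \<Longrightarrow> f z = g z" "z \<in> U"
  shows "f z = g z"
proof (rule ccontr)
  assume "f z \<noteq> g z"
  then obtain S T where ST: "open S" "open T" "f z \<in> S" "g z \<in> T" "S \<inter> T = {}"
    using hausdorff[OF \<open>f z \<noteq> g z\<close>] by blast
  let ?O = "(U \<inter> f -` S) \<inter> (U \<inter> g -` T)"
  have "open ?O"
    using assms(1-3) ST(1,2) by (intro open_Int continuous_open_preimage)
  moreover have "z \<in> ?O" using ST(3,4) assms(6) by auto
  moreover have "z \<in> closure V" using assms(4) by simp
  ultimately obtain y where "y \<in> V" "y \<in> ?O" by (meson closure_iff_nhds_not_empty disjoint_iff order_refl)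
  then show False using ST(5) assms(5)[of y] by auto
qed


text \<open>Directional derivatives of a holomorphic function are continuous, by Cauchy's inequality for the
  difference of the restrictions to two parallel complex lines.\<close>

lemma continuous_derivative:
  fixes f :: "('d::finite, 'n::finite) mtuple \<Rightarrow> complex"
  assumes D: "open D"
    and f': "\<And>w. w \<in> D \<Longrightarrow> (f has_derivative f' w) (at w)"
    and lin: "\<And>w c v. w \<in> D \<Longrightarrow> f' w (tuple_scale c v) = c * f' w v"
  shows "continuous_on D (\<lambda>w. f' w v)"
proof -
  have hol: "holomorphic_fun D f"
    unfolding holomorphic_fun_def using f' lin by blast
  have line: "((\<lambda>t. f (w + tuple_scale t v)) has_field_derivative f' w v) (at 0)" if "w \<in> D" for w
  proof -
    have "((\<lambda>t. w + tuple_scale t v) has_derivative (\<lambda>t. tuple_scale t v)) (at 0)"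
      by (rule derivative_eq_intros bounded_linear.has_derivative[OF bounded_linear_tuple_scale] refl)+ simp
    moreover have "(f has_derivative f' w) (at (w + tuple_scale 0 v))" using f'[OF that] by simp
    ultimately have "((\<lambda>t. f (w + tuple_scale t v)) has_derivative (\<lambda>t. f' w (tuple_scale t v))) (at 0)"
      by (rule has_derivative_compose)
    moreover have "(\<lambda>t. f' w (tuple_scale t v)) = (*) (f' w v)"
      by (auto simp: lin[OF that] fun_eq_iff)
    ultimately show ?thesis by (simp add: has_field_derivative_def)
  qed
  show ?thesis unfolding continuous_on_iff
  proof (intro ballI allI impI)
    fix w0 and \<epsilon> :: real assume w0: "w0 \<in> D" and \<epsilon>: "\<epsilon> > 0"
    obtain e where e: "e > 0" "cball w0 e \<subseteq> D" using D w0 open_contains_cball by blast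
    \<comment> \<open>discs of radius \<open>\<rho>\<close> in the direction of \<open>v\<close> stay within \<open>e / 2\<close> of their centre\<close>
    define \<rho> where "\<rho> = e / (2 * (norm v + 1))"
    have \<rho>: "\<rho> > 0" "\<rho> * norm v \<le> e / 2"
    proof -
      show "\<rho> > 0" unfolding \<rho>_def using e by (simp add: add_nonneg_pos)
      then have "\<rho> * norm v \<le> \<rho> * (norm v + 1)" by simp
      also have "\<dots> = e / 2" unfolding \<rho>_def by (simp add: field_simps add_nonneg_eq_0_iff)
      finally show "\<rho> * norm v \<le> e / 2" .
    qed
    have "uniformly_continuous_on (cball w0 e) f"
      using holomorphic_fun_continuous_on[OF hol] e
      by (intro compact_uniformly_continuous) (auto intro: continuous_on_subset)
    moreover have "\<epsilon> * \<rho> / 2 > 0" using \<epsilon> \<rho> by simp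
    ultimately obtain \<delta> where \<delta>: "\<delta> > 0" and unif:
      "\<And>x y. x \<in> cball w0 e \<Longrightarrow> y \<in> cball w0 e \<Longrightarrow> dist y x < \<delta> \<Longrightarrow> dist (f y) (f x) < \<epsilon> * \<rho> / 2"
      unfolding uniformly_continuous_on_def by meson
    show "\<exists>d>0. \<forall>w\<in>D. dist w w0 < d \<longrightarrow> dist (f' w v) (f' w0 v) < \<epsilon>"
    proof (intro exI[of _ "min \<delta> (e/2)"] conjI ballI impI)
      fix w assume w: "w \<in> D" "dist w w0 < min \<delta> (e/2)"
      have in1: "w + tuple_scale t v \<in> cball w0 e" "w0 + tuple_scale t v \<in> cball w0 e"
        if "t \<in> cball 0 \<rho>" for t
      proof -
        have "norm (tuple_scale t v) \<le> \<rho> * norm v"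
          using that by (simp add: norm_tuple_scale mult_right_mono)
        then have *: "norm (tuple_scale t v) \<le> e / 2" using \<rho>(2) by linarith
        show "w0 + tuple_scale t v \<in> cball w0 e"
          using * e(1) by (simp add: dist_norm)
        have "dist w0 (w + tuple_scale t v) \<le> dist w0 w + norm (tuple_scale t v)"
          using norm_triangle_ineq4[of "w0 - w" "tuple_scale t v"] by (simp add: dist_norm diff_diff_eq)
        then show "w + tuple_scale t v \<in> cball w0 e"
          using * w(2) by (simp add: dist_commute)
      qed
      define g where "g = (\<lambda>t. f (w + tuple_scale t v) - f (w0 + tuple_scale t v))"
      have sub: "cball 0 \<rho> \<subseteq> {t. w + tuple_scale t v \<in> D}" "cball 0 \<rho> \<subseteq> {t. w0 + tuple_scale t v \<in> D}"
        using in1 e(2) by blast+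
      have g: "g holomorphic_on cball 0 \<rho>" unfolding g_def
        by (intro holomorphic_on_diff holomorphic_on_subset[OF holomorphic_on_line(1)[OF hol D]] sub)
      have "cmod ((deriv ^^ 1) g 0) \<le> fact 1 * (\<epsilon> * \<rho> / 2) / \<rho> ^ 1"
      proof (rule Cauchy_inequality)
        show "g holomorphic_on ball 0 \<rho>" using g by (rule holomorphic_on_subset) auto
        show "continuous_on (cball 0 \<rho>) g" using g by (rule holomorphic_on_imp_continuous_on)
        show "cmod (g t) \<le> \<epsilon> * \<rho> / 2" if "cmod (0 - t) = \<rho>" for t
        proof -
          have "dist (w + tuple_scale t v) (w0 + tuple_scale t v) < \<delta>" using w(2) by simp
          from unif[OF in1(2) in1(1) this] show ?thesis using that by (simp add: g_def dist_norm)
        qed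
      qed (rule \<rho>)
      moreover have "(g has_field_derivative f' w v - f' w0 v) (at 0)"
        unfolding g_def by (intro DERIV_diff line w w0)
      then have "deriv g 0 = f' w v - f' w0 v" by (rule DERIV_imp_deriv)
      ultimately have "cmod (f' w v - f' w0 v) \<le> \<epsilon> / 2" using \<rho> by simp
      then show "dist (f' w v) (f' w0 v) < \<epsilon>" using \<epsilon> by (simp add: dist_norm)
    qed (use \<delta> e in auto)
  qed
qed


text \<open>The mean value of \<open>f\<close> over the circle of radius \<open>R\<close> around \<open>z\<close> in the direction of \<open>v\<close>.\<close>

definition circle_mean :: "real \<Rightarrow> ('d::finite, 'n::finite) mtuple \<Rightarrow>
    (('d, 'n) mtuple \<Rightarrow> complex) \<Rightarrow> ('d, 'n) mtuple \<Rightarrow> complex" where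
  "circle_mean R v f z =
     integral (cbox 0 1) (\<lambda>x::real. f (z + tuple_scale (R * exp (2 * of_real pi * \<i> * x)) v))"

text \<open>Differentiation under the integral sign.\<close>

lemma holomorphic_circle_mean:
  fixes f :: "('d::finite, 'n::finite) mtuple \<Rightarrow> complex"
  assumes f: "holomorphic_fun D f" "open D" and B: "open B" "convex B"
    and sub: "\<And>z t. z \<in> B \<Longrightarrow> cmod t = \<bar>R\<bar> \<Longrightarrow> z + tuple_scale t v \<in> D"
  shows "holomorphic_fun B (circle_mean R v f)"
proof -
  obtain f' where f': "\<And>w. w \<in> D \<Longrightarrow> (f has_derivative f' w) (at w)"
      and lin: "\<And>w c v. w \<in> D \<Longrightarrow> f' w (tuple_scale c v) = c * f' w v"
    using f(1) unfolding holomorphic_fun_def by metis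
  define c where "c = (\<lambda>x::real. complex_of_real R * exp (2 * of_real pi * \<i> * of_real x))"
  have cmodc: "cmod (c x) = \<bar>R\<bar>" for x by (simp add: c_def norm_mult)
  define F where "F = (\<lambda>w. Blinfun (f' w))"
  have F: "blinfun_apply (F w) = f' w" if "w \<in> D" for w
    unfolding F_def
    by (rule bounded_linear_Blinfun_apply) (use f'[OF that] in \<open>auto simp: has_derivative_def\<close>)
  have contF: "continuous_on D F"
    by (rule continuous_on_blinfun_componentwise)
      (use continuous_derivative[OF f(2) f' lin] in \<open>simp add: F cong: continuous_on_cong\<close>)
  have contc: "continuous_on S c" for S unfolding c_def by (intro continuous_intros)
  have contz: "continuous_on S (\<lambda>p. fst p + tuple_scale (c (snd p)) v)" for S :: "(('d, 'n) mtuple \<times> real) set"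
    by (intro continuous_intros continuous_on_compose2[OF linear_continuous_on[OF bounded_linear_tuple_scale]]
        continuous_on_compose2[OF contc]) auto
  have contz1: "continuous_on S (\<lambda>x. z + tuple_scale (c x) v)" for S and z :: "('d, 'n) mtuple"
    by (intro continuous_intros continuous_on_compose2[OF linear_continuous_on[OF bounded_linear_tuple_scale]]
        contc) auto
  have inD: "z + tuple_scale (c x) v \<in> D" if "z \<in> B" for z x using sub[OF that cmodc] .
  have eq: "circle_mean R v f = (\<lambda>z. integral (cbox 0 1) (\<lambda>x. f (z + tuple_scale (c x) v)))"
    by (simp add: circle_mean_def c_def fun_eq_iff)
  show ?thesis unfolding holomorphic_fun_def eq
  proof
    fix z0 assume z0: "z0 \<in> B"
    let ?F' = "integral (cbox 0 1) (\<lambda>x. F (z0 + tuple_scale (c x) v))"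
    have "((\<lambda>z. integral (cbox 0 1) (\<lambda>x. f (z + tuple_scale (c x) v))) has_derivative ?F') (at z0 within B)"
    proof (rule leibniz_rule[where fx = "\<lambda>z x. F (z + tuple_scale (c x) v)" and U = B])
      fix z x assume z: "z \<in> B"
      have "((\<lambda>z. z + tuple_scale (c x) v) has_derivative (\<lambda>h. h)) (at z)"
        by (auto intro!: derivative_eq_intros)
      from has_derivative_compose[OF this f'[OF inD[OF z]]]
      show "((\<lambda>z. f (z + tuple_scale (c x) v)) has_derivative blinfun_apply (F (z + tuple_scale (c x) v))) (at z within B)"
        by (simp add: F inD[OF z] has_derivative_at_withinI)
    next
      fix z assume "z \<in> B"
      then show "(\<lambda>x. f (z + tuple_scale (c x) v)) integrable_on cbox 0 1"
        by (intro integrable_continuous continuous_on_compose2[OF holomorphic_fun_continuous_on[OF f(1)] contz1])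
          (auto intro: inD)
    next
      show "continuous_on (B \<times> cbox 0 1) (\<lambda>(z, x). F (z + tuple_scale (c x) v))"
        unfolding split_beta
        by (rule continuous_on_compose2[OF contF contz]) (auto intro: inD)
    qed (use z0 B in auto)
    then have "((\<lambda>z. integral (cbox 0 1) (\<lambda>x. f (z + tuple_scale (c x) v))) has_derivative ?F') (at z0)"
      using at_within_open[OF z0 B(1)] by simp
    moreover have "?F' (tuple_scale a u) = a * ?F' u" for a u
    proof -
      have int: "(\<lambda>x. F (z0 + tuple_scale (c x) v)) integrable_on cbox 0 1"
        by (rule integrable_continuous, rule continuous_on_compose2[OF contF contz1])
          (auto intro: inD z0)
      have app: "?F' u = integral (cbox 0 1) (\<lambda>x. f' (z0 + tuple_scale (c x) v) u)" for u
        using integral_linear[OF int blinfun.bounded_linear_left[of u]]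
        by (simp add: o_def F inD z0)
      show ?thesis unfolding app by (simp add: lin inD z0)
    qed
    ultimately show "\<exists>F'. ((\<lambda>z. integral (cbox 0 1) (\<lambda>x. f (z + tuple_scale (c x) v))) has_derivative F') (at z0)
        \<and> (\<forall>a u. F' (tuple_scale a u) = a * F' u)" by blast
  qed
qed

lemma circle_mean_eq:
  assumes f: "holomorphic_fun D f" "open D" and R: "R > 0"
    and sub: "\<And>t. cmod t \<le> R \<Longrightarrow> z + tuple_scale t v \<in> D"
  shows "circle_mean R v f z = f z"
proof -
  define g where "g = (\<lambda>t. f (z + tuple_scale t v))"
  have g: "g holomorphic_on cball 0 R" unfolding g_def
    by (rule holomorphic_on_subset[OF holomorphic_on_line(1)[OF f]]) (use sub in auto)
  have "((\<lambda>u. g u / (u - 0)) has_contour_integral (2 * of_real pi * \<i> * g 0)) (circlepath 0 R)"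
    by (rule Cauchy_integral_circlepath)
      (use R g in \<open>auto intro: holomorphic_on_imp_continuous_on holomorphic_on_subset\<close>)
  then have "((\<lambda>x. 2 * of_real pi * \<i> * g (R * exp (2 * of_real pi * \<i> * of_real x))) has_integral
      2 * of_real pi * \<i> * g 0) (cbox 0 1)"
    unfolding has_contour_integral_def box_real
    by (rule has_integral_eq[rotated])
      (subst vector_derivative_circlepath01, use R in \<open>auto simp: circlepath\<close>)
  from has_integral_mult_right[OF this, of "1 / (2 * of_real pi * \<i>)"]
  have "((\<lambda>x. g (R * exp (2 * of_real pi * \<i> * of_real x))) has_integral g 0) (cbox 0 1)"
    by simp
  from integral_unique[OF this] show ?thesis by (simp add: circle_mean_def g_def)
qed

text \<open>Extension across the tuples that do not generate. These tuples form a closed cone, and the complex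
  line through \<open>z0\<close> in the direction of \<open>v\<close> avoids it, including its point at infinity. So the means
  over large circles in the direction of \<open>v\<close> are holomorphic on large balls, and by Cauchy's formula
  they have the values of \<open>f\<close> near \<open>z0\<close>.\<close>

lemma extension_of_avoiding_line:
  fixes f :: "('d::finite, 'n::finite) mtuple \<Rightarrow> complex" and v z0 :: "('d, 'n) mtuple"
  assumes f: "holomorphic_fun generating_tuples f"
    and v: "v \<in> generating_tuples"
    and z0: "\<And>t. z0 + tuple_scale t v \<in> generating_tuples"
  obtains F :: "('d, 'n) mtuple \<Rightarrow> complex"
  where "holomorphic_fun UNIV F" "\<And>z. z \<in> generating_tuples \<Longrightarrow> F z = f z"
proof -
  obtain \<epsilon> where \<epsilon>: "\<epsilon> > 0" "ball v \<epsilon> \<subseteq> generating_tuples"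
    using open_generating_tuples v open_contains_ball by blast
  \<comment> \<open>if \<open>norm z < \<rho>\<close> and \<open>cmod t = R \<rho>\<close>, then \<open>v + z / t\<close> is in the ball around \<open>v\<close>\<close>
  define R where "R = (\<lambda>\<rho>. \<bar>\<rho>\<bar> / \<epsilon> + 1)"
  define F where "F = (\<lambda>\<rho>. circle_mean (R \<rho>) v f)"
  have Rpos: "R \<rho> > 0" for \<rho> unfolding R_def using \<epsilon> by (simp add: add_nonneg_pos)
  have far: "z + tuple_scale t v \<in> generating_tuples" if "norm z < \<rho>" "cmod t = R \<rho>" for z t \<rho>
  proof -
    have t: "t \<noteq> 0" using that Rpos[of \<rho>] by auto
    have "\<epsilon> * R \<rho> = \<bar>\<rho>\<bar> + \<epsilon>" using \<epsilon>(1) by (simp add: R_def distrib_left)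
    then have "norm z < \<epsilon> * R \<rho>" using that(1) \<epsilon>(1) by linarith
    then have "norm (tuple_scale (1/t) z) < \<epsilon>"
      using Rpos[of \<rho>] that(2) by (simp add: norm_tuple_scale norm_divide field_simps)
    then have "v + tuple_scale (1/t) z \<in> generating_tuples" using \<epsilon>(2) by (auto simp: dist_norm)
    from generating_tuples_scale[OF this t] show ?thesis
      using t by (simp add: tuple_scale_add add.commute)
  qed
  have holF: "holomorphic_fun (ball 0 \<rho>) (F \<rho>)" for \<rho>
    unfolding F_def
    by (rule holomorphic_circle_mean[OF f open_generating_tuples])
      (use far Rpos[of \<rho>] in auto)
  have Feq: "F \<rho> z = f z" if \<rho>: "norm z0 < \<rho>" and z: "z \<in> generating_tuples \<inter> ball 0 \<rho>" for \<rho> z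
  proof -
    let ?K = "(\<lambda>t. z0 + tuple_scale t v) ` cball 0 (R \<rho>)"
    have "compact ?K"
      by (intro compact_continuous_image continuous_on_line) auto
    moreover have "?K \<subseteq> generating_tuples" using z0 by auto
    ultimately obtain \<delta> where \<delta>: "\<delta> > 0" "(\<Union>x\<in>?K. ball x \<delta>) \<subseteq> generating_tuples"
      using compact_subset_open_imp_ball_epsilon_subset[OF _ open_generating_tuples] by metis
    have near: "w + tuple_scale t v \<in> generating_tuples" if "w \<in> ball z0 \<delta>" "cmod t \<le> R \<rho>" for w t
      using \<delta>(2) that by (force simp: dist_norm)
    show ?thesis
    proof (rule holo_identity_generating[of "ball 0 \<rho>" _ _ "ball z0 \<delta> \<inter> ball 0 \<rho>"])
      have "z0 \<in> ball z0 \<delta> \<inter> ball 0 \<rho>" using \<delta>(1) \<rho> by simp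
      then show "ball z0 \<delta> \<inter> ball 0 \<rho> \<noteq> {}" by blast
      show "ball z0 \<delta> \<inter> ball 0 \<rho> \<subseteq> generating_tuples \<inter> ball 0 \<rho>"
        using near[where t = 0] Rpos[of \<rho>] by auto
      show "F \<rho> w = f w" if "w \<in> ball z0 \<delta> \<inter> ball 0 \<rho>" for w
        unfolding F_def by (rule circle_mean_eq[OF f open_generating_tuples Rpos])
          (use near that in auto)
    qed (use f holF z in \<open>auto simp: holomorphic_fun_iff\<close>)
  qed
  have dense: "closure (generating_tuples :: ('d, 'n) mtuple set) = UNIV"
    by (rule closure_generating_tuples[OF v])
  \<comment> \<open>the functions \<open>F \<rho>\<close> with \<open>norm z0 < \<rho>\<close> agree where they are defined, by density\<close>
  define G where "G = (\<lambda>z. F (norm z + norm z0 + 1) z)"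
  have lt: "norm z < norm z + norm z0 + 1" "norm z0 < norm z + norm z0 + 1" for z :: "('d, 'n) mtuple"
    using norm_ge_zero[of z0] norm_ge_zero[of z] by linarith+
  have GF: "G z = F \<rho> z" if "norm z0 < \<rho>" "z \<in> ball 0 \<rho>" for \<rho> z
  proof -
    let ?U = "ball 0 \<rho> \<inter> ball 0 (norm z + norm z0 + 1)"
    have "F (norm z + norm z0 + 1) z = F \<rho> z"
    proof (rule continuous_eq_on_dense[where U = ?U and z = z and f = "F (norm z + norm z0 + 1)" and g = "F \<rho>",
        OF _ _ _ dense])
    show "continuous_on ?U (F (norm z + norm z0 + 1))" "continuous_on ?U (F \<rho>)"
      using holomorphic_fun_continuous_on[OF holF] continuous_on_subset by blast+
    show "z \<in> ?U" using that lt by simp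
    show "F (norm z + norm z0 + 1) w = F \<rho> w" if "w \<in> ?U \<inter> generating_tuples" for w
      using Feq[of \<rho> w] Feq[of "norm z + norm z0 + 1" w] that \<open>norm z0 < \<rho>\<close> lt by auto
    qed auto
    then show ?thesis by (simp add: G_def)
  qed
  show ?thesis
  proof (rule that)
    show "holomorphic_fun UNIV G" unfolding holomorphic_fun_iff
    proof
      fix z :: "('d, 'n) mtuple"
      define \<rho> where "\<rho> = norm z + norm z0 + 1"
      have \<rho>: "norm z0 < \<rho>" "z \<in> ball 0 \<rho>" using lt[of z] by (auto simp: \<rho>_def)
      show "holo_at G z"
        by (rule holo_at_cong[of "F \<rho>" z "ball 0 \<rho>"])
          (use holF \<rho> GF[OF \<rho>(1)] in \<open>auto simp: holomorphic_fun_iff\<close>)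
    qed
    show "G z = f z" if "z \<in> generating_tuples" for z
      unfolding G_def using Feq[of "norm z + norm z0 + 1" z] that lt[of z] by auto
  qed
qed


section \<open>A complex line of generating tuples\<close>

text \<open>Powers of a matrix with respect to the matrix product.\<close>

primrec mat_power :: "'n::finite cmat \<Rightarrow> nat \<Rightarrow> 'n cmat" where
  "mat_power A 0 = mat 1"
| "mat_power A (Suc k) = A ** mat_power A k"

lemma generated_algebra_power: "A \<in> generated_algebra z \<Longrightarrow> mat_power A k \<in> generated_algebra z"
  by (induction k) (auto intro: generated_algebra.intros)

lemma generated_algebra_diff:
  assumes "A \<in> generated_algebra z" "B \<in> generated_algebra z"
  shows "A - B \<in> generated_algebra z"
proof -
  have "A - B = A + mat_scale (- 1) B" by (simp add: vec_eq_iff)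
  then show ?thesis using assms generated_algebra.add generated_algebra.scale by metis
qed

lemma generated_algebra_unscale:
  "mat_scale c A \<in> generated_algebra z \<Longrightarrow> c \<noteq> 0 \<Longrightarrow> A \<in> generated_algebra z"
  using generated_algebra.scale[of "mat_scale c A" z "1/c"] by simp

text \<open>The only place where it matters that \<open>d\<close> or \<open>n\<close> is greater than \<open>2\<close>. If \<open>d > 2\<close>, one of three components
  of \<open>z0 + t v\<close> does not depend on \<open>t\<close>. If \<open>n > 2\<close>, two components are used. In \<open>v\<close> they are a cyclic
  permutation matrix \<open>C\<close> and the matrix unit \<open>U 0 0\<close>; in \<open>z0\<close> they are a matrix \<open>X\<close> and a nilpotent
  matrix \<open>Y\<close> with \<open>U 0 0 ** Y = Y ** U 0 0 = 0\<close>. Then a power of \<open>Y + t U 0 0\<close> is a multiple of \<open>U 0 0\<close>,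
  so that \<open>Y\<close> and \<open>U 0 0\<close> can be separated for \<open>t \<noteq> 0\<close>; a power of \<open>Y\<close> is the matrix unit \<open>U m 1\<close>.\<close>

lemma exists_generating_line:
  assumes d: "CARD('d::finite) \<ge> 2" and n: "CARD('n::finite) \<ge> 2" and dn: "CARD('d) > 2 \<or> CARD('n) > 2"
  obtains v z0 :: "('d::finite, 'n::finite) mtuple"
  where "v \<in> generating_tuples" "\<And>t. z0 + tuple_scale t v \<in> generating_tuples"
proof -
  define n where "n = CARD('n)"
  obtain e :: "nat \<Rightarrow> 'n" where e: "bij_betw e {0..<n} UNIV"
    using ex_bij_betw_nat_finite[of "UNIV :: 'n set"] by (auto simp: n_def)
  have einj: "e i = e j \<longleftrightarrow> i = j" if "i < n" "j < n" for i j
    using e that by (auto simp: bij_betw_def inj_on_def)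
  have esurj: "\<exists>i<n. a = e i" for a
    using bij_betw_imp_surj_on[OF e] by (metis UNIV_I atLeastLessThan_iff imageE)
  define U where "U = (\<lambda>i j. matrix_unit (e i) (e j))"
  have UU: "U a b ** U c d = (if b = c then U a d else 0)" if "b < n" "c < n" for a b c d
    unfolding U_def matrix_unit_mult using einj[OF that] by simp
  \<comment> \<open>a row and a column of matrix units suffice\<close>
  have gen: "z \<in> generating_tuples"
    if "p < n" "\<And>i. i < n \<Longrightarrow> U i p \<in> generated_algebra z" "\<And>i. i < n \<Longrightarrow> U p i \<in> generated_algebra z"
    for z :: "('d, 'n) mtuple" and p
  proof (rule generating_tuplesI_units)
    fix a b
    obtain i j where "i < n" "j < n" "a = e i" "b = e j" using esurj by metis
    then show "matrix_unit a b \<in> generated_algebra z"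
      using generated_algebra.mult[OF that(2)[of i] that(3)[of j]] UU[of p p i j] that(1)
      by (simp add: U_def)
  qed
  show ?thesis
  proof (cases "n > 2")
    case False
    then have "CARD('d) \<ge> 3" using dn by (simp add: n_def)
    then obtain K where "K \<subseteq> (UNIV :: 'd set)" "card K = 3" by (meson obtain_subset_with_card_n)
    then obtain a b c :: 'd where abc: "a \<noteq> b" "a \<noteq> c" "b \<noteq> c" by (auto simp: card_3_iff)
    have n2: "n = 2" using False n by (simp add: n_def)
    \<comment> \<open>the pair \<open>P\<close>, \<open>Q\<close> generates, and both are in the algebra generated by
      \<open>Q + t P\<close>, \<open>t Q\<close>, \<open>P\<close>\<close>
    define P Q where "P = U 1 0" and "Q = U 0 1"
    have PQ: "z \<in> generating_tuples" if "P \<in> generated_algebra z" "Q \<in> generated_algebra z"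
      for z :: "('d, 'n) mtuple"
    proof (rule gen[of 0])
      have "U 0 0 \<in> generated_algebra z"
        using generated_algebra.mult[OF that(2,1)] UU[of 1 1 0 0] n2 by (simp add: P_def Q_def)
      then show "U i 0 \<in> generated_algebra z" "U 0 i \<in> generated_algebra z" if "i < n" for i
        using \<open>P \<in> _\<close> \<open>Q \<in> _\<close> that n2 by (auto simp: less_2_cases_iff P_def Q_def)
    qed (simp add: n2)
    define v z0 :: "('d, 'n) mtuple"
      where "v = (\<chi> k. if k = a then P else if k = b then Q else 0)"
        and "z0 = (\<chi> k. if k = a then Q else if k = c then P else 0)"
    show ?thesis
    proof (rule that)
      show "v \<in> generating_tuples"
        using generated_algebra.gen[of v a] generated_algebra.gen[of v b] abc
        by (intro PQ) (auto simp: v_def)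
      fix t
      have "P \<in> generated_algebra (z0 + tuple_scale t v)"
        using generated_algebra.gen[of "z0 + tuple_scale t v" c] abc by (simp add: v_def z0_def)
      moreover from this have "Q \<in> generated_algebra (z0 + tuple_scale t v)"
        using generated_algebra.gen[of "z0 + tuple_scale t v" a] abc
          generated_algebra_diff[OF _ generated_algebra.scale, of "Q + mat_scale t P" _ P t]
        by (simp add: v_def z0_def)
      ultimately show "z0 + tuple_scale t v \<in> generating_tuples" by (rule PQ)
    qed
  next
    case True
    obtain K where "K \<subseteq> (UNIV :: 'd set)" "card K = 2" by (meson d obtain_subset_with_card_n)
    then obtain a b :: 'd where ab: "a \<noteq> b" by (auto simp: card_2_iff)
    define m where "m = n - 1"
    have m: "m < n" "m \<ge> 2" "n = Suc m" using True by (auto simp: m_def)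
    \<comment> \<open>\<open>Y\<close> is a nilpotent shift on all but the first basis vector\<close>
    define Y where "Y = (\<Sum>i\<in>{1..<m}. U (Suc i) i)"
    \<comment> \<open>\<open>X\<close> permutes the basis vectors \<open>0\<close>, \<open>1\<close>, \<open>m\<close> cyclically and annihilates any others; \<open>C\<close> permutes all, and has the
      same entries as \<open>Y\<close> outside row and column \<open>0\<close>\<close>
    define X where "X = U m 0 + U 0 1 + U 1 m"
    define C where "C = Y + U 1 0 + U 0 m"
    have YU: "Y ** U i k = (if 1 \<le> i \<and> i < m then U (Suc i) k else 0)" if "i < n" for i k
    proof -
      have "Y ** U i k = (\<Sum>j\<in>{1..<m}. if j = i then U (Suc i) k else 0)"
        unfolding Y_def matrix_mult_sum_left by (intro sum.cong) (use that m UU in auto)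
      then show ?thesis by simp
    qed
    have UY: "U k j ** Y = (if 2 \<le> j \<and> j < n then U k (j - 1) else 0)" if "j < n" for j k
    proof -
      have "U k j ** Y = (\<Sum>i\<in>{1..<m}. if i = j - 1 \<and> j \<ge> 2 then U k (j - 1) else 0)"
        unfolding Y_def matrix_mult_sum_right by (intro sum.cong) (use that m UU in auto)
      then show ?thesis using that m by auto
    qed
    have Ypow: "mat_power Y (Suc k) = (\<Sum>i\<in>{1..<m - k}. U (Suc k + i) i)" for k
    proof (induction k)
      case (Suc k)
      have "mat_power Y (Suc (Suc k)) = (\<Sum>i\<in>{1..<m - k}. Y ** U (Suc k + i) i)"
        using Suc by (simp add: matrix_mult_sum_right)
      also have "\<dots> = (\<Sum>i\<in>{1..<m - k}. if i < m - Suc k then U (Suc (Suc k) + i) i else 0)"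
        by (intro sum.cong) (use YU m in auto)
      also have "\<dots> = (\<Sum>i\<in>{1..<m - Suc k}. U (Suc (Suc k) + i) i)"
        by (intro sum.mono_neutral_cong_right) auto
      finally show ?case .
    qed (simp add: Y_def)
    have Ym1: "mat_power Y (m - 1) = U m 1"
      using Ypow[of "m - 2"] m by (simp add: numeral_2_eq_2 Suc_diff_Suc)
    have Ym: "mat_power Y m = 0"
      using Ypow[of "m - 1"] m by simp
    define v z0 :: "('d, 'n) mtuple"
      where "v = (\<chi> k. if k = a then C else if k = b then U 0 0 else 0)"
        and "z0 = (\<chi> k. if k = a then X else if k = b then Y else 0)"
    \<comment> \<open>right multiplication by \<open>Y\<close> lowers column indices, left multiplication raises row indices\<close>
    have desc: "U k j \<in> generated_algebra z"
      if "Y \<in> generated_algebra z" "U k m \<in> generated_algebra z" "1 \<le> j" "j < n"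
      for k j and z :: "('d, 'n) mtuple"
    proof -
      have "U k (m - i) \<in> generated_algebra z" if "i < m" for i
        using that
      proof (induction i)
        case (Suc i)
        have "2 \<le> m - i" "m - i < n" "m - i - 1 = m - Suc i" using Suc.prems m by auto
        then have "U k (m - i) ** Y = U k (m - Suc i)" using UY[of "m - i" k] by simp
        then show ?case
          using generated_algebra.mult[OF Suc.IH \<open>Y \<in> _\<close>] Suc.prems by simp
      qed (use \<open>U k m \<in> _\<close> in simp)
      from this[of "m - j"] show ?thesis using that m by simp
    qed
    have asc: "U j k \<in> generated_algebra z"
      if "Y \<in> generated_algebra z" "U 1 k \<in> generated_algebra z" "1 \<le> j" "j < n"
      for k j and z :: "('d, 'n) mtuple"
    proof -
      have "Suc i < n \<Longrightarrow> U (Suc i) k \<in> generated_algebra z" for i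
      proof (induction i)
        case (Suc i)
        then show ?case
          using generated_algebra.mult[OF \<open>Y \<in> _\<close> Suc.IH] YU[of "Suc i" k] m by simp
      qed (use \<open>U 1 k \<in> _\<close> in simp)
      from this[of "j - 1"] show ?thesis using that m by simp
    qed
    show ?thesis
    proof (rule that)
      show "v \<in> generating_tuples"
      proof (rule gen[of 0])
        have C: "C \<in> generated_algebra v" and U0: "U 0 0 \<in> generated_algebra v"
          using generated_algebra.gen[of v a] generated_algebra.gen[of v b] ab by (auto simp: v_def)
        show "U i 0 \<in> generated_algebra v" if "i < n" for i
          using that
        proof (induction i)
          case (Suc i)
          have "C ** U i 0 = U (Suc i) 0"
            using Suc.prems m YU[of i 0] by (cases i) (auto simp: C_def matrix_add_rdistrib UU)
          then show ?case using generated_algebra.mult[OF C Suc.IH] Suc.prems by simp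
        qed (rule U0)
        have "U 0 (m - i) \<in> generated_algebra v" if "i < m" for i
          using that
        proof (induction i)
          case 0
          have "U 0 0 ** C = U 0 m"
            using m UY[of 0 0] by (auto simp: C_def matrix_add_ldistrib UU)
          then show ?case using generated_algebra.mult[OF U0 C] by simp
        next
          case (Suc i)
          have "2 \<le> m - i" "m - i < n" "m - i - 1 = m - Suc i" using Suc.prems m by auto
          then have "U 0 (m - i) ** C = U 0 (m - Suc i)"
            using Suc.prems m UY[of "m - i" 0] by (auto simp: C_def matrix_add_ldistrib UU)
          then show ?case using generated_algebra.mult[OF Suc.IH C] Suc.prems by simp
        qed
        then have row: "U 0 (m - i) \<in> generated_algebra v" if "i < m" for i
          using that by blast
        show "U 0 i \<in> generated_algebra v" if "i < n" for i
        proof (cases "i = 0")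
          case False
          then have "m - i < m" "m - (m - i) = i" using that m by auto
          then show ?thesis using row[of "m - i"] by simp
        qed (simp add: U0)
      qed (use m in simp)
    next
      fix t
      let ?G = "generated_algebra (z0 + tuple_scale t v)"
      show "z0 + tuple_scale t v \<in> generating_tuples"
      proof (cases "t = 0")
        case True
        have X: "X \<in> ?G" and Y: "Y \<in> ?G"
          using generated_algebra.gen[of "z0 + tuple_scale t v" a]
            generated_algebra.gen[of "z0 + tuple_scale t v" b] ab True by (auto simp: z0_def)
        have R: "U m 1 \<in> ?G" using generated_algebra_power[OF Y, of "m - 1"] Ym1 by simp
        have "X ** U m 1 = U 1 1" using m by (auto simp: X_def matrix_add_rdistrib UU)
        then have U11: "U 1 1 \<in> ?G" using generated_algebra.mult[OF X R] by simp
        have "X ** U 1 1 = U 0 1" using m by (auto simp: X_def matrix_add_rdistrib UU)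
        then have U01: "U 0 1 \<in> ?G" using generated_algebra.mult[OF X U11] by simp
        have "U 1 1 ** X = U 1 m" using m by (auto simp: X_def matrix_add_ldistrib UU)
        then have U1m: "U 1 m \<in> ?G" using generated_algebra.mult[OF U11 X] by simp
        have "U 1 m ** X = U 1 0" using m by (auto simp: X_def matrix_add_ldistrib UU)
        then have U10: "U 1 0 \<in> ?G" using generated_algebra.mult[OF U1m X] by simp
        show ?thesis
        proof (rule gen[of 1])
          show "U i 1 \<in> ?G" if "i < n" for i
            using that U01 asc[OF Y U11] by (cases "i = 0") auto
          show "U 1 i \<in> ?G" if "i < n" for i
            using that U10 desc[OF Y U1m] by (cases "i = 0") auto
        qed (use m in simp)
      next
        case False
        define N where "N = Y + mat_scale t (U 0 0)"
        have XC: "X + mat_scale t C \<in> ?G" and N: "N \<in> ?G"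
          using generated_algebra.gen[of "z0 + tuple_scale t v" a]
            generated_algebra.gen[of "z0 + tuple_scale t v" b] ab by (auto simp: z0_def v_def N_def)
        have Y0: "U 0 0 ** mat_power Y (Suc k) = 0" for k
          using UY[of 0 0] by (simp add: matrix_mul_assoc m)
        have Npow: "mat_power N (Suc k) = mat_power Y (Suc k) + mat_scale (t ^ Suc k) (U 0 0)" for k
        proof (induction k)
          case (Suc k)
          have "Y ** U 0 0 = 0" using YU[of 0 0] m by simp
          moreover have "mat_power N (Suc (Suc k)) = N ** (mat_power Y (Suc k) + mat_scale (t ^ Suc k) (U 0 0))"
            using Suc by simp
          ultimately show ?case using Y0[of k] UU[of 0 0 0 0] m
            by (simp add: N_def matrix_add_ldistrib matrix_add_rdistrib mat_scale_mult_left
                mat_scale_mult_right del: mat_power.simps) (simp add: ac_simps)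
        qed (simp add: N_def)
        have U0: "U 0 0 \<in> ?G"
        proof (rule generated_algebra_unscale)
          show "mat_scale (t ^ m) (U 0 0) \<in> ?G"
            using Npow[of "m - 1"] m Ym generated_algebra_power[OF N, of m] by simp
        qed (use False in simp)
        have Y: "Y \<in> ?G"
          using generated_algebra_diff[OF N generated_algebra.scale[OF U0, of t]] by (simp add: N_def)
        have R: "U m 1 \<in> ?G" using generated_algebra_power[OF Y, of "m - 1"] Ym1 by simp
        \<comment> \<open>\<open>M\<close> has entries only at the matrix units of \<open>X\<close> and in row and column \<open>0\<close>\<close>
        define M where "M = X + mat_scale t C - mat_scale t Y"
        have M: "M \<in> ?G" unfolding M_def
          by (intro generated_algebra_diff XC generated_algebra.scale Y)
        have Meq: "M = X + mat_scale t (U 1 0) + mat_scale t (U 0 m)"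
          by (simp add: M_def C_def mat_scale_add)
        have c: "M ** U 0 0 = U m 0 + mat_scale t (U 1 0)" using m
          by (auto simp: Meq X_def matrix_add_rdistrib UU mat_scale_mult_left)
        then have c': "U m 0 + mat_scale t (U 1 0) \<in> ?G" using generated_algebra.mult[OF M U0] by simp
        have "U m 1 ** (U m 0 + mat_scale t (U 1 0)) = mat_scale t (U m 0)" using m
          by (auto simp: matrix_add_ldistrib UU mat_scale_mult_right)
        then have Um0: "U m 0 \<in> ?G"
          using generated_algebra_unscale[OF _ False] generated_algebra.mult[OF R c'] by simp
        have U10: "U 1 0 \<in> ?G"
          using generated_algebra_unscale[OF _ False] generated_algebra_diff[OF c' Um0] by simp
        have "U 0 0 ** M = U 0 1 + mat_scale t (U 0 m)" using m
          by (auto simp: Meq X_def matrix_add_ldistrib UU mat_scale_mult_right)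
        then have r': "U 0 1 + mat_scale t (U 0 m) \<in> ?G" using generated_algebra.mult[OF U0 M] by simp
        have "(U 0 1 + mat_scale t (U 0 m)) ** U m 1 = mat_scale t (U 0 1)" using m
          by (auto simp: matrix_add_rdistrib UU mat_scale_mult_left)
        then have U01: "U 0 1 \<in> ?G"
          using generated_algebra_unscale[OF _ False] generated_algebra.mult[OF r' R] by simp
        have U0m: "U 0 m \<in> ?G"
          using generated_algebra_unscale[OF _ False] generated_algebra_diff[OF r' U01] by simp
        show ?thesis
        proof (rule gen[of 0])
          show "U i 0 \<in> ?G" if "i < n" for i
            using that U0 asc[OF Y U10] by (cases "i = 0") auto
          show "U 0 i \<in> ?G" if "i < n" for i
            using that U0 desc[OF Y U0m] by (cases "i = 0") auto
        qed (use m in simp)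
      qed
    qed
  qed
qed


section \<open>Holomorphic functions on the quotient\<close>

text \<open>The two notions of nearness of \<open>y\<close> to \<open>a\<close> in the definition of
  \<^const>\<open>complex_differentiable_at\<close>; only the first \<open>N\<close> coordinates count.\<close>

abbreviation l1_dist :: "nat \<Rightarrow> (nat \<Rightarrow> complex) \<Rightarrow> (nat \<Rightarrow> complex) \<Rightarrow> real" where
  "l1_dist N y a \<equiv> \<Sum>i<N. cmod (y i - a i)"

abbreviation near :: "nat \<Rightarrow> real \<Rightarrow> (nat \<Rightarrow> complex) \<Rightarrow> (nat \<Rightarrow> complex) \<Rightarrow> bool" where
  "near N \<delta> y a \<equiv> \<forall>i<N. cmod (y i - a i) < \<delta>"

text \<open>At \<open>y\<close> with the same first \<open>N\<close> coordinates as \<open>a\<close> the error bound is \<open>0\<close>, so the other coordinates do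
  not matter.\<close>

lemma complex_differentiable_at_cong:
  assumes "complex_differentiable_at N F a" "\<And>i. i < N \<Longrightarrow> y i = a i"
  shows "F y = F a"
proof -
  obtain c where c: "\<And>\<epsilon>. \<epsilon> > 0 \<Longrightarrow> \<exists>\<delta>>0. \<forall>y. near N \<delta> y a \<longrightarrow>
        cmod (F y - F a - (\<Sum>i<N. c i * (y i - a i))) \<le> \<epsilon> * l1_dist N y a"
    using assms(1) unfolding complex_differentiable_at_def by blast
  from c[OF zero_less_one] obtain \<delta> where \<delta>: "\<delta> > 0" "\<And>y. near N \<delta> y a \<Longrightarrow>
        cmod (F y - F a - (\<Sum>i<N. c i * (y i - a i))) \<le> 1 * l1_dist N y a"
    by blast
  have "cmod (F y - F a - (\<Sum>i<N. c i * (y i - a i))) \<le> 1 * l1_dist N y a"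
    by (rule \<delta>(2)) (simp add: assms(2) \<delta>(1))
  then show ?thesis using assms(2) by simp
qed

lemma complex_differentiable_at_reindex:
  assumes F: "complex_differentiable_at M F (\<lambda>j. a (e j))"
    and e: "inj_on e {..<M}" "e ` {..<M} \<subseteq> {..<N}"
  shows "complex_differentiable_at N (\<lambda>y. F (\<lambda>j. y (e j))) a"
proof -
  obtain c where c: "\<And>\<epsilon>. \<epsilon> > 0 \<Longrightarrow> \<exists>\<delta>>0. \<forall>y. near M \<delta> y (\<lambda>j. a (e j)) \<longrightarrow>
      cmod (F y - F (\<lambda>j. a (e j)) - (\<Sum>j<M. c j * (y j - a (e j)))) \<le> \<epsilon> * l1_dist M y (\<lambda>j. a (e j))"
    using F unfolding complex_differentiable_at_def by blast
  define c' where "c' = (\<lambda>i. if i \<in> e ` {..<M} then c (the_inv_into {..<M} e i) else 0)"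
  have lin: "(\<Sum>i<N. c' i * h i) = (\<Sum>j<M. c j * h (e j))" for h
  proof -
    have "(\<Sum>i<N. c' i * h i) = (\<Sum>i\<in>e ` {..<M}. c' i * h i)"
      by (rule sum.mono_neutral_right) (use e(2) in \<open>auto simp: c'_def\<close>)
    also have "\<dots> = (\<Sum>j<M. c j * h (e j))"
      unfolding sum.reindex[OF e(1)] by (intro sum.cong) (auto simp: c'_def the_inv_into_f_f[OF e(1)])
    finally show ?thesis .
  qed
  have dist: "l1_dist M (\<lambda>j. y (e j)) (\<lambda>j. a (e j)) \<le> l1_dist N y a" for y
    using sum_mono2[OF finite_lessThan e(2), of "\<lambda>i. cmod (y i - a i)"]
    by (simp add: sum.reindex[OF e(1)] o_def)
  show ?thesis unfolding complex_differentiable_at_def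
  proof (intro exI[of _ c'] allI impI)
    fix \<epsilon> :: real assume \<epsilon>: "\<epsilon> > 0"
    from c[OF this] obtain \<delta> where \<delta>: "\<delta> > 0" "\<And>y. near M \<delta> y (\<lambda>j. a (e j)) \<Longrightarrow>
        cmod (F y - F (\<lambda>j. a (e j)) - (\<Sum>j<M. c j * (y j - a (e j)))) \<le> \<epsilon> * l1_dist M y (\<lambda>j. a (e j))"
      by blast
    have "cmod (F (\<lambda>j. y (e j)) - F (\<lambda>j. a (e j)) - (\<Sum>i<N. c' i * (y i - a i))) \<le> \<epsilon> * l1_dist N y a"
      if "near N \<delta> y a" for y
    proof -
      have "near M \<delta> (\<lambda>j. y (e j)) (\<lambda>j. a (e j))" using that e(2) by (auto simp: image_subset_iff)
      then show ?thesis unfolding lin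
        by (rule order_trans[OF \<delta>(2)]) (use \<epsilon> dist in \<open>simp add: mult_left_mono\<close>)
    qed
    then show "\<exists>\<delta>>0. \<forall>y. near N \<delta> y a \<longrightarrow>
        cmod (F (\<lambda>j. y (e j)) - F (\<lambda>j. a (e j)) - (\<Sum>i<N. c' i * (y i - a i))) \<le> \<epsilon> * l1_dist N y a"
      using \<delta>(1) by blast
  qed
qed

lemma complex_differentiable_at_extend:
  "complex_differentiable_at N F a \<Longrightarrow> complex_differentiable_at (N + M) F a"
  using complex_differentiable_at_reindex[of N F a "\<lambda>j. j" "N + M"] by force

lemma complex_differentiable_at_shift:
  "complex_differentiable_at M F (\<lambda>i. a (N + i)) \<Longrightarrow>
    complex_differentiable_at (N + M) (\<lambda>y. F (\<lambda>i. y (N + i))) a"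
  by (rule complex_differentiable_at_reindex) auto

text \<open>A vector-valued version of \<^const>\<open>complex_differentiable_at\<close>, for functions of the first \<open>N\<close>
  coordinates; \<open>L\<close> is the derivative, and \<open>K\<close> a bound for it in the \<open>l\<^sup>1\<close> norm. Linearity of \<open>L\<close> is
  not required.\<close>

definition approximated_at :: "nat \<Rightarrow> ((nat \<Rightarrow> complex) \<Rightarrow> 'e::real_normed_vector) \<Rightarrow>
    ((nat \<Rightarrow> complex) \<Rightarrow> 'e) \<Rightarrow> (nat \<Rightarrow> complex) \<Rightarrow> bool" where
  "approximated_at N G L a \<longleftrightarrow> (\<exists>K\<ge>0. \<forall>h. norm (L h) \<le> K * (\<Sum>i<N. cmod (h i))) \<and>
     (\<forall>\<epsilon>>0. \<exists>\<delta>>0. \<forall>y. near N \<delta> y a \<longrightarrow>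
        norm (G y - G a - L (\<lambda>i. y i - a i)) \<le> \<epsilon> * l1_dist N y a)"

lemma approximated_atD:
  assumes "approximated_at N G L a" "\<epsilon> > 0"
  shows "\<exists>\<delta>>0. \<forall>y. near N \<delta> y a \<longrightarrow>
        norm (G y - G a - L (\<lambda>i. y i - a i)) \<le> \<epsilon> * l1_dist N y a"
  using assms unfolding approximated_at_def by blast

lemma approximated_at_complex:
  assumes "complex_differentiable_at N F a"
  obtains c where "approximated_at N F (\<lambda>h. \<Sum>i<N. c i * h i) a"
proof -
  obtain c where c: "\<forall>\<epsilon>>0. \<exists>\<delta>>0. \<forall>y. near N \<delta> y a \<longrightarrow>
        cmod (F y - F a - (\<Sum>i<N. c i * (y i - a i))) \<le> \<epsilon> * l1_dist N y a"
    using assms unfolding complex_differentiable_at_def by blast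
  have "cmod (\<Sum>i<N. c i * h i) \<le> (\<Sum>i<N. cmod (c i)) * (\<Sum>i<N. cmod (h i))" for h
  proof -
    have "cmod (\<Sum>i<N. c i * h i) \<le> (\<Sum>i<N. cmod (c i) * cmod (h i))"
      by (rule order_trans[OF norm_sum]) (simp add: norm_mult)
    also have "\<dots> \<le> (\<Sum>i<N. cmod (c i) * (\<Sum>i<N. cmod (h i)))"
      by (intro sum_mono mult_left_mono member_le_sum) auto
    finally show ?thesis by (simp add: sum_distrib_right)
  qed
  then have "\<exists>K\<ge>0. \<forall>h. cmod (\<Sum>i<N. c i * h i) \<le> K * (\<Sum>i<N. cmod (h i))"
    by (intro exI[of _ "\<Sum>i<N. cmod (c i)"]) (simp add: sum_nonneg)
  then show ?thesis using that c unfolding approximated_at_def by blast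
qed

lemma approximated_at_lipschitz:
  assumes "approximated_at N G L a"
  obtains K \<delta> where "K > 0" "\<delta> > 0"
    "\<And>y. (\<And>i. i < N \<Longrightarrow> cmod (y i - a i) < \<delta>) \<Longrightarrow> norm (G y - G a) \<le> K * l1_dist N y a"
proof -
  obtain K where K: "K \<ge> 0" "\<And>h. norm (L h) \<le> K * (\<Sum>i<N. cmod (h i))"
    using assms unfolding approximated_at_def by blast
  have "\<exists>\<delta>>0. \<forall>y. near N \<delta> y a \<longrightarrow>
        norm (G y - G a - L (\<lambda>i. y i - a i)) \<le> 1 * l1_dist N y a"
    using assms unfolding approximated_at_def by (meson zero_less_one)
  then obtain \<delta> where \<delta>: "\<delta> > 0" "\<And>y. near N \<delta> y a \<Longrightarrow>
        norm (G y - G a - L (\<lambda>i. y i - a i)) \<le> 1 * l1_dist N y a" by blast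
  show ?thesis
  proof (rule that[of "K + 1" \<delta>])
    fix y assume y: "\<And>i. i < N \<Longrightarrow> cmod (y i - a i) < \<delta>"
    have "norm (G y - G a) \<le> norm (G y - G a - L (\<lambda>i. y i - a i)) + norm (L (\<lambda>i. y i - a i))"
      by (metis norm_triangle_sub add.commute)
    also have "\<dots> \<le> 1 * l1_dist N y a + K * l1_dist N y a"
      using \<delta>(2)[of y] y K(2)[of "\<lambda>i. y i - a i"] by (intro add_mono) auto
    finally show "norm (G y - G a) \<le> (K + 1) * l1_dist N y a"
      by (simp add: algebra_simps)
  qed (use K \<delta> in auto)
qed

lemma approximated_at_near:
  assumes "approximated_at N G L a" "e > 0"
  obtains \<delta> where "\<delta> > 0" "\<And>y. (\<And>i. i < N \<Longrightarrow> cmod (y i - a i) < \<delta>) \<Longrightarrow> norm (G y - G a) < e"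
proof -
  obtain K \<delta> where K: "K > 0" "\<delta> > 0"
    "\<And>y. (\<And>i. i < N \<Longrightarrow> cmod (y i - a i) < \<delta>) \<Longrightarrow> norm (G y - G a) \<le> K * l1_dist N y a"
    using approximated_at_lipschitz[OF assms(1)] by blast
  define M where "M = K * (real N + 1)"
  have M: "M > 0" using K(1) by (simp add: M_def)
  define \<delta>' where "\<delta>' = e / (2 * M)"
  have \<delta>': "\<delta>' > 0" unfolding \<delta>'_def using M assms(2) by simp
  show ?thesis
  proof (rule that[of "min \<delta> \<delta>'"])
    fix y assume y: "\<And>i. i < N \<Longrightarrow> cmod (y i - a i) < min \<delta> \<delta>'"
    have "l1_dist N y a \<le> (\<Sum>i<N. \<delta>')"
      by (rule sum_mono) (use y in \<open>simp add: less_imp_le\<close>)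
    also have "\<dots> \<le> (real N + 1) * \<delta>'" using \<delta>' by simp
    finally have "K * l1_dist N y a \<le> K * ((real N + 1) * \<delta>')" using K by simp
    also have "\<dots> = M * \<delta>'" by (simp add: M_def)
    also have "\<dots> = e / 2" unfolding \<delta>'_def using M by simp
    finally have "K * l1_dist N y a < e" using assms(2) by simp
    then show "norm (G y - G a) < e" using K(3)[of y] y by fastforce
  qed (use K \<delta>' in auto)
qed

lemma approximated_at_sum:
  assumes "finite I" and G: "\<And>i. i \<in> I \<Longrightarrow> approximated_at N (F i) (L i) a"
    and J: "\<And>i. i \<in> I \<Longrightarrow> bounded_linear (J i)"
  shows "approximated_at N (\<lambda>y. \<Sum>i\<in>I. J i (F i y)) (\<lambda>h. \<Sum>i\<in>I. J i (L i h)) a"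
  using assms
proof (induction I rule: finite_induct)
  case empty
  then show ?case by (auto simp: approximated_at_def sum_nonneg intro!: exI[of _ 1])
next
  case (insert k I)
  let ?G = "\<lambda>y. \<Sum>i\<in>I. J i (F i y)" and ?L = "\<lambda>h. \<Sum>i\<in>I. J i (L i h)"
  let ?S = "\<lambda>h. \<Sum>i<N. cmod (h i)"
  have IH: "approximated_at N ?G ?L a" by (rule insert.IH) (use insert in auto)
  have k: "approximated_at N (F k) (L k) a" and Jk: "bounded_linear (J k)" using insert by auto
  obtain B where B: "B > 0" "\<And>x. norm (J k x) \<le> B * norm x"
    using bounded_linear.pos_bounded[OF Jk] by (auto simp: mult.commute)
  obtain K1 where K1: "K1 \<ge> 0" "\<And>h. norm (?L h) \<le> K1 * ?S h"
    using IH unfolding approximated_at_def by blast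
  obtain K2 where K2: "K2 \<ge> 0" "\<And>h. norm (L k h) \<le> K2 * ?S h"
    using k unfolding approximated_at_def by blast
  have bound: "norm (J k (L k h) + ?L h) \<le> (B * K2 + K1) * ?S h" for h
  proof -
    have "norm (J k (L k h)) \<le> B * (K2 * ?S h)"
      using B(2)[of "L k h"] K2(2)[of h] B(1) by (meson mult_left_mono less_imp_le order_trans)
    then show ?thesis using norm_triangle_ineq[of "J k (L k h)" "?L h"] K1(2)[of h]
      by (simp add: algebra_simps)
  qed
  have "\<exists>\<delta>>0. \<forall>y. near N \<delta> y a \<longrightarrow>
      norm (J k (F k y) + ?G y - (J k (F k a) + ?G a) - (J k (L k (\<lambda>i. y i - a i)) + ?L (\<lambda>i. y i - a i)))
        \<le> \<epsilon> * ?S (\<lambda>i. y i - a i)" if \<epsilon>: "\<epsilon> > 0" for \<epsilon>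
  proof -
    have "\<epsilon> / 2 > 0" "\<epsilon> / (2 * B) > 0" using \<epsilon> B by auto
    from approximated_atD[OF IH this(1)] obtain \<delta>1
      where \<delta>1: "\<delta>1 > 0" "\<And>y. near N \<delta>1 y a \<Longrightarrow>
          norm (?G y - ?G a - ?L (\<lambda>i. y i - a i)) \<le> \<epsilon> / 2 * ?S (\<lambda>i. y i - a i)" by blast
    from approximated_atD[OF k \<open>\<epsilon> / (2 * B) > 0\<close>] obtain \<delta>2
      where \<delta>2: "\<delta>2 > 0" "\<And>y. near N \<delta>2 y a \<Longrightarrow>
          norm (F k y - F k a - L k (\<lambda>i. y i - a i)) \<le> \<epsilon> / (2 * B) * ?S (\<lambda>i. y i - a i)"
      by blast
    show ?thesis
    proof (intro exI[of _ "min \<delta>1 \<delta>2"] conjI allI impI)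
      fix y assume y: "\<forall>i<N. cmod (y i - a i) < min \<delta>1 \<delta>2"
      let ?h = "\<lambda>i. y i - a i"
      have "J k (F k y) - J k (F k a) - J k (L k ?h) = J k (F k y - F k a - L k ?h)"
        using Jk by (simp add: linear_simps)
      also have "norm \<dots> \<le> B * norm (F k y - F k a - L k ?h)" by (rule B)
      also have "\<dots> \<le> B * (\<epsilon> / (2 * B) * ?S ?h)"
        using \<delta>2(2)[of y] y B(1) by (intro mult_left_mono) auto
      also have "\<dots> = \<epsilon> / 2 * ?S ?h" using B(1) by simp
      finally have 1: "norm (J k (F k y) - J k (F k a) - J k (L k ?h)) \<le> \<epsilon> / 2 * ?S ?h" .
      have 2: "norm (?G y - ?G a - ?L ?h) \<le> \<epsilon> / 2 * ?S ?h" using \<delta>1(2)[of y] y by auto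
      have "J k (F k y) + ?G y - (J k (F k a) + ?G a) - (J k (L k ?h) + ?L ?h)
          = (J k (F k y) - J k (F k a) - J k (L k ?h)) + (?G y - ?G a - ?L ?h)"
        by (simp add: algebra_simps)
      also have "norm \<dots> \<le> \<epsilon> / 2 * ?S ?h + \<epsilon> / 2 * ?S ?h"
        by (rule norm_triangle_mono[OF 1 2])
      finally show "norm (J k (F k y) + ?G y - (J k (F k a) + ?G a) - (J k (L k ?h) + ?L ?h)) \<le> \<epsilon> * ?S ?h"
        by simp
    qed (use \<delta>1 \<delta>2 in auto)
  qed
  moreover have "\<exists>K\<ge>0. \<forall>h. norm (J k (L k h) + ?L h) \<le> K * ?S h"
    by (intro exI[of _ "B * K2 + K1"] conjI allI bound) (use B K1 K2 in auto)
  ultimately show ?case using insert.hyps unfolding approximated_at_def by simp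
qed

lemma approximated_at_compose:
  assumes G: "approximated_at N G L a" and \<Phi>: "(\<Phi> has_derivative \<Phi>') (at (G a))"
  shows "approximated_at N (\<lambda>y. \<Phi> (G y)) (\<lambda>h. \<Phi>' (L h)) a"
proof -
  let ?S = "\<lambda>h. \<Sum>i<N. cmod (h i)"
  have lin: "bounded_linear \<Phi>'" using \<Phi> by (rule has_derivative_bounded_linear)
  obtain B where B: "B > 0" "\<And>x. norm (\<Phi>' x) \<le> B * norm x"
    using bounded_linear.pos_bounded[OF lin] by (auto simp: mult.commute)
  obtain K where K: "K \<ge> 0" "\<And>h. norm (L h) \<le> K * ?S h"
    using G unfolding approximated_at_def by blast
  obtain M \<delta>0 where M: "M > 0" "\<delta>0 > 0"
    "\<And>y. (\<And>i. i < N \<Longrightarrow> cmod (y i - a i) < \<delta>0) \<Longrightarrow> norm (G y - G a) \<le> M * ?S (\<lambda>i. y i - a i)"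
    using approximated_at_lipschitz[OF G] by blast
  have "\<exists>\<delta>>0. \<forall>y. near N \<delta> y a \<longrightarrow>
      norm (\<Phi> (G y) - \<Phi> (G a) - \<Phi>' (L (\<lambda>i. y i - a i))) \<le> \<epsilon> * ?S (\<lambda>i. y i - a i)" if \<epsilon>: "\<epsilon> > 0" for \<epsilon>
  proof -
    have pos: "\<epsilon> / (2 * M) > 0" "\<epsilon> / (2 * B) > 0" using \<epsilon> M B by auto
    obtain d where d: "d > 0" "\<And>w. norm (w - G a) < d \<Longrightarrow>
        norm (\<Phi> w - \<Phi> (G a) - \<Phi>' (w - G a)) \<le> \<epsilon> / (2 * M) * norm (w - G a)"
      using \<Phi> pos(1) unfolding has_derivative_at_alt by blast
    obtain \<delta>1 where \<delta>1: "\<delta>1 > 0" "\<And>y. (\<And>i. i < N \<Longrightarrow> cmod (y i - a i) < \<delta>1) \<Longrightarrow> norm (G y - G a) < d"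
      using approximated_at_near[OF G d(1)] by blast
    obtain \<delta>2 where \<delta>2: "\<delta>2 > 0" "\<And>y. near N \<delta>2 y a \<Longrightarrow>
          norm (G y - G a - L (\<lambda>i. y i - a i)) \<le> \<epsilon> / (2 * B) * ?S (\<lambda>i. y i - a i)"
      using G pos(2) unfolding approximated_at_def by meson
    show ?thesis
    proof (intro exI[of _ "min \<delta>0 (min \<delta>1 \<delta>2)"] conjI allI impI)
      fix y assume y: "\<forall>i<N. cmod (y i - a i) < min \<delta>0 (min \<delta>1 \<delta>2)"
      let ?h = "\<lambda>i. y i - a i"
      have "norm (\<Phi> (G y) - \<Phi> (G a) - \<Phi>' (G y - G a)) \<le> \<epsilon> / (2 * M) * norm (G y - G a)"
        using d(2)[OF \<delta>1(2)[of y]] y by auto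
      also have "\<dots> \<le> \<epsilon> / (2 * M) * (M * ?S ?h)"
        using M(3)[of y] y pos by (intro mult_left_mono) auto
      also have "\<dots> = \<epsilon> / 2 * ?S ?h" using M(1) by simp
      finally have 1: "norm (\<Phi> (G y) - \<Phi> (G a) - \<Phi>' (G y - G a)) \<le> \<epsilon> / 2 * ?S ?h" .
      have "norm (\<Phi>' (G y - G a - L ?h)) \<le> B * norm (G y - G a - L ?h)" by (rule B)
      also have "\<dots> \<le> B * (\<epsilon> / (2 * B) * ?S ?h)"
        using \<delta>2(2)[of y] y B(1) by (intro mult_left_mono) auto
      also have "\<dots> = \<epsilon> / 2 * ?S ?h" using B(1) by simp
      finally have 2: "norm (\<Phi>' (G y - G a - L ?h)) \<le> \<epsilon> / 2 * ?S ?h" .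
      have "\<Phi> (G y) - \<Phi> (G a) - \<Phi>' (L ?h)
          = (\<Phi> (G y) - \<Phi> (G a) - \<Phi>' (G y - G a)) + \<Phi>' (G y - G a - L ?h)"
        using lin by (simp add: linear_simps)
      also have "norm \<dots> \<le> \<epsilon> / 2 * ?S ?h + \<epsilon> / 2 * ?S ?h"
        by (rule norm_triangle_mono[OF 1 2])
      finally show "norm (\<Phi> (G y) - \<Phi> (G a) - \<Phi>' (L ?h)) \<le> \<epsilon> * ?S ?h" by simp
    qed (use M \<delta>1 \<delta>2 in auto)
  qed
  moreover have "norm (\<Phi>' (L h)) \<le> (B * K) * ?S h" for h
    using B(2)[of "L h"] K(2)[of h] B(1) by (simp add: mult.assoc) (meson mult_left_mono less_imp_le order_trans)
  then have "\<exists>K\<ge>0. \<forall>h. norm (\<Phi>' (L h)) \<le> K * ?S h"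
    using B(1) K(1) by (intro exI[of _ "B * K"]) auto
  ultimately show ?thesis unfolding approximated_at_def by blast
qed

text \<open>Chain rule for a function that is complex linear to first order after a family of complex
  functions \<open>F i\<close>; the maps \<open>J i\<close> assemble the values \<open>F i y\<close> to one vector.\<close>

lemma complex_differentiable_at_compose:
  fixes \<Phi> :: "'e::real_normed_vector \<Rightarrow> complex"
  assumes I: "finite I" and F: "\<And>i. i \<in> I \<Longrightarrow> complex_differentiable_at N (F i) a"
    and J: "\<And>i. i \<in> I \<Longrightarrow> bounded_linear (J i)"
    and \<Phi>: "(\<Phi> has_derivative \<Phi>') (at (\<Sum>i\<in>I. J i (F i a)))"
    and lin: "\<And>i c w. i \<in> I \<Longrightarrow> \<Phi>' (J i (c * w)) = c * \<Phi>' (J i w)"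
  shows "complex_differentiable_at N (\<lambda>y. \<Phi> (\<Sum>i\<in>I. J i (F i y))) a"
proof -
  have "\<forall>i\<in>I. \<exists>c. approximated_at N (F i) (\<lambda>h. \<Sum>j<N. c j * h j) a"
    using approximated_at_complex[OF F] by metis
  then obtain c where c: "\<And>i. i \<in> I \<Longrightarrow> approximated_at N (F i) (\<lambda>h. \<Sum>j<N. c i j * h j) a"
    by metis
  have bl: "bounded_linear \<Phi>'" using \<Phi> by (rule has_derivative_bounded_linear)
  have eq: "\<Phi>' (\<Sum>i\<in>I. J i (\<Sum>j<N. c i j * h j)) = (\<Sum>j<N. (\<Sum>i\<in>I. \<Phi>' (J i (c i j))) * h j)" for h
  proof -
    have "\<Phi>' (\<Sum>i\<in>I. J i (\<Sum>j<N. c i j * h j)) = (\<Sum>i\<in>I. \<Sum>j<N. \<Phi>' (J i (h j * c i j)))"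
      using J bounded_linear.linear[OF bl] bounded_linear.linear[OF J]
      by (simp add: linear_sum mult.commute cong: sum.cong)
    also have "\<dots> = (\<Sum>i\<in>I. \<Sum>j<N. \<Phi>' (J i (c i j)) * h j)"
      by (intro sum.cong refl) (simp add: lin mult.commute)
    also have "\<dots> = (\<Sum>j<N. (\<Sum>i\<in>I. \<Phi>' (J i (c i j))) * h j)"
      by (subst sum.swap) (simp add: sum_distrib_right)
    finally show ?thesis .
  qed
  have "approximated_at N (\<lambda>y. \<Phi> (\<Sum>i\<in>I. J i (F i y)))
      (\<lambda>h. \<Phi>' (\<Sum>i\<in>I. J i (\<Sum>j<N. c i j * h j))) a"
    by (rule approximated_at_compose[OF approximated_at_sum[OF I c J] \<Phi>])
  then show ?thesis unfolding approximated_at_def eq complex_differentiable_at_def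
    by (intro exI[of _ "\<lambda>j. \<Sum>i\<in>I. \<Phi>' (J i (c i j))"]) (rule conjunct2)
qed

lemma complex_differentiable_at_has_derivative:
  fixes g :: "nat \<Rightarrow> 'e::real_normed_vector \<Rightarrow> complex"
  assumes F: "complex_differentiable_at N F (\<lambda>i. g i x)"
    and g: "\<And>i. i < N \<Longrightarrow> (g i has_derivative g' i) (at x)"
  shows "\<exists>c. ((\<lambda>x. F (\<lambda>i. g i x)) has_derivative (\<lambda>h. \<Sum>i<N. c i * g' i h)) (at x)"
proof -
  obtain c where c: "\<And>\<epsilon>. \<epsilon> > 0 \<Longrightarrow> \<exists>\<delta>>0. \<forall>y. (\<forall>i<N. cmod (y i - g i x) < \<delta>) \<longrightarrow>
        cmod (F y - F (\<lambda>i. g i x) - (\<Sum>i<N. c i * (y i - g i x))) \<le> \<epsilon> * (\<Sum>i<N. cmod (y i - g i x))"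
    using F unfolding complex_differentiable_at_def by blast
  have "((\<lambda>x. \<Sum>i<N. c i * g i x) has_derivative (\<lambda>h. \<Sum>i<N. c i * g' i h)) (at x)"
    by (intro has_derivative_sum has_derivative_mult_right g) auto
  note lin = this[unfolded has_derivative_at_alt]
  have lip: "\<exists>B>0. \<exists>d>0. \<forall>y. norm (y - x) < d \<longrightarrow> cmod (g i y - g i x) \<le> B * norm (y - x)" if i: "i < N" for i
  proof -
    obtain B where B: "B > 0" "\<And>h. norm (g' i h) \<le> B * norm h"
      using bounded_linear.pos_bounded[OF has_derivative_bounded_linear[OF g[OF i]]]
      by (auto simp: mult.commute)
    obtain d where d: "d > 0" "\<And>y. norm (y - x) < d \<Longrightarrow> norm (g i y - g i x - g' i (y - x)) \<le> 1 * norm (y - x)"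
      using g[OF i] unfolding has_derivative_at_alt by (meson zero_less_one)
    have "cmod (g i y - g i x) \<le> (B + 1) * norm (y - x)" if "norm (y - x) < d" for y
      using d(2)[OF that] B(2)[of "y - x"] norm_triangle_sub[of "g i y - g i x" "g' i (y - x)"]
      by (simp add: algebra_simps)
    then show ?thesis using B d by (intro exI[of _ "B + 1"]) auto
  qed
  then obtain B d where Bd: "\<And>i. i < N \<Longrightarrow> B i > 0 \<and> d i > 0"
    "\<And>i y. i < N \<Longrightarrow> norm (y - x) < d i \<Longrightarrow> cmod (g i y - g i x) \<le> B i * norm (y - x)"
    by metis
  define C where "C = (\<Sum>i<N. B i) + 1"
  have Bpos: "i < N \<Longrightarrow> 0 \<le> B i" for i using Bd(1)[of i] by auto
  have "(\<Sum>i<N. B i) \<ge> 0" by (rule sum_nonneg) (use Bpos in auto)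
  then have C: "C > 0" by (simp add: C_def)
  have BC: "B i \<le> C" if "i < N" for i
  proof -
    have "B i \<le> (\<Sum>i<N. B i)" by (rule member_le_sum) (use that Bpos in auto)
    then show ?thesis by (simp add: C_def)
  qed
  define d0 where "d0 = Min (insert 1 (d ` {..<N}))"
  have d0: "d0 > 0" "\<And>i. i < N \<Longrightarrow> d0 \<le> d i" unfolding d0_def using Bd(1) by auto
  have "((\<lambda>x. F (\<lambda>i. g i x)) has_derivative (\<lambda>h. \<Sum>i<N. c i * g' i h)) (at x)"
    unfolding has_derivative_at_alt
  proof (intro conjI allI impI)
    show "bounded_linear (\<lambda>h. \<Sum>i<N. c i * g' i h)" using lin by blast
    fix e :: real assume e: "e > 0"
    have "e / (2 * C) > 0" using e C by simp
    from c[OF this] obtain \<delta> where \<delta>: "\<delta> > 0" "\<And>y. (\<forall>i<N. cmod (y i - g i x) < \<delta>) \<Longrightarrow>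
        cmod (F y - F (\<lambda>i. g i x) - (\<Sum>i<N. c i * (y i - g i x)))
          \<le> e / (2 * C) * (\<Sum>i<N. cmod (y i - g i x))" by auto
    have "e / 2 > 0" using e by simp
    then obtain d1 where d1: "d1 > 0" "\<And>y. norm (y - x) < d1 \<Longrightarrow>
        norm ((\<Sum>i<N. c i * g i y) - (\<Sum>i<N. c i * g i x) - (\<Sum>i<N. c i * g' i (y - x))) \<le> e / 2 * norm (y - x)"
      using lin by blast
    show "\<exists>d>0. \<forall>y. norm (y - x) < d \<longrightarrow> norm (F (\<lambda>i. g i y) - F (\<lambda>i. g i x) - (\<Sum>i<N. c i * g' i (y - x)))
        \<le> e * norm (y - x)"
    proof (intro exI[of _ "min (min d0 d1) (\<delta> / C)"] conjI allI impI)
      fix y assume y: "norm (y - x) < min (min d0 d1) (\<delta> / C)"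
      have le: "cmod (g i y - g i x) \<le> B i * norm (y - x)" if "i < N" for i
        using Bd(2)[OF that] d0(2)[OF that] y by auto
      have Cy: "C * norm (y - x) < \<delta>" using y C by (simp add: field_simps)
      have near: "cmod (g i y - g i x) < \<delta>" if "i < N" for i
      proof -
        have "B i * norm (y - x) \<le> C * norm (y - x)" using BC[OF that] by (intro mult_right_mono) auto
        then show ?thesis using le[OF that] Cy by linarith
      qed
      have "(\<Sum>i<N. cmod (g i y - g i x)) \<le> (\<Sum>i<N. B i * norm (y - x))"
        by (rule sum_mono) (use le in auto)
      also have "\<dots> \<le> C * norm (y - x)" by (simp add: C_def sum_distrib_right[symmetric] algebra_simps)
      finally have S: "(\<Sum>i<N. cmod (g i y - g i x)) \<le> C * norm (y - x)" .
      have "cmod (F (\<lambda>i. g i y) - F (\<lambda>i. g i x) - (\<Sum>i<N. c i * (g i y - g i x)))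
          \<le> e / (2 * C) * (\<Sum>i<N. cmod (g i y - g i x))"
        using \<delta>(2)[of "\<lambda>i. g i y"] near by auto
      also have "\<dots> \<le> e / (2 * C) * (C * norm (y - x))"
        using e C S by (intro mult_left_mono) auto
      also have "\<dots> = e / 2 * norm (y - x)" using C by simp
      finally have 1: "cmod (F (\<lambda>i. g i y) - F (\<lambda>i. g i x) - (\<Sum>i<N. c i * (g i y - g i x))) \<le> e / 2 * norm (y - x)" .
      have 2: "cmod ((\<Sum>i<N. c i * (g i y - g i x)) - (\<Sum>i<N. c i * g' i (y - x))) \<le> e / 2 * norm (y - x)"
        using d1(2)[of y] y by (simp add: right_diff_distrib sum_subtractf)
      have "F (\<lambda>i. g i y) - F (\<lambda>i. g i x) - (\<Sum>i<N. c i * g' i (y - x))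
        = (F (\<lambda>i. g i y) - F (\<lambda>i. g i x) - (\<Sum>i<N. c i * (g i y - g i x)))
          + ((\<Sum>i<N. c i * (g i y - g i x)) - (\<Sum>i<N. c i * g' i (y - x)))" by simp
      also have "norm \<dots> \<le> e / 2 * norm (y - x) + e / 2 * norm (y - x)"
        by (rule norm_triangle_mono[OF 1 2])
      finally show "norm (F (\<lambda>i. g i y) - F (\<lambda>i. g i x) - (\<Sum>i<N. c i * g' i (y - x))) \<le> e * norm (y - x)"
        by simp
    qed (use d0 d1 \<delta> C in auto)
  qed
  then show ?thesis by blast
qed


lemma invariants_const: "(\<lambda>z. c) \<in> invariants"
  by (simp add: invariants_def polynomial_fun.const)

lemma invariants_add: "p \<in> invariants \<Longrightarrow> q \<in> invariants \<Longrightarrow> (\<lambda>z. p z + q z) \<in> invariants"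
  by (simp add: invariants_def polynomial_fun.add)

lemma invariants_mult: "p \<in> invariants \<Longrightarrow> q \<in> invariants \<Longrightarrow> (\<lambda>z. p z * q z) \<in> invariants"
  by (simp add: invariants_def polynomial_fun.mult)

lemma invariants_trace: "nc_polynomial X \<Longrightarrow> (\<lambda>z. trace (X z)) \<in> invariants"
  unfolding invariants_def trace_def
  by (auto intro!: polynomial_fun_sum nc_polynomial_entry)
    (simp add: nc_polynomial_conj trace_conj_mat flip: trace_def)

lemma invariants_det: "nc_polynomial X \<Longrightarrow> (\<lambda>z. det (X z)) \<in> invariants"
  unfolding invariants_def
  by (auto intro!: polynomial_fun_det nc_polynomial_entry simp: nc_polynomial_conj det_conj_mat)

lemma pi0_apply [simp]: "p \<in> invariants \<Longrightarrow> pi0 z p = p z"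
  by (simp add: pi0_def)

lemma pi0_conj [simp]: "invertible s \<Longrightarrow> pi0 (conj_tuple s z) = pi0 z"
  unfolding pi0_def by (rule restrict_ext) (simp add: invariants_def)

lemma pi0_in_Q0: "z \<in> generating_tuples \<Longrightarrow> pi0 z \<in> Q0"
  by (simp add: Q0_def)

lemma pi0_in_quotient_variety: "pi0 z \<in> quotient_variety"
  by (auto simp: quotient_variety_def pi0_def invariants_const invariants_add invariants_mult)

lemma topspace_quotient_topology: "topspace quotient_topology = quotient_variety"
  by (auto simp: quotient_topology_def quotient_variety_def extensional_def PiE_def)

lemma Q0_subset: "Q0 \<subseteq> topspace quotient_topology"
  by (auto simp: Q0_def topspace_quotient_topology pi0_in_quotient_variety)

text \<open>The Euclidean topology of \<open>Q0\<close>.\<close>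

abbreviation Q0_topology :: "('d::finite, 'n::finite) qpoint topology" where
  "Q0_topology \<equiv> subtopology quotient_topology Q0"

lemma continuous_map_evaluation:
  assumes "p \<in> invariants"
  shows "continuous_map Q0_topology euclidean (\<lambda>q. q p)"
  unfolding quotient_topology_def
  by (intro continuous_map_from_subtopology continuous_map_product_projection assms)

lemma openin_Q0_polydisc:
  fixes N :: nat and p :: "nat \<Rightarrow> ('d::finite, 'n::finite) mtuple \<Rightarrow> complex"
  assumes "\<And>i. i < N \<Longrightarrow> p i \<in> invariants"
  shows "openin Q0_topology {q \<in> Q0. \<forall>i<N. cmod (q (p i) - a i) < r}"
proof (cases "N = 0")
  case True
  have "openin Q0_topology (Q0 :: ('d, 'n) qpoint set)"
    by (metis Q0_subset openin_topspace topspace_subtopology_subset)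
  then show ?thesis using True by simp
next
  case False
  have "openin Q0_topology {q \<in> topspace Q0_topology. q (p i) \<in> ball (a i) r}" if "i < N" for i
    by (rule openin_continuous_map_preimage[OF continuous_map_evaluation[OF assms[OF that]]]) auto
  then have "openin Q0_topology (\<Inter>i\<in>{..<N}. {q \<in> topspace Q0_topology. q (p i) \<in> ball (a i) r})"
    using False by (intro openin_INT2) auto
  also have "(\<Inter>i\<in>{..<N}. {q \<in> topspace Q0_topology. q (p i) \<in> ball (a i) r})
      = {q \<in> Q0. \<forall>i<N. cmod (q (p i) - a i) < r}"
    using False Q0_subset by (auto simp: dist_norm norm_minus_commute)
  finally show ?thesis .
qed

lemma open_pi0_preimage:
  fixes U :: "('d::finite, 'n::finite) qpoint set"
  assumes "openin Q0_topology U"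
  shows "open {z \<in> generating_tuples. pi0 z \<in> U}"
proof -
  have "continuous_map (top_of_set generating_tuples) Q0_topology (pi0 :: ('d, 'n) mtuple \<Rightarrow> _)"
    unfolding quotient_topology_def continuous_map_in_subtopology
  proof (intro conjI)
    show "continuous_map (top_of_set generating_tuples) (product_topology (\<lambda>p. euclidean) invariants) 
        (pi0 :: ('d, 'n) mtuple \<Rightarrow> _)"
      unfolding continuous_map_componentwise
      by (auto simp: pi0_def invariants_def continuous_map_iff_continuous intro!: polynomial_fun_continuous)
  qed (auto simp: pi0_in_quotient_variety pi0_in_Q0)
  from openin_continuous_map_preimage[OF this assms]
  show ?thesis
    using openin_open_trans[OF _ open_generating_tuples] by simp
qed


text \<open>On the part of \<open>U\<close> in the polydisc of radius \<open>r\<close> around \<open>x\<close>, the function \<open>h\<close> is the holomorphic function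
  \<open>F\<close> of the regular functions \<open>p 0\<close> up to \<open>p (N - 1)\<close>.\<close>

definition holo_rep :: "('d::finite, 'n::finite) qpoint set \<Rightarrow> ('d, 'n) qpoint \<Rightarrow> nat \<Rightarrow>
    (nat \<Rightarrow> ('d, 'n) mtuple \<Rightarrow> complex) \<Rightarrow> real \<Rightarrow> (('d, 'n) qpoint \<Rightarrow> complex) \<Rightarrow>
    ((nat \<Rightarrow> complex) \<Rightarrow> complex) \<Rightarrow> bool" where
  "holo_rep U x N p r h F \<longleftrightarrow>
     (\<forall>y. (\<forall>i<N. cmod (y i - x (p i)) < r) \<longrightarrow> complex_differentiable_at N F y) \<and>
     (\<forall>u\<in>U. (\<forall>i<N. cmod (u (p i) - x (p i)) < r) \<longrightarrow> h u = F (\<lambda>i. u (p i)))"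

lemma holomorphic_on_quotient_iff_rep:
  "holomorphic_on_quotient U h \<longleftrightarrow>
     (\<forall>x\<in>U. \<exists>N p F r. r > 0 \<and> (\<forall>i<N. p i \<in> invariants) \<and> holo_rep U x N p r h F)"
  unfolding holomorphic_on_quotient_def holo_rep_def by (rule refl)

lemma holo_rep_mono:
  assumes "holo_rep U x N p r h F" "r' \<le> r"
  shows "holo_rep U x N p r' h F"
proof -
  have 1: "(\<forall>i<N. cmod (y i - x (p i)) < r') \<longrightarrow> (\<forall>i<N. cmod (y i - x (p i)) < r)" for y
    using assms(2) by (auto intro: less_le_trans)
  have 2: "(\<forall>i<N. cmod (u (p i) - x (p i)) < r') \<longrightarrow> (\<forall>i<N. cmod (u (p i) - x (p i)) < r)" for u
    using assms(2) by (auto intro: less_le_trans)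
  show ?thesis using assms(1) 1 2 unfolding holo_rep_def by meson
qed

lemma holo_rep_subset: "holo_rep U x N p r h F \<Longrightarrow> U' \<subseteq> U \<Longrightarrow> holo_rep U' x N p r h F"
  by (auto simp: holo_rep_def)

text \<open>Finitely many holomorphic functions are locally functions of the same regular functions.\<close>

lemma common_holo_rep:
  assumes "finite I" "x \<in> U" "\<And>i. i \<in> I \<Longrightarrow> holomorphic_on_quotient U (h i)"
  shows "\<exists>N p r F. r > 0 \<and> (\<forall>i<N. p i \<in> invariants) \<and> (\<forall>i\<in>I. holo_rep U x N p r (h i) (F i))"
  using assms
proof (induction I rule: finite_induct)
  case empty
  show ?case by (intro exI[of _ 0] exI[of _ "1::real"] exI) auto
next
  case (insert k I)
  then obtain N p r F where IH: "r > 0" "\<And>i. i < N \<Longrightarrow> p i \<in> invariants"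
      "\<And>i. i \<in> I \<Longrightarrow> holo_rep U x N p r (h i) (F i)" by (metis insertCI)
  obtain M p' r' F' where k: "r' > 0" "\<And>i. i < M \<Longrightarrow> p' i \<in> invariants" "holo_rep U x M p' r' (h k) F'"
    using insert.prems unfolding holomorphic_on_quotient_iff_rep by (metis insertCI)
  \<comment> \<open>the regular functions of both representations side by side\<close>
  define P where "P = (\<lambda>i. if i < N then p i else p' (i - N))"
  define s where "s = min r r'"
  have s: "s > 0" "s \<le> r" "s \<le> r'" using IH k by (auto simp: s_def)
  have P1: "P i = p i" if "i < N" for i using that by (simp add: P_def)
  have P2: "P (N + i) = p' i" for i by (simp add: P_def)
  have "holo_rep U x (N + M) P s (h i) (F i)" if "i \<in> I" for i
    unfolding holo_rep_def
  proof (intro conjI allI ballI impI)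
    have rep: "holo_rep U x N p s (h i) (F i)" using holo_rep_mono[OF IH(3)[OF that] s(2)] .
    {
      fix y assume "\<forall>i<N + M. cmod (y i - x (P i)) < s"
      then have "\<forall>i<N. cmod (y i - x (p i)) < s" using P1 by (metis trans_less_add1)
      then have "complex_differentiable_at N (F i) y" using rep by (auto simp: holo_rep_def)
      then show "complex_differentiable_at (N + M) (F i) y" by (rule complex_differentiable_at_extend)
    }
    fix u assume "u \<in> U" "\<forall>i<N + M. cmod (u (P i) - x (P i)) < s"
    then have *: "u \<in> U" "\<forall>i<N. cmod (u (p i) - x (p i)) < s" using P1 by (metis trans_less_add1)+
    then have "h i u = F i (\<lambda>j. u (p j))" using rep by (auto simp: holo_rep_def)
    also have "\<dots> = F i (\<lambda>j. u (P j))"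
      by (rule sym, rule complex_differentiable_at_cong[of N])
        (use * rep P1 in \<open>auto simp: holo_rep_def\<close>)
    finally show "h i u = F i (\<lambda>j. u (P j))" .
  qed
  moreover have "holo_rep U x (N + M) P s (h k) (\<lambda>y. F' (\<lambda>i. y (N + i)))"
    unfolding holo_rep_def
  proof (intro conjI allI ballI impI)
    have rep: "holo_rep U x M p' s (h k) F'" using holo_rep_mono[OF k(3) s(3)] .
    {
      fix y assume "\<forall>i<N + M. cmod (y i - x (P i)) < s"
      then have "\<forall>i<M. cmod (y (N + i) - x (p' i)) < s" using P2 by (metis nat_add_left_cancel_less)
      then have "complex_differentiable_at M F' (\<lambda>i. y (N + i))" using rep by (auto simp: holo_rep_def)
      then show "complex_differentiable_at (N + M) (\<lambda>y. F' (\<lambda>i. y (N + i))) y"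
        by (rule complex_differentiable_at_shift)
    }
    fix u assume "u \<in> U" "\<forall>i<N + M. cmod (u (P i) - x (P i)) < s"
    then have "u \<in> U" "\<forall>i<M. cmod (u (p' i) - x (p' i)) < s" using P2 by (metis nat_add_left_cancel_less)+
    then show "h k u = F' (\<lambda>i. u (P (N + i)))" using rep by (auto simp: holo_rep_def P2)
  qed
  ultimately have "\<forall>i\<in>insert k I. holo_rep U x (N + M) P s (h i) ((F(k := \<lambda>y. F' (\<lambda>i. y (N + i)))) i)"
    using insert.hyps by auto
  moreover have "\<forall>i<N + M. P i \<in> invariants" using IH(2) k(2) by (auto simp: P_def)
  ultimately show ?case using s(1) by blast
qed

text \<open>A function \<open>\<Phi>\<close> on a normed space, applied to the vector assembled by maps \<open>J i\<close> from holomorphic functions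
  \<open>h i\<close>, is holomorphic if its derivative is complex linear along every \<open>J i\<close>.\<close>

lemma holomorphic_on_quotient_compose:
  fixes \<Phi> :: "'e::real_normed_vector \<Rightarrow> complex" and J :: "'i \<Rightarrow> complex \<Rightarrow> 'e"
  assumes I: "finite I" and h: "\<And>i. i \<in> I \<Longrightarrow> holomorphic_on_quotient U (h i)"
    and J: "\<And>i. i \<in> I \<Longrightarrow> bounded_linear (J i)" and "open E"
    and E: "\<And>q. q \<in> U \<Longrightarrow> (\<Sum>i\<in>I. J i (h i q)) \<in> E"
    and \<Phi>: "\<And>e. e \<in> E \<Longrightarrow> \<exists>\<Phi>'. (\<Phi> has_derivative \<Phi>') (at e) \<and>
      (\<forall>i\<in>I. \<forall>c w. \<Phi>' (J i (c * w)) = c * \<Phi>' (J i w))"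
  shows "holomorphic_on_quotient U (\<lambda>q. \<Phi> (\<Sum>i\<in>I. J i (h i q)))"
  unfolding holomorphic_on_quotient_iff_rep
proof
  fix x assume x: "x \<in> U"
  obtain N p r F where r: "r > 0" and p: "\<forall>i<N. p i \<in> invariants"
    and F: "\<And>i. i \<in> I \<Longrightarrow> holo_rep U x N p r (h i) (F i)"
    using common_holo_rep[of I x U h] I x h by blast
  let ?a = "\<lambda>i. x (p i)" and ?G = "\<lambda>y. \<Sum>i\<in>I. J i (F i y)"
  have diff: "complex_differentiable_at N (F i) y" if "i \<in> I" "\<forall>i<N. cmod (y i - ?a i) < r" for i y
    using F[OF that(1)] that(2) by (auto simp: holo_rep_def)
  have eq: "h i u = F i (\<lambda>j. u (p j))" if "i \<in> I" "u \<in> U" "\<forall>i<N. cmod (u (p i) - ?a i) < r" for i u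
    using F[OF that(1)] that by (auto simp: holo_rep_def)
  have "\<exists>c. approximated_at N (F i) (\<lambda>h. \<Sum>j<N. c j * h j) ?a" if "i \<in> I" for i
  proof -
    have "complex_differentiable_at N (F i) ?a" by (rule diff[OF that]) (use r in simp)
    then show ?thesis by (rule approximated_at_complex) (rule exI)
  qed
  then obtain c where "\<And>i. i \<in> I \<Longrightarrow> approximated_at N (F i) (\<lambda>h. \<Sum>j<N. c i j * h j) ?a"
    using bchoice[of I "\<lambda>i c. approximated_at N (F i) (\<lambda>h. \<Sum>j<N. c j * h j) ?a"] by blast
  from approximated_at_sum[OF I this J]
  have G: "approximated_at N ?G (\<lambda>h. \<Sum>i\<in>I. J i (\<Sum>j<N. c i j * h j)) ?a" .
  have "?G ?a = (\<Sum>i\<in>I. J i (h i x))"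
    by (intro sum.cong refl arg_cong[of _ _ "J _"] eq[symmetric]) (use x r in auto)
  then have "?G ?a \<in> E" using E[OF x] by simp
  then obtain e where e: "e > 0" "ball (?G ?a) e \<subseteq> E" using \<open>open E\<close> open_contains_ball by blast
  obtain \<delta> where \<delta>: "\<delta> > 0" "\<And>y. (\<And>i. i < N \<Longrightarrow> cmod (y i - ?a i) < \<delta>) \<Longrightarrow> norm (?G y - ?G ?a) < e"
    using approximated_at_near[OF G e(1)] by blast
  have GE: "?G y \<in> E" if "\<forall>i<N. cmod (y i - ?a i) < \<delta>" for y
  proof -
    have "?G y \<in> ball (?G ?a) e" using \<delta>(2)[of y] that by (simp add: dist_norm norm_minus_commute)
    then show ?thesis using e by auto
  qed
  have "holo_rep U x N p (min r \<delta>) (\<lambda>q. \<Phi> (\<Sum>i\<in>I. J i (h i q))) (\<lambda>y. \<Phi> (?G y))"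
    unfolding holo_rep_def
  proof (intro conjI allI ballI impI)
    fix y assume y: "\<forall>i<N. cmod (y i - ?a i) < min r \<delta>"
    obtain \<Phi>' where "(\<Phi> has_derivative \<Phi>') (at (?G y))" "\<And>i c w. i \<in> I \<Longrightarrow> \<Phi>' (J i (c * w)) = c * \<Phi>' (J i w)"
      using \<Phi>[OF GE, of y] y by auto
    then show "complex_differentiable_at N (\<lambda>y. \<Phi> (?G y)) y"
      by (intro complex_differentiable_at_compose[where \<Phi>' = \<Phi>', OF I _ J] diff) (use y in auto)
  next
    fix u assume u: "u \<in> U" "\<forall>i<N. cmod (u (p i) - ?a i) < min r \<delta>"
    then have "(\<Sum>i\<in>I. J i (h i u)) = ?G (\<lambda>j. u (p j))"
      by (intro sum.cong refl arg_cong[of _ _ "J _"] eq) auto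
    then show "\<Phi> (\<Sum>i\<in>I. J i (h i u)) = \<Phi> (?G (\<lambda>j. u (p j)))" by simp
  qed
  then show "\<exists>N p F r. r > 0 \<and> (\<forall>i<N. p i \<in> invariants) \<and>
      holo_rep U x N p r (\<lambda>q. \<Phi> (\<Sum>i\<in>I. J i (h i q))) F"
    using r \<delta>(1) p by (intro exI[of _ N] exI[of _ p] exI[of _ "\<lambda>y. \<Phi> (?G y)"] exI[of _ "min r \<delta>"]) auto
qed

lemma holomorphic_on_quotient_subset:
  assumes "holomorphic_on_quotient U h" "U' \<subseteq> U"
  shows "holomorphic_on_quotient U' h"
  unfolding holomorphic_on_quotient_iff_rep
proof
  fix x assume "x \<in> U'"
  then obtain N p F r where "r > 0 \<and> (\<forall>i<N. p i \<in> invariants) \<and> holo_rep U x N p r h F"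
    using assms unfolding holomorphic_on_quotient_iff_rep by blast
  then have "r > 0 \<and> (\<forall>i<N. p i \<in> invariants) \<and> holo_rep U' x N p r h F"
    using holo_rep_subset[OF _ assms(2)] by blast
  then show "\<exists>N p F r. r > 0 \<and> (\<forall>i<N. p i \<in> invariants) \<and> holo_rep U' x N p r h F"
    by (intro exI)
qed

lemma holomorphic_on_quotient_invariant:
  assumes "p \<in> invariants"
  shows "holomorphic_on_quotient U (\<lambda>q. q p)"
proof -
  have "complex_differentiable_at 1 (\<lambda>y. y 0) y" for y
    unfolding complex_differentiable_at_def by (intro exI[of _ "\<lambda>i. 1"]) (auto intro: exI[of _ 1])
  then show ?thesis unfolding holomorphic_on_quotient_def
    by (intro ballI exI[of _ 1] exI[of _ "\<lambda>i. p"] exI[of _ "\<lambda>y. y 0"]) (simp add: assms)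
qed

lemma holomorphic_on_quotient_const: "holomorphic_on_quotient U (\<lambda>q. c)"
proof -
  have "complex_differentiable_at 0 (\<lambda>y. c) y" for y
    unfolding complex_differentiable_at_def by (auto intro: exI[of _ 1])
  then show ?thesis unfolding holomorphic_on_quotient_def
    by (intro ballI exI[of _ 0] exI[of _ "\<lambda>i z. 0"] exI[of _ "\<lambda>y. c"] exI[of _ 1]) simp
qed

lemma holomorphic_on_quotient_compose2:
  fixes \<Phi> :: "complex \<times> complex \<Rightarrow> complex"
  assumes h: "holomorphic_on_quotient U f" "holomorphic_on_quotient U g"
    and \<Phi>: "\<And>e. \<exists>\<Phi>'. (\<Phi> has_derivative \<Phi>') (at e) \<and>
      (\<forall>c x y. \<Phi>' (c * x, c * y) = c * \<Phi>' (x, y))"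
  shows "holomorphic_on_quotient U (\<lambda>q. \<Phi> (f q, g q))"
proof -
  let ?J = "\<lambda>b w. if b then (w, 0) else (0, w :: complex)"
  have "holomorphic_on_quotient U (\<lambda>q. \<Phi> (\<Sum>b\<in>UNIV. ?J b (if b then f q else g q)))"
  proof (rule holomorphic_on_quotient_compose[where E = UNIV and h = "\<lambda>b q. if b then f q else g q"])
    show "bounded_linear (?J b)" for b
      by (cases b) (auto intro: bounded_linear_Pair bounded_linear_ident bounded_linear_zero)
    fix e
    obtain \<Phi>' where "(\<Phi> has_derivative \<Phi>') (at e)" "\<And>c x y. \<Phi>' (c * x, c * y) = c * \<Phi>' (x, y)"
      using \<Phi> by blast
    moreover from this(2)[of _ _ 0] this(2)[of _ 0]
    have "\<Phi>' (?J b (c * w)) = c * \<Phi>' (?J b w)" for b c w by (cases b) auto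
    ultimately show "\<exists>\<Phi>'. (\<Phi> has_derivative \<Phi>') (at e) \<and>
      (\<forall>b\<in>UNIV. \<forall>c w. \<Phi>' (?J b (c * w)) = c * \<Phi>' (?J b w))" by blast
    show "holomorphic_on_quotient U (\<lambda>q. if b then f q else g q)" for b
      using h by (cases b) auto
  qed auto
  then show ?thesis by (simp add: UNIV_bool)
qed

lemma holomorphic_on_quotient_add:
  assumes "holomorphic_on_quotient U f" "holomorphic_on_quotient U g"
  shows "holomorphic_on_quotient U (\<lambda>q. f q + g q)"
proof -
  have "holomorphic_on_quotient U (\<lambda>q. (\<lambda>e. fst e + snd e) (f q, g q))"
  proof (rule holomorphic_on_quotient_compose2[OF assms])
    fix e :: "complex \<times> complex"
    have "((\<lambda>e. fst e + snd e) has_derivative (\<lambda>e. fst e + snd e)) (at e)"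
      by (auto intro!: derivative_eq_intros)
    then show "\<exists>\<Phi>'. ((\<lambda>e. fst e + snd e) has_derivative \<Phi>') (at e) \<and>
        (\<forall>c x y. \<Phi>' (c * x, c * y) = c * \<Phi>' (x, y))"
      by (intro exI[of _ "\<lambda>e. fst e + snd e"]) (auto simp: algebra_simps)
  qed
  then show ?thesis by simp
qed

lemma holomorphic_on_quotient_mult:
  assumes "holomorphic_on_quotient U f" "holomorphic_on_quotient U g"
  shows "holomorphic_on_quotient U (\<lambda>q. f q * g q)"
proof -
  have "holomorphic_on_quotient U (\<lambda>q. (\<lambda>e. fst e * snd e) (f q, g q))"
  proof (rule holomorphic_on_quotient_compose2[OF assms])
    fix e :: "complex \<times> complex"
    have "((\<lambda>e. fst e * snd e) has_derivative (\<lambda>h. fst e * snd h + fst h * snd e)) (at e)"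
      by (auto intro!: derivative_eq_intros)
    then show "\<exists>\<Phi>'. ((\<lambda>e. fst e * snd e) has_derivative \<Phi>') (at e) \<and>
        (\<forall>c x y. \<Phi>' (c * x, c * y) = c * \<Phi>' (x, y))"
      by (intro exI[of _ "\<lambda>h. fst e * snd h + fst h * snd e"]) (auto simp: algebra_simps)
  qed
  then show ?thesis by simp
qed

lemma holomorphic_on_quotient_inverse:
  assumes "holomorphic_on_quotient U f" "\<And>q. q \<in> U \<Longrightarrow> f q \<noteq> 0"
  shows "holomorphic_on_quotient U (\<lambda>q. inverse (f q))"
proof -
  have "holomorphic_on_quotient U (\<lambda>q. inverse (\<Sum>i\<in>{()}. f q))"
  proof (rule holomorphic_on_quotient_compose[where E = "- {0}" and J = "\<lambda>i w. w" and h = "\<lambda>i. f"])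
    fix e :: complex assume "e \<in> - {0}"
    then have "(inverse has_derivative (\<lambda>h. - (inverse e * h * inverse e))) (at e)"
      by (intro has_derivative_inverse') auto
    then show "\<exists>\<Phi>'. (inverse has_derivative \<Phi>') (at e) \<and> (\<forall>i\<in>{()}. \<forall>c w. \<Phi>' (c * w) = c * \<Phi>' w)"
      by (intro exI[of _ "\<lambda>h. - (inverse e * h * inverse e)"]) auto
  qed (use assms in auto)
  then show ?thesis by simp
qed

lemma holomorphic_on_quotient_divide:
  assumes "holomorphic_on_quotient U f" "holomorphic_on_quotient U g" "\<And>q. q \<in> U \<Longrightarrow> g q \<noteq> 0"
  shows "holomorphic_on_quotient U (\<lambda>q. f q / g q)"
  unfolding divide_inverse
  by (intro holomorphic_on_quotient_mult holomorphic_on_quotient_inverse assms)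

lemma holomorphic_on_quotient_diff:
  assumes "holomorphic_on_quotient U f" "holomorphic_on_quotient U g"
  shows "holomorphic_on_quotient U (\<lambda>q. f q - g q)"
  using holomorphic_on_quotient_add[OF assms(1)
      holomorphic_on_quotient_mult[OF holomorphic_on_quotient_const[of U "-1"] assms(2)]]
  by simp

lemma openin_holomorphic_preimage:
  assumes h: "holomorphic_on_quotient U h" and U: "openin Q0_topology U" and "open E"
  shows "openin Q0_topology {q \<in> U. h q \<in> E}"
proof (subst openin_subopen, clarify)
  fix x assume x: "x \<in> U" "h x \<in> E"
  obtain N p F r where r: "r > 0" "\<forall>i<N. p i \<in> invariants" and rep: "holo_rep U x N p r h F"
    using h x unfolding holomorphic_on_quotient_iff_rep by blast
  let ?a = "\<lambda>i. x (p i)"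
  have "complex_differentiable_at N F ?a" using rep r by (auto simp: holo_rep_def)
  then obtain c where F: "approximated_at N F (\<lambda>h. \<Sum>i<N. c i * h i) ?a"
    by (rule approximated_at_complex)
  have hx: "h x = F ?a" using rep x r by (auto simp: holo_rep_def)
  obtain e where e: "e > 0" "ball (h x) e \<subseteq> E" using \<open>open E\<close> x open_contains_ball by blast
  obtain \<delta> where \<delta>: "\<delta> > 0" "\<And>y. (\<And>i. i < N \<Longrightarrow> cmod (y i - ?a i) < \<delta>) \<Longrightarrow> norm (F y - F ?a) < e"
    using approximated_at_near[OF F e(1)] by blast
  let ?T = "U \<inter> {q \<in> Q0. \<forall>i<N. cmod (q (p i) - x (p i)) < min r \<delta>}"
  have "openin Q0_topology ?T"
    by (intro openin_Int U openin_Q0_polydisc) (use r in auto)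
  moreover have "x \<in> Q0" using x(1) openin_subset[OF U] by auto
  then have "x \<in> ?T" using x r \<delta> by auto
  moreover have "?T \<subseteq> {q \<in> U. h q \<in> E}"
  proof
    fix q assume "q \<in> ?T"
    then have q: "q \<in> U" "\<forall>i<N. cmod (q (p i) - x (p i)) < min r \<delta>" by auto
    then have "h q = F (\<lambda>i. q (p i))" using rep by (auto simp: holo_rep_def)
    moreover have "norm (F (\<lambda>i. q (p i)) - F ?a) < e" using \<delta>(2)[of "\<lambda>i. q (p i)"] q by auto
    ultimately have "h q \<in> ball (h x) e" by (simp add: hx dist_norm norm_minus_commute)
    then show "q \<in> {q \<in> U. h q \<in> E}" using e q by auto
  qed
  ultimately show "\<exists>T. openin Q0_topology T \<and> x \<in> T \<and> T \<subseteq> {q \<in> U. h q \<in> E}" by blast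
qed

text \<open>Holomorphic functions on open parts of the quotient pull back to holomorphic functions of tuples.\<close>

lemma holo_at_pi0:
  fixes U :: "('d::finite, 'n::finite) qpoint set"
  assumes h: "holomorphic_on_quotient U h" and U: "openin Q0_topology U"
    and z: "z \<in> generating_tuples" "pi0 z \<in> U"
  shows "holo_at (\<lambda>z. h (pi0 z)) z"
proof -
  obtain N p F r where r: "r > 0" and p: "\<And>i. i < N \<Longrightarrow> p i \<in> invariants"
    and rep: "holo_rep U (pi0 z) N p r h F"
    using h z unfolding holomorphic_on_quotient_iff_rep by blast
  have pz: "cmod (p i w - p i z) < r \<longleftrightarrow> cmod (pi0 w (p i) - pi0 z (p i)) < r" if "i < N" for i w
    using p[OF that] by simp
  define S where "S = {w \<in> generating_tuples. pi0 w \<in> U} \<inter> (\<Inter>i\<in>{..<N}. {w. cmod (p i w - p i z) < r})"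
  have "\<forall>i<N. holo_at (p i) z"
    using p by (auto simp: invariants_def intro: holo_at_polynomial)
  then obtain p' where p': "\<And>i. i < N \<Longrightarrow> (p i has_derivative p' i) (at z)"
      "\<And>i c v. i < N \<Longrightarrow> p' i (tuple_scale c v) = c * p' i v"
    unfolding holo_at_def by metis
  have "\<forall>i<N. cmod (p i z - pi0 z (p i)) < r" using p r by simp
  then have "complex_differentiable_at N F (\<lambda>i. p i z)" using rep by (auto simp: holo_rep_def)
  from complex_differentiable_at_has_derivative[of N F p z, OF this p'(1)]
  obtain c where "((\<lambda>x. F (\<lambda>i. p i x)) has_derivative (\<lambda>h. \<Sum>i<N. c i * p' i h)) (at z)" by blast
  then have "holo_at (\<lambda>w. F (\<lambda>i. p i w)) z"
    unfolding holo_at_def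
    by (intro exI[of _ "\<lambda>h. \<Sum>i<N. c i * p' i h"]) (auto simp: p' sum_distrib_left algebra_simps intro!: sum.cong)
  then show ?thesis
  proof (rule holo_at_cong)
    have "open {w. cmod (p i w - p i z) < r}" if "i < N" for i
      using p[OF that] by (intro open_Collect_less continuous_intros polynomial_fun_continuous)
        (auto simp: invariants_def)
    then show "open S" unfolding S_def
      by (intro open_Int open_pi0_preimage U open_INT finite_lessThan) auto
    show "z \<in> S" using z r by (simp add: S_def)
    fix w assume w: "w \<in> S"
    then have "h (pi0 w) = F (\<lambda>i. pi0 w (p i))" using rep pz by (auto simp: holo_rep_def S_def)
    also have "\<dots> = F (\<lambda>i. p i w)"
    proof (rule complex_differentiable_at_cong[where N = N and a = "\<lambda>i. p i w"])
      have "\<forall>i<N. cmod (p i w - pi0 z (p i)) < r" using w p by (simp add: S_def)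
      then show "complex_differentiable_at N F (\<lambda>i. p i w)"
        using rep[unfolded holo_rep_def, THEN conjunct1, rule_format, of "\<lambda>i. p i w"] by blast
    qed (use p in auto)
    finally show "F (\<lambda>i. p i w) = h (pi0 w)" by simp
  qed
qed

lemma tuple_eq_sum_axis:
  fixes z :: "('d::finite, 'n::finite) mtuple"
  shows "z = (\<Sum>m\<in>UNIV. axis (fst m) (axis (fst (snd m)) (axis (snd (snd m))
    (z $ fst m $ fst (snd m) $ snd (snd m)))))"
proof -
  have "(\<Sum>m\<in>UNIV. axis (fst m) (axis (fst (snd m)) (axis (snd (snd m))
    (z $ fst m $ fst (snd m) $ snd (snd m)))) $ k $ i $ j)
    = (\<Sum>m\<in>UNIV. if m = (k, i, j) then z $ k $ i $ j else 0)" for k i j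
    by (intro sum.cong) (auto simp: axis_def)
  then show ?thesis by (simp add: vec_eq_iff)
qed

text \<open>Composition of a holomorphic function of tuples with a holomorphic map into tuples.\<close>

lemma holomorphic_on_quotient_compose_tuple:
  fixes s :: "('d::finite, 'n::finite) qpoint \<Rightarrow> ('d, 'n) mtuple"
  assumes f: "holomorphic_fun D f" "open D" and s: "\<And>q. q \<in> U \<Longrightarrow> s q \<in> D"
    and hol: "\<And>k i j. holomorphic_on_quotient U (\<lambda>q. s q $ k $ i $ j)"
  shows "holomorphic_on_quotient U (\<lambda>q. f (s q))"
proof -
  let ?J = "\<lambda>m w. axis (fst m) (axis (fst (snd m)) (axis (snd (snd m)) w)) :: ('d, 'n) mtuple"
  let ?h = "\<lambda>m q. s q $ fst m $ fst (snd m) $ snd (snd m)"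
  have eq: "(\<Sum>m\<in>UNIV. ?J m (?h m q)) = s q" for q
    by (rule tuple_eq_sum_axis[symmetric])
  have "holomorphic_on_quotient U (\<lambda>q. f (\<Sum>m\<in>UNIV. ?J m (?h m q)))"
  proof (rule holomorphic_on_quotient_compose[where E = D and h = ?h])
    fix m :: "'d \<times> 'n \<times> 'n"
    show "bounded_linear (?J m)"
      by (intro linear_conv_bounded_linear[THEN iffD1] linearI) (auto simp: vec_eq_iff axis_def)
    show "holomorphic_on_quotient U (?h m)" using hol by simp
  next
    fix e assume "e \<in> D"
    then obtain f' where f': "(f has_derivative f') (at e)" "\<And>c v. f' (tuple_scale c v) = c * f' v"
      using f(1) unfolding holomorphic_fun_def by blast
    have "?J m (c * w) = tuple_scale c (?J m w)" for m c w
      by (auto simp: vec_eq_iff axis_def)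
    then show "\<exists>\<Phi>'. (f has_derivative \<Phi>') (at e) \<and>
      (\<forall>m\<in>UNIV. \<forall>c w. \<Phi>' (?J m (c * w)) = c * \<Phi>' (?J m w))" using f' by auto
  qed (use f(2) s eq in auto)
  then show ?thesis unfolding eq .
qed


section \<open>Holomorphic dependence of simple eigenvalues\<close>

text \<open>A simple root of a polynomial is locally a holomorphic function of parameters on which the
  polynomial depends linearly.\<close>

lemma simple_root_holomorphic:
  fixes l :: "'m::finite \<Rightarrow> complex poly" and c0 :: "complex^'m"
  assumes root: "(\<Sum>i\<in>UNIV. poly (l i) T0 * c0 $ i) = 0"
    and simple: "(\<Sum>i\<in>UNIV. poly (pderiv (l i)) T0 * c0 $ i) \<noteq> 0"
  obtains E \<mu> where "open E" "c0 \<in> E" "\<mu> c0 = T0"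
    "\<forall>c\<in>E. (\<Sum>i\<in>UNIV. poly (l i) (\<mu> c) * c $ i) = 0"
    "\<forall>c\<in>E. \<exists>\<mu>'. (\<mu> has_derivative \<mu>') (at c) \<and> (\<forall>a v. \<mu>' (a *s v) = a * \<mu>' v)"
proof -
  \<comment> \<open>the inverse function theorem is applied to the map that sends \<open>(T, c)\<close> to the value at \<open>T\<close> of the
    polynomial with parameters \<open>c\<close>, together with \<open>c\<close>; \<open>G\<close> inverts its derivative at \<open>(T0, c0)\<close>\<close>
  define f :: "complex \<times> (complex^'m) \<Rightarrow> complex \<times> (complex^'m)"
    where "f = (\<lambda>x. (\<Sum>i\<in>UNIV. poly (l i) (fst x) * snd x $ i, snd x))"
  define Df :: "complex \<times> (complex^'m) \<Rightarrow> complex \<times> (complex^'m) \<Rightarrow> complex \<times> (complex^'m)"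
    where "Df = (\<lambda>x h. ((\<Sum>i\<in>UNIV. poly (l i) (fst x) * snd h $ i
        + poly (pderiv (l i)) (fst x) * fst h * snd x $ i), snd h))"
  have der: "(f has_derivative Df x) (at x)" for x
  proof -
    have "((\<lambda>x. poly (l i) (fst x)) has_derivative (\<lambda>h. poly (pderiv (l i)) (fst x) * fst h)) (at x)" for i
    proof -
      have 1: "(fst has_derivative fst) (at x)" by (auto intro!: derivative_eq_intros)
      have 2: "(poly (l i) has_derivative (*) (poly (pderiv (l i)) (fst x))) (at (fst x))"
        using poly_DERIV[of "l i" "fst x"] by (simp add: has_field_derivative_def)
      from has_derivative_compose[OF 1 2] show ?thesis .
    qed
    moreover have "((\<lambda>x. snd x $ i) has_derivative (\<lambda>h. snd h $ i)) (at x)" for i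
      by (intro bounded_linear_imp_has_derivative bounded_linear_compose[OF bounded_linear_vec_nth bounded_linear_snd])
    ultimately show ?thesis unfolding f_def Df_def
      by (intro has_derivative_Pair has_derivative_sum has_derivative_mult)
        (auto intro!: derivative_eq_intros)
  qed
  have bl: "bounded_linear (Df x)" for x using der by (rule has_derivative_bounded_linear)
  define f' where "f' = (\<lambda>x. Blinfun (Df x))"
  have f': "blinfun_apply (f' x) = Df x" for x
    unfolding f'_def by (rule bounded_linear_Blinfun_apply[OF bl])
  have contf': "continuous_on UNIV f'"
    by (rule continuous_on_blinfun_componentwise) (auto simp: f' Df_def intro!: continuous_intros)
  define D where "D = (\<Sum>i\<in>UNIV. poly (pderiv (l i)) T0 * c0 $ i)"
  define G :: "complex \<times> (complex^'m) \<Rightarrow> complex \<times> (complex^'m)"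
    where "G = (\<lambda>y. ((fst y - (\<Sum>i\<in>UNIV. poly (l i) T0 * snd y $ i)) / D, snd y))"
  have blG: "bounded_linear G"
    unfolding G_def
    by (intro bounded_linear_Pair bounded_linear_snd bounded_linear_compose[OF bounded_linear_divide]
        bounded_linear_sub bounded_linear_fst bounded_linear_sum bounded_linear_const_mult
        bounded_linear_compose[OF bounded_linear_vec_nth bounded_linear_snd])
  have inv: "Blinfun G o\<^sub>L f' (T0, c0) = id_blinfun"
  proof (rule blinfun_eqI)
    fix h :: "complex \<times> (complex^'m)"
    have "(\<Sum>i\<in>UNIV. poly (pderiv (l i)) T0 * fst h * c0 $ i) = D * fst h"
      unfolding D_def sum_distrib_right by (intro sum.cong refl) simp
    then have "G (Df (T0, c0) h) = h"
      using simple by (simp add: G_def Df_def sum.distrib D_def[symmetric] prod_eq_iff)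
    then show "blinfun_apply (Blinfun G o\<^sub>L f' (T0, c0)) h = blinfun_apply id_blinfun h"
      by (simp add: f' bounded_linear_Blinfun_apply[OF blG])
  qed
  have derf: "(f has_derivative blinfun_apply (f' x)) (at x)" for x using der f' by simp
  have "\<exists>V g (g' :: _ \<Rightarrow> _ \<Rightarrow> _). open V \<and> f (T0, c0) \<in> V \<and> g (f (T0, c0)) = (T0, c0) \<and> (\<forall>y\<in>V. f (g y) = y) \<and>
      (\<forall>y\<in>V. (g has_derivative (g' y)) (at y)) \<and>
      (\<forall>y\<in>V. g' y = inv_into UNIV (Df (g y))) \<and> (\<forall>y\<in>V. bij (Df (g y)))"
  proof (rule inverse_function_theorem[OF open_UNIV derf contf' UNIV_I inv])
    fix U' V g g'
    assume *: "(T0, c0) \<in> U'" "open V" "f (T0, c0) \<in> V" "homeomorphism U' V f g"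
      "\<And>y. y \<in> V \<Longrightarrow> (g has_derivative (g' y)) (at y)"
      "\<And>y. y \<in> V \<Longrightarrow> g' y = inv_into UNIV (blinfun_apply (f' (g y)))"
      "\<And>y. y \<in> V \<Longrightarrow> bij (blinfun_apply (f' (g y)))"
    then show ?thesis
      by (intro exI[of _ V] exI[of _ g] exI[of _ g']) (simp add: homeomorphism_def f')
  qed
  then obtain V g g' where V: "open V" "f (T0, c0) \<in> V" "g (f (T0, c0)) = (T0, c0)"
    and fg: "\<And>y. y \<in> V \<Longrightarrow> f (g y) = y"
    and g': "\<forall>y\<in>V. (g has_derivative (g' y)) (at y)"
      "\<forall>y\<in>V. g' y = inv_into UNIV (Df (g y))" "\<forall>y\<in>V. bij (Df (g y))"
    by blast
  have f0: "f (T0, c0) = (0, c0)" using root by (simp add: f_def)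
  define E where "E = {c. (0, c) \<in> V}"
  define \<mu> where "\<mu> = (\<lambda>c. fst (g (0, c)))"
  have g2: "g (0, c) = (\<mu> c, c)" if "c \<in> E" for c
    using fg[of "(0, c)"] that by (auto simp: E_def f_def \<mu>_def prod_eq_iff)
  show ?thesis
  proof (rule that)
    show "open E" unfolding E_def
      using open_vimage[OF V(1), of "\<lambda>c. (0, c)"] by (simp add: vimage_def continuous_on_Pair)
    show "c0 \<in> E" using V f0 by (simp add: E_def)
    show "\<mu> c0 = T0" using V(3) by (simp add: f0 \<mu>_def)
    show "\<forall>c\<in>E. (\<Sum>i\<in>UNIV. poly (l i) (\<mu> c) * c $ i) = 0"
    proof
      fix c assume c: "c \<in> E"
      then have cV: "(0, c) \<in> V" by (simp add: E_def)
      show "(\<Sum>i\<in>UNIV. poly (l i) (\<mu> c) * c $ i) = 0"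
        using fg[OF cV] g2[OF c] by (simp add: f_def)
    qed
    show "\<forall>c\<in>E. \<exists>\<mu>'. (\<mu> has_derivative \<mu>') (at c) \<and> (\<forall>a v. \<mu>' (a *s v) = a * \<mu>' v)"
    proof
      fix c assume c: "c \<in> E"
      then have cV: "(0, c) \<in> V" by (simp add: E_def)
      let ?A = "Df (g (0, c))"
      have bij: "bij ?A" and inv: "g' (0, c) = inv_into UNIV ?A" using bspec[OF g'(2) cV] bspec[OF g'(3) cV] by (simp_all add: f')
      have A: "?A (a * fst h, a *s snd h) = (a * fst (?A h), a *s snd (?A h))" for a h
        by (simp add: Df_def sum_distrib_left algebra_simps)
      have invA: "inv_into UNIV ?A (a * fst y, a *s snd y) = (a * fst (inv_into UNIV ?A y), a *s snd (inv_into UNIV ?A y))" for a y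
      proof -
        have "?A (inv_into UNIV ?A y) = y" using bij by (simp add: bij_is_surj surj_f_inv_f)
        then have "?A (a * fst (inv_into UNIV ?A y), a *s snd (inv_into UNIV ?A y)) = (a * fst y, a *s snd y)"
          using A[of a "inv_into UNIV ?A y"] by simp
        then show ?thesis using bij by (metis bij_is_inj inv_f_f)
      qed
      have "((\<lambda>c. (0::complex, c)) has_derivative (\<lambda>h. (0, h))) (at c)"
        by (auto intro!: derivative_eq_intros)
      from has_derivative_compose[OF this bspec[OF g'(1) cV]]
      have "((\<lambda>c. g (0, c)) has_derivative (\<lambda>h. g' (0, c) (0, h))) (at c)" .
      then have "(\<mu> has_derivative (\<lambda>h. fst (g' (0, c) (0, h)))) (at c)"
        unfolding \<mu>_def by (rule has_derivative_fst)
      moreover have "fst (g' (0, c) (0, a *s v)) = a * fst (g' (0, c) (0, v))" for a v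
        using invA[of a "(0, v)"] by (simp add: inv)
      ultimately show "\<exists>\<mu>'. (\<mu> has_derivative \<mu>') (at c) \<and> (\<forall>a v. \<mu>' (a *s v) = a * \<mu>' v)"
        by (intro exI[of _ "\<lambda>h. fst (g' (0, c) (0, h))"]) auto
    qed
  qed
qed

text \<open>The characteristic polynomial of a matrix, as the determinant of a matrix of polynomials.\<close>

definition char_poly_mat :: "'n::finite cmat \<Rightarrow> complex poly" where
  "char_poly_mat A = det (\<chi> i j. [:- A $ i $ j, if i = j then 1 else 0:])"

lemma poly_char_poly_mat: "poly (char_poly_mat A) T = det (mat T - A)"
proof -
  have "poly (of_int k) T = of_int k" for k by (simp flip: of_int_poly)
  then show ?thesis
    by (simp add: char_poly_mat_def det_def poly_sum poly_prod mat_nth if_distrib[of "(*) T"]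
        cong: if_cong)
qed

lemma degree_char_poly_mat: "degree (char_poly_mat (A :: 'n::finite cmat)) \<le> CARD('n)"
  unfolding char_poly_mat_def det_def
proof (rule degree_sum_le)
  fix p :: "'n \<Rightarrow> 'n"
  let ?M = "\<chi> i j. [:- A $ i $ j, if i = j then 1 else 0:]"
  have "degree (of_int (sign p) * (\<Prod>i\<in>UNIV. ?M $ i $ p i)) \<le> degree (\<Prod>i\<in>UNIV. ?M $ i $ p i)"
    by (rule order_trans[OF degree_mult_le]) (simp flip: of_int_poly)
  also have "\<dots> \<le> (\<Sum>i\<in>UNIV. degree (?M $ i $ p i))"
    using degree_prod_sum_le[of UNIV "\<lambda>i. ?M $ i $ p i"] by (simp add: o_def)
  also have "\<dots> \<le> (\<Sum>i\<in>(UNIV :: 'n set). 1)" by (rule sum_mono) simp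
  finally show "degree (of_int (sign p) * (\<Prod>i\<in>UNIV. ?M $ i $ p i)) \<le> CARD('n)" by simp
qed simp

lemma finite_inj_complex: "\<exists>a :: 'm::finite \<Rightarrow> complex. inj a"
proof -
  obtain h :: "'m \<Rightarrow> nat" where "bij_betw h UNIV {0..<card (UNIV :: 'm set)}"
    using ex_bij_betw_finite_nat[of "UNIV :: 'm set"] by auto
  then have "inj (\<lambda>x. complex_of_nat (h x))"
    by (auto simp: bij_betw_def inj_on_def)
  then show ?thesis by blast
qed

text \<open>The polynomial with value \<open>1\<close> at the node \<open>a i\<close> and \<open>0\<close> at the other nodes, for injective \<open>a\<close>.\<close>

definition lagrange_poly :: "('m::finite \<Rightarrow> complex) \<Rightarrow> 'm \<Rightarrow> complex poly" where
  "lagrange_poly a i = (\<Prod>j\<in>UNIV - {i}. Polynomial.smult (1 / (a i - a j)) [:- a j, 1:])"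

lemma poly_lagrange_factor:
  "poly (Polynomial.smult (1 / (a - b)) [:- b, 1:]) x = (x - b) / (a - b)" for a b x :: complex
  by (simp add: diff_divide_distrib)

lemma poly_lagrange_poly:
  assumes "inj a"
  shows "poly (lagrange_poly a i) (a j) = (if i = j then 1 else 0)"
proof (cases "i = j")
  case True
  then show ?thesis using assms unfolding lagrange_poly_def poly_prod poly_lagrange_factor
    by (auto simp: inj_eq intro!: prod.neutral)
next
  case False
  then show ?thesis unfolding lagrange_poly_def poly_prod poly_lagrange_factor
    by (auto intro!: prod_zero bexI[of _ j])
qed

lemma degree_lagrange_poly: "degree (lagrange_poly a (i::'m::finite)) < CARD('m)"
proof -
  have "degree (lagrange_poly a i) \<le> (\<Sum>j\<in>UNIV - {i}. degree (Polynomial.smult (1 / (a i - a j)) [:- a j, 1:]))"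
    unfolding lagrange_poly_def
    using degree_prod_sum_le[of "UNIV - {i}" "\<lambda>j. Polynomial.smult (1 / (a i - a j)) [:- a j, 1:]"] by (simp add: o_def)
  also have "\<dots> \<le> (\<Sum>j\<in>UNIV - {i}. 1)" by (rule sum_mono) simp
  also have "\<dots> < CARD('m)" by (simp add: card_Diff_singleton)
  finally show ?thesis .
qed

lemma lagrange_interpolation:
  fixes a :: "'m::finite \<Rightarrow> complex"
  assumes "inj a" "degree p < CARD('m)"
  shows "p = (\<Sum>i\<in>UNIV. Polynomial.smult (poly p (a i)) (lagrange_poly a i))"
proof (rule poly_eqI_degree[where A = "range a"])
  show "poly p x = poly (\<Sum>i\<in>UNIV. Polynomial.smult (poly p (a i)) (lagrange_poly a i)) x" if x: "x \<in> range a" for x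
  proof -
    obtain j where "x = a j" using x by auto
    then show ?thesis
      by (simp add: poly_sum poly_lagrange_poly[OF assms(1)] if_distrib[of "(*) _"] cong: if_cong)
  qed
  have card: "card (range a) = CARD('m)" using assms(1) by (simp add: card_image)
  then show "card (range a) > degree p" using assms(2) by simp
  have "degree (\<Sum>i\<in>UNIV. Polynomial.smult (poly p (a i)) (lagrange_poly a i)) \<le> CARD('m) - 1"
  proof (rule degree_sum_le)
    show "degree (Polynomial.smult (poly p (a i)) (lagrange_poly a i)) \<le> CARD('m) - 1" for i
      using degree_smult_le[of "poly p (a i)" "lagrange_poly a i"] degree_lagrange_poly[of a i] by linarith
  qed simp
  then show "card (range a) > degree (\<Sum>i\<in>UNIV. Polynomial.smult (poly p (a i)) (lagrange_poly a i))"
    unfolding card using zero_less_card_finite[where 'a = 'm] by linarith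
qed

text \<open>The diagonal matrix with diagonal entries \<open>d i\<close>.\<close>

definition diag_mat :: "('n \<Rightarrow> complex) \<Rightarrow> 'n::finite cmat" where
  "diag_mat d = (\<chi> i j. if i = j then d i else 0)"

lemma diag_mat_nth [simp]: "diag_mat d $ i $ j = (if i = j then d i else 0)"
  by (simp add: diag_mat_def)

lemma char_poly_diag_mat: "char_poly_mat (diag_mat d) = (\<Prod>i\<in>UNIV. [:- d i, 1:])"
  unfolding char_poly_mat_def by (subst det_diagonal) auto

lemma pderiv_sum: "pderiv (\<Sum>x\<in>S. f x) = (\<Sum>x\<in>S. pderiv (f x))"
  by (induction S rule: infinite_finite_induct) (auto simp: pderiv_add)

lemma nc_polynomial_diff_mat: "nc_polynomial X \<Longrightarrow> nc_polynomial (\<lambda>z. mat T - X z)"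
proof -
  assume X: "nc_polynomial X"
  have "(\<lambda>z. mat T - X z) = (\<lambda>z. mat_scale T (mat 1) + mat_scale (-1) (X z))"
    by (auto simp: fun_eq_iff vec_eq_iff mat_nth)
  then show ?thesis by (simp only:) (intro nc_polynomial.add nc_polynomial.scale nc_polynomial.one X)
qed

text \<open>An eigenvalue of \<open>X z0\<close> continues to an eigenvalue of \<open>X z\<close> that is a holomorphic function of \<open>pi0 z\<close>. The
  characteristic polynomial of \<open>X z\<close> is parametrised by its values at \<open>n + 1\<close> fixed nodes, indexed by
  \<open>'n option\<close>: these values are determinants, hence invariants.\<close>

lemma eigenvalue_local_section:
  fixes X :: "('d::finite, 'n::finite) mtuple \<Rightarrow> 'n cmat"
  assumes X: "nc_polynomial X" and z0: "z0 \<in> generating_tuples"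
    and d: "inj d" "X z0 = diag_mat d"
  obtains U \<mu> where "openin Q0_topology U" "pi0 z0 \<in> U" "holomorphic_on_quotient U \<mu>" "\<mu> (pi0 z0) = d i"
    "\<And>z. pi0 z \<in> U \<Longrightarrow> det (mat (\<mu> (pi0 z)) - X z) = 0"
proof -
  obtain a :: "'n option \<Rightarrow> complex" where a: "inj a" using finite_inj_complex by blast
  define l where "l = lagrange_poly a"
  define p where "p = (\<lambda>k z. det (mat (a k) - X z))"
  have p: "p k \<in> invariants" for k
    unfolding p_def by (intro invariants_det nc_polynomial_diff_mat X)
  have char: "char_poly_mat (X z) = (\<Sum>k\<in>UNIV. Polynomial.smult (p k z) (l k))" for z
  proof -
    have "degree (char_poly_mat (X z)) < CARD('n option)"
      using degree_char_poly_mat[of "X z"] by (simp add: card_UNIV_option)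
    from lagrange_interpolation[OF a this] show ?thesis
      by (simp add: l_def p_def poly_char_poly_mat)
  qed
  have char0: "char_poly_mat (X z0) = [:- d i, 1:] * (\<Prod>j\<in>UNIV - {i}. [:- d j, 1:])"
    unfolding d char_poly_diag_mat by (rule prod.remove) auto
  define c0 :: "complex^'n option" where "c0 = (\<chi> k. p k z0)"
  have "(\<Sum>k\<in>UNIV. poly (l k) (d i) * c0 $ k) = poly (char_poly_mat (X z0)) (d i)"
    by (simp add: char poly_sum c0_def mult.commute)
  also have "\<dots> = 0" by (simp add: char0)
  finally have root: "(\<Sum>k\<in>UNIV. poly (l k) (d i) * c0 $ k) = 0" .
  have "(\<Sum>k\<in>UNIV. poly (pderiv (l k)) (d i) * c0 $ k) = poly (pderiv (char_poly_mat (X z0))) (d i)"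
    by (simp add: char poly_sum c0_def pderiv_sum pderiv_smult mult.commute)
  also have "\<dots> = (\<Prod>j\<in>UNIV - {i}. d i - d j)"
    unfolding char0 pderiv_mult poly_add poly_mult by (simp add: pderiv_pCons poly_prod)
  also have "\<dots> \<noteq> 0" using d(1) by (auto simp: inj_eq)
  finally have simple: "(\<Sum>k\<in>UNIV. poly (pderiv (l k)) (d i) * c0 $ k) \<noteq> 0" .
  from simple_root_holomorphic[OF root simple] obtain E \<mu> where E: "open E" "c0 \<in> E" "\<mu> c0 = d i"
      "\<forall>c\<in>E. (\<Sum>k\<in>UNIV. poly (l k) (\<mu> c) * c $ k) = 0"
      "\<forall>c\<in>E. \<exists>\<mu>'. (\<mu> has_derivative \<mu>') (at c) \<and> (\<forall>a v. \<mu>' (a *s v) = a * \<mu>' v)"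
    .
  obtain e where e: "e > 0" "ball c0 e \<subseteq> E" using E(1,2) open_contains_ball by blast
  define r where "r = e / CARD('n option)"
  have r: "r > 0" using e by (simp add: r_def)
  have near: "c \<in> E" if "\<And>k. cmod (c $ k - c0 $ k) < r" for c
  proof -
    have "norm (c - c0) \<le> (\<Sum>k\<in>UNIV. cmod ((c - c0) $ k))"
      unfolding norm_vec_def by (rule L2_set_le_sum) auto
    also have "\<dots> < (\<Sum>k\<in>(UNIV :: 'n option set). r)" by (rule sum_strict_mono) (use that in auto)
    also have "\<dots> = e" by (simp add: r_def)
    finally show ?thesis using e(2) by (auto simp: dist_norm norm_minus_commute)
  qed
  define U where "U = (\<Inter>k\<in>UNIV. {q \<in> Q0. q (p k) \<in> ball (c0 $ k) r})"
  let ?c = "\<lambda>q. \<Sum>k\<in>UNIV. axis k (q (p k)) :: complex^'n option"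
  have c: "?c q $ k = q (p k)" for q k by (simp add: axis_def)
  have cE: "?c q \<in> E" if "q \<in> U" for q
  proof (rule near)
    show "cmod (?c q $ k - c0 $ k) < r" for k
      unfolding c using that by (simp add: U_def dist_norm norm_minus_commute)
  qed
  have c0eq: "?c (pi0 z0) = c0" by (simp add: vec_eq_iff c0_def p axis_def)
  show ?thesis
  proof (rule that)
    have "openin Q0_topology (Q0 :: ('d, 'n) qpoint set)"
      by (metis Q0_subset openin_topspace topspace_subtopology_subset)
    then show "openin Q0_topology U" unfolding U_def
      by (intro openin_INT2 openin_holomorphic_preimage holomorphic_on_quotient_invariant p) auto
    show "pi0 z0 \<in> U" using r p z0 by (auto simp: U_def c0_def pi0_in_Q0)
    show "holomorphic_on_quotient U (\<lambda>q. \<mu> (?c q))"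
    proof (rule holomorphic_on_quotient_compose[where E = E])
      show "bounded_linear (axis k :: complex \<Rightarrow> complex^'n option)" for k
        by (intro linear_conv_bounded_linear[THEN iffD1] linearI) (auto simp: vec_eq_iff axis_def)
      fix e assume "e \<in> E"
      then obtain \<mu>' where "(\<mu> has_derivative \<mu>') (at e)" "\<And>a v. \<mu>' (a *s v) = a * \<mu>' v"
        using E(5) by blast
      moreover have "axis k (c * w) = c *s (axis k w :: complex^'n option)" for k c w
        by (simp add: vec_eq_iff axis_def)
      ultimately show "\<exists>\<mu>'. (\<mu> has_derivative \<mu>') (at e) \<and>
          (\<forall>k\<in>UNIV. \<forall>c w. \<mu>' (axis k (c * w)) = c * \<mu>' (axis k w))" by auto
    qed (use E(1) cE holomorphic_on_quotient_invariant p in auto)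
    show "\<mu> (?c (pi0 z0)) = d i" by (simp only: c0eq E(3))
    fix z :: "('d, 'n) mtuple" assume z: "pi0 z \<in> U"
    have cz: "?c (pi0 z) $ k = p k z" for k unfolding c by (rule pi0_apply[OF p])
    have "det (mat (\<mu> (?c (pi0 z))) - X z) = poly (char_poly_mat (X z)) (\<mu> (?c (pi0 z)))"
      by (rule poly_char_poly_mat[symmetric])
    also have "\<dots> = (\<Sum>k\<in>UNIV. poly (l k) (\<mu> (?c (pi0 z))) * ?c (pi0 z) $ k)"
      by (simp only: char poly_sum poly_smult cz mult.commute)
    also have "\<dots> = 0" by (rule bspec[OF E(4) cE[OF z]])
    finally show "det (mat (\<mu> (?c (pi0 z))) - X z) = 0" .
  qed
qed


section \<open>Local sections of the principal bundle\<close>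

text \<open>The product of a list of matrices.\<close>

primrec mat_prod_list :: "'n::finite cmat list \<Rightarrow> 'n cmat" where
  "mat_prod_list [] = mat 1"
| "mat_prod_list (A # As) = A ** mat_prod_list As"

text \<open>The spectral idempotent for the eigenvalue \<open>\<mu> i\<close> of a matrix \<open>A\<close> with distinct eigenvalues \<open>\<mu> j\<close>: the
  product of the matrices \<open>(A - \<mu> j) / (\<mu> i - \<mu> j)\<close> over \<open>j \<noteq> i\<close>. The list \<open>xs\<close> enumerates the indices.\<close>

definition spectral_idempotent :: "'n list \<Rightarrow> ('n \<Rightarrow> complex) \<Rightarrow> 'n::finite cmat \<Rightarrow> 'n \<Rightarrow> 'n cmat" where
  "spectral_idempotent xs \<mu> A i =
     mat_prod_list (map (\<lambda>j. mat_scale (1 / (\<mu> i - \<mu> j)) (A + mat_scale (- \<mu> j) (mat 1))) (filter (\<lambda>j. j \<noteq> i) xs))"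

lemma diag_mat_mult: "diag_mat c ** diag_mat d = diag_mat (\<lambda>i. c i * d i)"
proof -
  have "(\<Sum>k\<in>UNIV. (if i = k then c i else 0) * (if k = j then d k else 0)) = (if i = j then c i * d i else 0)" for i j
    by (simp add: if_distrib[of "\<lambda>x. x * _"] cong: if_cong)
  then show ?thesis by (simp add: vec_eq_iff matrix_mult_nth)
qed

lemma mult_diag_mat_nth: "(A ** diag_mat d) $ i $ j = A $ i $ j * d j"
  by (simp add: matrix_mult_nth if_distrib cong: if_cong)

lemma diag_mat_mult_nth: "(diag_mat d ** A) $ i $ j = d i * A $ i $ j"
  by (simp add: matrix_mult_nth if_distrib[of "\<lambda>x. x * _"] cong: if_cong)

lemma mat_one_diag: "mat 1 = diag_mat (\<lambda>i. 1)"
  by (simp add: vec_eq_iff mat_nth)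

lemma mat_prod_list_diag:
  "(\<And>j. j \<in> set ys \<Longrightarrow> f j = diag_mat (d j)) \<Longrightarrow>
    mat_prod_list (map f ys) = diag_mat (\<lambda>k. \<Prod>j\<leftarrow>ys. d j k)"
  by (induction ys) (auto simp: mat_one_diag diag_mat_mult)

lemma conj_mat_prod_list:
  "invertible g \<Longrightarrow> conj_mat g (mat_prod_list As) = mat_prod_list (map (conj_mat g) As)"
  by (induction As) (auto simp: conj_mat_mult)

lemma spectral_idempotent_conj:
  fixes A :: "'n::finite cmat"
  assumes g: "invertible g" "conj_mat g A = diag_mat \<mu>" and "inj \<mu>" and xs: "distinct xs" "set xs = UNIV"
  shows "conj_mat g (spectral_idempotent xs \<mu> A i) = matrix_unit i i"
proof -
  let ?ys = "filter (\<lambda>j. j \<noteq> i) xs"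
  let ?f = "\<lambda>j. mat_scale (1 / (\<mu> i - \<mu> j)) (A + mat_scale (- \<mu> j) (mat 1))"
  have "conj_mat g (spectral_idempotent xs \<mu> A i) = mat_prod_list (map (\<lambda>j. conj_mat g (?f j)) ?ys)"
    by (simp add: spectral_idempotent_def conj_mat_prod_list[OF g(1)] o_def)
  also have "\<dots> = diag_mat (\<lambda>k. \<Prod>j\<leftarrow>?ys. (\<mu> k - \<mu> j) / (\<mu> i - \<mu> j))"
    by (rule mat_prod_list_diag)
      (simp add: conj_mat_scale conj_mat_add g vec_eq_iff mat_nth)
  also have "\<dots> = matrix_unit i i"
  proof -
    have "(\<Prod>j\<leftarrow>?ys. (\<mu> k - \<mu> j) / (\<mu> i - \<mu> j)) = (if k = i then 1 else 0)" for k
    proof (cases "k = i")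
      case True
      have "(\<Prod>j\<leftarrow>?ys. (\<mu> k - \<mu> j) / (\<mu> i - \<mu> j)) = (\<Prod>j\<leftarrow>?ys. 1)"
        by (intro arg_cong[of _ _ prod_list] map_cong) (use True \<open>inj \<mu>\<close> in \<open>auto simp: inj_eq\<close>)
      also have "\<dots> = 1" by (induction xs) auto
      finally show ?thesis using True by simp
    next
      case False
      then have "k \<in> set ?ys" using xs by simp
      then have "0 \<in> set (map (\<lambda>j. (\<mu> k - \<mu> j) / (\<mu> i - \<mu> j)) ?ys)"
        by (auto intro!: image_eqI[of _ _ k] simp: False)
      then show ?thesis using False by (simp add: prod_list_zero_iff)
    qed
    then show ?thesis by (simp add: vec_eq_iff matrix_unit_nth)
  qed
  finally show ?thesis .
qed

lemma mat_prod_list_eigenvector: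
  "(\<And>j. j \<in> set ys \<Longrightarrow> f j *v u = d j *s u) \<Longrightarrow>
    mat_prod_list (map f ys) *v u = (\<Prod>j\<leftarrow>ys. d j) *s (u :: complex^'n::finite)"
proof (induction ys)
  case (Cons j ys)
  then have "mat_prod_list (map f (j # ys)) *v u = f j *v ((\<Prod>j\<leftarrow>ys. d j) *s u)"
    by (simp flip: matrix_vector_mul_assoc)
  also have "\<dots> = (\<Prod>j\<leftarrow>ys. d j) *s (d j *s u)"
    using Cons.prems by (simp add: matrix_vector_mult_scaleR vec.scale)
  finally show ?case by (simp add: vector_smult_assoc mult.commute)
qed simp

lemma det_zero_eigenvector:
  fixes A :: "'n::finite cmat"
  assumes "det (mat t - A) = 0"
  obtains u where "u \<noteq> 0" "A *v u = t *s u"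
proof -
  have "\<not> invertible (mat t - A)" using assms by (simp add: invertible_det_nz)
  then obtain u where u: "u \<noteq> 0" "(mat t - A) *v u = 0"
    unfolding invertible_left_inverse matrix_left_invertible_ker by blast
  have "mat t *v u = t *s u"
    by (simp add: vec_eq_iff matrix_vector_mult_def mat_nth if_distrib[of "\<lambda>x. x * _"] cong: if_cong)
  then have "A *v u = t *s u" using u(2) by (simp add: matrix_vector_mult_diff_rdistrib)
  then show ?thesis using that u by blast
qed

lemma diagonalizable_distinct_eigenvalues:
  fixes A :: "'n::finite cmat"
  assumes det: "\<And>i. det (mat (\<mu> i) - A) = 0" and "inj \<mu>"
  obtains g where "invertible g" "conj_mat g A = diag_mat \<mu>"
proof -
  have "\<forall>i. \<exists>u. u \<noteq> 0 \<and> A *v u = \<mu> i *s u" using det_zero_eigenvector[OF det] by metis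
  then obtain u where u: "\<And>i. u i \<noteq> 0" "\<And>i. A *v u i = \<mu> i *s u i" by metis
  obtain xs :: "'n list" where xs: "set xs = UNIV" "distinct xs" using finite_distinct_list[of "UNIV :: 'n set"] by auto
  define g where "g = (\<chi> i j. u j $ i)"
  have col: "column j g = u j" for j by (simp add: column_def g_def vec_eq_iff)
  have "invertible g" unfolding invertible_left_inverse matrix_left_invertible_independent_columns
  proof (intro allI impI)
    fix c k assume "(\<Sum>i\<in>UNIV. c i *s column i g) = 0"
    then have 0: "(\<Sum>i\<in>UNIV. c i *s u i) = 0" by (simp add: col)
    let ?ys = "filter (\<lambda>j. j \<noteq> k) xs"
    \<comment> \<open>\<open>?P\<close> annihilates all of the eigenvectors except the one for \<open>\<mu> k\<close>\<close>
    let ?P = "mat_prod_list (map (\<lambda>j. A + mat_scale (- \<mu> j) (mat 1)) ?ys)"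
    have scal: "mat_scale a (mat 1) *v v = a *s v" for a and v :: "complex^'n"
    proof -
      have "(\<Sum>j\<in>UNIV. mat_scale a (mat 1) $ i $ j * v $ j) = (\<Sum>j\<in>UNIV. if j = i then a * v $ i else 0)" for i
        by (intro sum.cong) (auto simp: mat_nth)
      then show ?thesis by (simp add: vec_eq_iff matrix_vector_mult_def del: mat_scale_nth)
    qed
    have P: "?P *v u i = (\<Prod>j\<leftarrow>?ys. \<mu> i - \<mu> j) *s u i" for i
    proof (rule mat_prod_list_eigenvector)
      show "(A + mat_scale (- \<mu> j) (mat 1)) *v u i = (\<mu> i - \<mu> j) *s u i" for j
        by (simp add: matrix_vector_mult_add_rdistrib u scal vec_eq_iff algebra_simps)
    qed
    have P0: "?P *v u i = 0" if "i \<noteq> k" for i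
    proof -
      have "i \<in> set ?ys" using that xs by simp
      then have "0 \<in> set (map (\<lambda>j. \<mu> i - \<mu> j) ?ys)" by (auto intro!: image_eqI[of _ _ i] simp: that)
      then have "(\<Prod>j\<leftarrow>?ys. \<mu> i - \<mu> j) = 0" by (simp add: prod_list_zero_iff)
      then show ?thesis by (simp add: P)
    qed
    have "0 = ?P *v (\<Sum>i\<in>UNIV. c i *s u i)" by (simp add: 0)
    also have "\<dots> = (\<Sum>i\<in>UNIV. ?P *v (c i *s u i))" by (rule vec.linear_sum[OF matrix_vector_mul_linear_gen])
    also have "\<dots> = (\<Sum>i\<in>UNIV. if i = k then c k *s (?P *v u k) else 0)"
      by (intro sum.cong refl) (simp add: P0 vec.scale)
    also have "\<dots> = c k *s (?P *v u k)" by simp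
    finally have "c k *s ((\<Prod>j\<leftarrow>?ys. \<mu> k - \<mu> j) *s u k) = 0" by (simp add: P)
    moreover have "(\<Prod>j\<leftarrow>?ys. \<mu> k - \<mu> j) \<noteq> 0"
      using \<open>inj \<mu>\<close> by (auto simp: prod_list_zero_iff inj_eq)
    ultimately show "c k = 0" using u(1)[of k] by (simp add: vec.scale_eq_0_iff)
  qed
  moreover have "A ** g = g ** diag_mat \<mu>"
  proof -
    have "(A ** g) $ i $ j = (A *v u j) $ i" for i j
      by (simp add: matrix_mult_nth matrix_vector_mult_def g_def)
    then show ?thesis by (simp add: vec_eq_iff mult_diag_mat_nth u(2)) (simp add: g_def mult.commute)
  qed
  then have "conj_mat g A = diag_mat \<mu>"
    using matrix_inv_inverse(2)[OF \<open>invertible g\<close>] unfolding conj_mat_def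
    by (metis matrix_mul_assoc matrix_mul_lid)
  ultimately show ?thesis using that by blast
qed

text \<open>Matrix functions of a tuple \<open>z\<close> that are linear combinations of noncommutative polynomials
  whose coefficients are holomorphic functions of \<open>pi0 z\<close>.\<close>

inductive holo_nc :: "('d::finite, 'n::finite) qpoint set \<Rightarrow> (('d, 'n) mtuple \<Rightarrow> 'n cmat) \<Rightarrow> bool"
  for U :: "('d, 'n) qpoint set" where
  base: "nc_polynomial X \<Longrightarrow> holo_nc U X"
| scale: "holomorphic_on_quotient U h \<Longrightarrow> holo_nc U M \<Longrightarrow> holo_nc U (\<lambda>z. mat_scale (h (pi0 z)) (M z))"
| add: "holo_nc U M \<Longrightarrow> holo_nc U N \<Longrightarrow> holo_nc U (\<lambda>z. M z + N z)"
| lmult: "nc_polynomial X \<Longrightarrow> holo_nc U M \<Longrightarrow> holo_nc U (\<lambda>z. X z ** M z)"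

lemma holo_nc_mult: "holo_nc U M \<Longrightarrow> holo_nc U N \<Longrightarrow> holo_nc U (\<lambda>z. M z ** N z)"
proof (induction rule: holo_nc.induct)
  case (base X)
  then show ?case by (rule holo_nc.lmult)
next
  case (scale h M)
  then show ?case using holo_nc.scale[of U h "\<lambda>z. M z ** N z"] by (simp add: mat_scale_mult_left)
next
  case (add M M')
  then show ?case using holo_nc.add[of U "\<lambda>z. M z ** N z" "\<lambda>z. M' z ** N z"]
    by (simp add: matrix_add_rdistrib)
next
  case (lmult X M)
  then show ?case using holo_nc.lmult[of X U "\<lambda>z. M z ** N z"] by (simp add: matrix_mul_assoc)
qed

lemma trace_mat_scale: "trace (mat_scale c A) = c * trace A"
  by (simp add: trace_def sum_distrib_left)

text \<open>The factor \<open>X\<close> takes up the left factors that occur in the induction.\<close>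

lemma holo_nc_trace_aux:
  "holo_nc U M \<Longrightarrow> nc_polynomial X \<Longrightarrow>
    \<exists>t. holomorphic_on_quotient U t \<and> (\<forall>z. trace (X z ** M z) = t (pi0 z))"
proof (induction arbitrary: X rule: holo_nc.induct)
  case (base Y)
  then have "(\<lambda>z. trace (X z ** Y z)) \<in> invariants" by (intro invariants_trace nc_polynomial.mult)
  then show ?case
    by (intro exI[of _ "\<lambda>q. q (\<lambda>z. trace (X z ** Y z))"]) (simp add: holomorphic_on_quotient_invariant)
next
  case (scale h M)
  then obtain t where "holomorphic_on_quotient U t" "\<forall>z. trace (X z ** M z) = t (pi0 z)" by blast
  then show ?case using scale.hyps
    by (intro exI[of _ "\<lambda>q. h q * t q"])
      (simp add: mat_scale_mult_right trace_mat_scale holomorphic_on_quotient_mult)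
next
  case (add M N)
  then obtain t t' where "holomorphic_on_quotient U t" "\<forall>z. trace (X z ** M z) = t (pi0 z)"
    "holomorphic_on_quotient U t'" "\<forall>z. trace (X z ** N z) = t' (pi0 z)" by blast
  then show ?case
    by (intro exI[of _ "\<lambda>q. t q + t' q"])
      (simp add: matrix_add_ldistrib trace_add holomorphic_on_quotient_add)
next
  case (lmult Y M)
  then show ?case using lmult.IH[of "\<lambda>z. X z ** Y z"] by (simp add: matrix_mul_assoc nc_polynomial.mult)
qed

lemma holo_nc_trace:
  assumes "holo_nc U M"
  obtains t where "holomorphic_on_quotient U t" "\<And>z. trace (M z) = t (pi0 z)"
  using holo_nc_trace_aux[OF assms nc_polynomial.one] by auto

lemma holo_nc_prod_list:
  "(\<And>j. j \<in> set ys \<Longrightarrow> holo_nc U (f j)) \<Longrightarrow> holo_nc U (\<lambda>z. mat_prod_list (map (\<lambda>j. f j z) ys))"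
  by (induction ys) (auto intro: holo_nc.base nc_polynomial.one holo_nc_mult)

lemma holo_nc_spectral_idempotent:
  assumes X: "nc_polynomial X" and \<mu>: "\<And>i. holomorphic_on_quotient U (\<mu> i)"
    and inj: "\<And>q i j. q \<in> U \<Longrightarrow> i \<noteq> j \<Longrightarrow> \<mu> i q \<noteq> \<mu> j q"
  shows "holo_nc U (\<lambda>z. spectral_idempotent xs (\<lambda>i. \<mu> i (pi0 z)) (X z) i)"
  unfolding spectral_idempotent_def
proof (rule holo_nc_prod_list)
  fix j assume "j \<in> set (filter (\<lambda>j. j \<noteq> i) xs)"
  then have "i \<noteq> j" by auto
  have "holomorphic_on_quotient U (\<lambda>q. 1 / (\<mu> i q - \<mu> j q))"
    by (intro holomorphic_on_quotient_divide holomorphic_on_quotient_diff holomorphic_on_quotient_const \<mu>)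
      (use inj \<open>i \<noteq> j\<close> in simp)
  moreover have "holomorphic_on_quotient U (\<lambda>q. - \<mu> j q)"
    using holomorphic_on_quotient_diff[OF holomorphic_on_quotient_const[of U 0] \<mu>] by simp
  ultimately show "holo_nc U (\<lambda>z. mat_scale (1 / (\<mu> i (pi0 z) - \<mu> j (pi0 z)))
      (X z + mat_scale (- \<mu> j (pi0 z)) (mat 1)))"
    using holo_nc.scale[of U "\<lambda>q. 1 / (\<mu> i q - \<mu> j q)" "\<lambda>z. X z + mat_scale (- \<mu> j (pi0 z)) (mat 1)"]
      holo_nc.scale[of U "\<lambda>q. - \<mu> j q" "\<lambda>z. mat 1"]
    by (simp add: holo_nc.add holo_nc.base X nc_polynomial.one)
qed

lemma trace_matrix_unit_mult: "trace (matrix_unit i j ** A) = A $ j $ i"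
proof -
  have "(matrix_unit i j ** A) $ k $ k = (if k = i then A $ j $ k else 0)" for k
  proof -
    have "(matrix_unit i j ** A) $ k $ k = (\<Sum>m\<in>UNIV. if m = j then (if k = i then A $ j $ k else 0) else 0)"
      unfolding matrix_mult_nth by (intro sum.cong) (auto simp: matrix_unit_nth)
    then show ?thesis by simp
  qed
  then show ?thesis by (simp add: trace_def)
qed

lemma matrix_unit_sandwich:
  fixes A :: "'n::finite cmat"
  shows "matrix_unit i i ** A ** matrix_unit j j = mat_scale (A $ i $ j) (matrix_unit i j)"
proof -
  have unit: "matrix_unit k k = diag_mat (\<lambda>l. if l = k then 1 else 0)" for k :: 'n
    by (auto simp: vec_eq_iff matrix_unit_nth)
  have "(matrix_unit i i ** A ** matrix_unit j j) $ k $ l = (if k = i \<and> l = j then A $ i $ j else 0)" for k l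
    unfolding unit mult_diag_mat_nth diag_mat_mult_nth by auto
  then show ?thesis by (simp add: vec_eq_iff matrix_unit_nth)
qed

text \<open>Near \<open>pi0 z0\<close> there is a holomorphic choice of one representative of each orbit. If \<open>X z\<close> has
  distinct eigenvalues and, with respect to an eigenbasis of \<open>X z\<close>, the matrix \<open>C z\<close> has no zero in the
  column \<open>a\<close> and in the row \<open>a\<close>, the eigenbasis can be normalised so that all entries of the column
  \<open>a\<close> of \<open>C z\<close> are equal. The entries of \<open>z\<close> with respect to the normalised basis do not depend on
  choices, and can be expressed by traces.\<close>

lemma exists_local_section:
  fixes z0 :: "('d::finite, 'n::finite) mtuple"
  assumes z0: "z0 \<in> generating_tuples"
  obtains U and S :: "('d, 'n) qpoint \<Rightarrow> ('d, 'n) mtuple"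
  where "openin Q0_topology U" "pi0 z0 \<in> U" "\<And>k i j. holomorphic_on_quotient U (\<lambda>q. S q $ k $ i $ j)"
    "\<And>z. pi0 z \<in> U \<Longrightarrow> \<exists>s. invertible s \<and> S (pi0 z) = conj_tuple s z"
proof -
  obtain d :: "'n \<Rightarrow> complex" where d: "inj d" using finite_inj_complex by blast
  obtain X where X: "nc_polynomial X" "X z0 = diag_mat d" by (rule generating_tuples_nc_polynomial[OF z0])
  obtain C where C: "nc_polynomial C" "C z0 = (\<chi> i j. 1)" by (rule generating_tuples_nc_polynomial[OF z0])
  obtain xs :: "'n list" where xs: "set xs = UNIV" "distinct xs" using finite_distinct_list[of "UNIV :: 'n set"] by auto
  have "\<forall>i. \<exists>U \<mu>. openin Q0_topology U \<and> pi0 z0 \<in> U \<and> holomorphic_on_quotient U \<mu> \<and> \<mu> (pi0 z0) = d i \<and>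
      (\<forall>z. pi0 z \<in> U \<longrightarrow> det (mat (\<mu> (pi0 z)) - X z) = 0)"
    using eigenvalue_local_section[OF X(1) z0 d X(2)] by metis
  then obtain Us \<mu> where U\<mu>: "\<And>i. openin Q0_topology (Us i)" "\<And>i. pi0 z0 \<in> Us i"
    "\<And>i. holomorphic_on_quotient (Us i) (\<mu> i)" "\<And>i. \<mu> i (pi0 z0) = d i"
    "\<And>i z. pi0 z \<in> Us i \<Longrightarrow> det (mat (\<mu> i (pi0 z)) - X z) = 0" by metis
  define U1 where "U1 = (\<Inter>i\<in>UNIV. Us i)"
  have U1: "openin Q0_topology U1" unfolding U1_def using U\<mu>(1) by (intro openin_INT2) auto
  have \<mu>1: "holomorphic_on_quotient U1 (\<mu> i)" for i
    by (rule holomorphic_on_quotient_subset[OF U\<mu>(3)]) (auto simp: U1_def)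
  define U2 where "U2 = (\<Inter>(i, j)\<in>UNIV. {q \<in> U1. i = j \<or> \<mu> i q \<noteq> \<mu> j q})"
  have U2: "openin Q0_topology U2" unfolding U2_def
  proof (intro openin_INT2; clarify?)
    fix i j
    have "openin Q0_topology {q \<in> U1. \<mu> i q - \<mu> j q \<in> - {0}}"
      by (intro openin_holomorphic_preimage holomorphic_on_quotient_diff \<mu>1 U1) auto
    then show "openin Q0_topology {q \<in> U1. i = j \<or> \<mu> i q \<noteq> \<mu> j q}"
      using U1 by (cases "i = j") auto
  qed auto
  have U21: "U2 \<subseteq> U1" by (auto simp: U2_def)
  have \<mu>2: "holomorphic_on_quotient U2 (\<mu> i)" for i
    by (rule holomorphic_on_quotient_subset[OF \<mu>1 U21])
  have inj2: "\<mu> i q \<noteq> \<mu> j q" if "q \<in> U2" "i \<noteq> j" for q i j using that by (auto simp: U2_def)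
  \<comment> \<open>an arbitrary index\<close>
  define a :: 'n where "a = undefined"
  define \<epsilon> where "\<epsilon> = (\<lambda>i z. spectral_idempotent xs (\<lambda>i. \<mu> i (pi0 z)) (X z) i)"
  have \<epsilon>: "holo_nc U2 (\<epsilon> i)" for i
    unfolding \<epsilon>_def by (rule holo_nc_spectral_idempotent[OF X(1) \<mu>2 inj2])
  have "\<forall>i. \<exists>t. holomorphic_on_quotient U2 t \<and> (\<forall>z. trace (\<epsilon> i z ** C z ** \<epsilon> a z ** C z) = t (pi0 z))"
    using holo_nc_trace[OF holo_nc_mult[OF holo_nc_mult[OF holo_nc_mult[OF \<epsilon> holo_nc.base] \<epsilon>] holo_nc.base]] C(1)
    by metis
  then obtain N where N: "\<And>i. holomorphic_on_quotient U2 (N i)"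
    "\<And>i z. trace (\<epsilon> i z ** C z ** \<epsilon> a z ** C z) = N i (pi0 z)" by metis
  have "\<forall>k i j. \<exists>t. holomorphic_on_quotient U2 t \<and>
      (\<forall>z. trace (\<epsilon> i z ** z $ k ** \<epsilon> j z ** C z ** \<epsilon> a z ** C z) = t (pi0 z))"
  proof (intro allI)
    fix k i j
    have "holo_nc U2 (\<lambda>z. \<epsilon> i z ** z $ k ** \<epsilon> j z ** C z ** \<epsilon> a z ** C z)"
      by (intro holo_nc_mult \<epsilon> holo_nc.base C nc_polynomial.gen)
    from holo_nc_trace[OF this]
    show "\<exists>t. holomorphic_on_quotient U2 t \<and>
      (\<forall>z. trace (\<epsilon> i z ** z $ k ** \<epsilon> j z ** C z ** \<epsilon> a z ** C z) = t (pi0 z))" by metis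
  qed
  then obtain T where T: "\<And>k i j. holomorphic_on_quotient U2 (T k i j)"
    "\<And>k i j z. trace (\<epsilon> i z ** z $ k ** \<epsilon> j z ** C z ** \<epsilon> a z ** C z) = T k i j (pi0 z)" by metis
  \<comment> \<open>\<open>T k i j / N i\<close> is the entry of \<open>z $ k\<close> with respect to the normalised eigenbasis\<close>
  have formulas: "N i (pi0 z) = conj_mat g (C z) $ i $ a * conj_mat g (C z) $ a $ i"
      "T k i j (pi0 z) = conj_mat g (z $ k) $ i $ j * conj_mat g (C z) $ j $ a * conj_mat g (C z) $ a $ i"
    if z: "pi0 z \<in> U2" and g: "invertible g" "conj_mat g (X z) = diag_mat (\<lambda>i. \<mu> i (pi0 z))" for z g k i j
  proof -
    have "inj (\<lambda>i. \<mu> i (pi0 z))" using inj2[OF z] by (auto intro: injI)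
    then have eps: "conj_mat g (\<epsilon> i z) = matrix_unit i i" for i
      unfolding \<epsilon>_def using spectral_idempotent_conj g xs by blast
    let ?c = "conj_mat g (C z)"
    have "N i (pi0 z) = trace (conj_mat g (\<epsilon> i z ** C z ** \<epsilon> a z ** C z))"
      by (simp add: trace_conj_mat g N(2))
    also have "\<dots> = ?c $ i $ a * ?c $ a $ i"
      by (simp add: conj_mat_mult g eps matrix_unit_sandwich mat_scale_mult_left trace_mat_scale trace_matrix_unit_mult)
    finally show "N i (pi0 z) = ?c $ i $ a * ?c $ a $ i" .
    have "T k i j (pi0 z) = trace (conj_mat g (\<epsilon> i z ** z $ k ** \<epsilon> j z ** C z ** \<epsilon> a z ** C z))"
      by (simp add: trace_conj_mat g T(2))
    also have "\<dots> = trace ((matrix_unit i i ** conj_mat g (z $ k) ** matrix_unit j j) **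
        (matrix_unit j j ** ?c ** matrix_unit a a) ** ?c)"
    proof -
      have "matrix_unit j j = matrix_unit j j ** matrix_unit j j" by (simp add: matrix_unit_mult)
      then show ?thesis by (simp add: conj_mat_mult g eps) (metis matrix_mul_assoc)
    qed
    also have "\<dots> = conj_mat g (z $ k) $ i $ j * ?c $ j $ a * ?c $ a $ i"
      by (simp only: matrix_unit_sandwich)
        (simp add: mat_scale_mult_left mat_scale_mult_right matrix_unit_mult trace_mat_scale trace_matrix_unit_mult)
    finally show "T k i j (pi0 z) = conj_mat g (z $ k) $ i $ j * ?c $ j $ a * ?c $ a $ i" .
  qed
  define U where "U = (\<Inter>i\<in>UNIV. {q \<in> U2. N i q \<in> - {0}})"
  have UU2: "U \<subseteq> U2" by (auto simp: U_def)
  have NU: "N i q \<noteq> 0" if "q \<in> U" for q i using that by (auto simp: U_def)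
  define S :: "('d, 'n) qpoint \<Rightarrow> ('d, 'n) mtuple" where "S = (\<lambda>q. \<chi> k i j. T k i j q / N i q)"
  show ?thesis
  proof (rule that)
    show "openin Q0_topology U" unfolding U_def
      by (intro openin_INT2 openin_holomorphic_preimage N U2) auto
    have z0U2: "pi0 z0 \<in> U2" using U\<mu>(2,4) d by (auto simp: U2_def U1_def inj_eq)
    have "N i (pi0 z0) = 1" for i
      using formulas(1)[OF z0U2, of "mat 1" i] by (simp add: X U\<mu>(4) C)
    then show "pi0 z0 \<in> U" using z0U2 by (simp add: U_def)
    show "holomorphic_on_quotient U (\<lambda>q. S q $ k $ i $ j)" for k i j
      using NU by (simp add: S_def)
        (intro holomorphic_on_quotient_divide holomorphic_on_quotient_subset[OF _ UU2] T N)
    fix z assume z: "pi0 z \<in> U"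
    then have z2: "pi0 z \<in> U2" using UU2 by auto
    then have "pi0 z \<in> Us i" for i using U21 by (auto simp: U1_def)
    then have "det (mat (\<mu> i (pi0 z)) - X z) = 0" for i by (rule U\<mu>(5))
    moreover have "inj (\<lambda>i. \<mu> i (pi0 z))" using inj2[OF z2] by (auto intro: injI)
    ultimately obtain g where g: "invertible g" "conj_mat g (X z) = diag_mat (\<lambda>i. \<mu> i (pi0 z))"
      using diagonalizable_distinct_eigenvalues[of "\<lambda>i. \<mu> i (pi0 z)"] by metis
    define \<delta> where "\<delta> = (\<lambda>i. conj_mat g (C z) $ i $ a)"
    have nz: "\<delta> i \<noteq> 0" "conj_mat g (C z) $ a $ i \<noteq> 0" for i
      using NU[OF z, of i] formulas(1)[OF z2 g, of i] by (auto simp: \<delta>_def)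
    have inv: "matrix_inv (diag_mat \<delta>) = diag_mat (\<lambda>i. 1 / \<delta> i)"
      by (rule matrix_inv_unique) (simp_all add: diag_mat_mult nz mat_one_diag)
    have invd: "invertible (diag_mat \<delta>)"
      unfolding invertible_def
      by (rule exI[of _ "diag_mat (\<lambda>i. 1 / \<delta> i)"]) (simp add: diag_mat_mult nz mat_one_diag)
    have "S (pi0 z) $ k $ i $ j = conj_mat (g ** diag_mat \<delta>) (z $ k) $ i $ j" for k i j
    proof -
      have "conj_mat (g ** diag_mat \<delta>) (z $ k) $ i $ j = 1 / \<delta> i * conj_mat g (z $ k) $ i $ j * \<delta> j"
        by (simp add: conj_mat_compose[OF g(1) invd, symmetric] conj_mat_def[of "diag_mat \<delta>"] inv
            mult_diag_mat_nth diag_mat_mult_nth)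
      also have "\<dots> = T k i j (pi0 z) / N i (pi0 z)"
        unfolding formulas[OF z2 g] using nz by (simp add: \<delta>_def)
      finally show ?thesis by (simp add: S_def)
    qed
    then have "S (pi0 z) = conj_tuple (g ** diag_mat \<delta>) z" by (simp add: vec_eq_iff)
    then show "\<exists>s. invertible s \<and> S (pi0 z) = conj_tuple s z"
      using invertible_mult[OF g(1) invd] by blast
  qed
qed

text \<open>The invariants separate the orbit of a generating tuple from all other orbits: both tuples are conjugate
  to the value of the same local section.\<close>

lemma pi0_eq_imp_conj:
  assumes "z \<in> generating_tuples" "pi0 w = pi0 z"
  obtains s where "invertible s" "w = conj_tuple s z"
proof -
  obtain U S where S: "pi0 z \<in> U" "\<And>x. pi0 x \<in> U \<Longrightarrow> \<exists>s. invertible s \<and> S (pi0 x) = conj_tuple s x"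
    using exists_local_section[OF assms(1)] by metis
  obtain s where s: "invertible s" "S (pi0 z) = conj_tuple s z" using S by metis
  obtain t where t: "invertible t" "S (pi0 z) = conj_tuple t w" using S(2)[of w] S(1) assms(2) by auto
  have "w = conj_tuple (matrix_inv t) (conj_tuple s z)" using s t by (metis conj_tuple_cancel(1))
  then show ?thesis
    using that s t by (metis conj_tuple_compose invertible_matrix_inv invertible_mult)
qed

lemma exists_local_trivialisation:
  fixes q :: "('d::finite, 'n::finite) qpoint"
  assumes "q \<in> Q0"
  obtains U s where "q \<in> U" "local_trivialisation U s"
proof -
  obtain z0 where z0: "z0 \<in> generating_tuples" "q = pi0 z0" using assms by (auto simp: Q0_def)
  obtain U and S :: "('d, 'n) qpoint \<Rightarrow> ('d, 'n) mtuple" where US: "openin Q0_topology U" "pi0 z0 \<in> U"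
    "\<And>k i j. holomorphic_on_quotient U (\<lambda>q. S q $ k $ i $ j)"
    "\<And>z. pi0 z \<in> U \<Longrightarrow> \<exists>s. invertible s \<and> S (pi0 z) = conj_tuple s z"
    using exists_local_section[OF z0(1)] by metis
  have "S r \<in> generating_tuples \<and> pi0 (S r) = r" if r: "r \<in> U" for r
  proof -
    have "r \<in> Q0" using openin_subset[OF US(1)] r by auto
    then obtain z where "z \<in> generating_tuples" "r = pi0 z" by (auto simp: Q0_def)
    then show ?thesis using US(4)[of z] r generating_tuples_conj by auto
  qed
  then show ?thesis using that[of U S] US z0 by (simp add: local_trivialisation_def)
qed


section \<open>Concomitants and cross sections\<close>

lemma mem_bundle_class:
  "(w, B) \<in> bundle_class z A \<longleftrightarrow> (\<exists>s. invertible s \<and> w = conj_tuple s z \<and> B = conj_mat s A)"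
  unfolding bundle_class_def by auto

lemma self_mem_bundle_class: "(z, A) \<in> bundle_class z A"
  unfolding mem_bundle_class by (rule exI[of _ "mat 1"]) simp

lemma bundle_class_conj:
  assumes s: "invertible s"
  shows "bundle_class (conj_tuple s z) (conj_mat s A) = bundle_class z A"
proof (intro equalityI subsetI; clarify)
  fix w B assume "(w, B) \<in> bundle_class (conj_tuple s z) (conj_mat s A)"
  then obtain t where "invertible t" "w = conj_tuple (s ** t) z" "B = conj_mat (s ** t) A"
    using s by (auto simp: mem_bundle_class conj_tuple_compose conj_mat_compose)
  then show "(w, B) \<in> bundle_class z A" using s invertible_mult mem_bundle_class by blast
next
  fix w B assume "(w, B) \<in> bundle_class z A"
  then obtain t where t: "invertible t" "w = conj_tuple t z" "B = conj_mat t A"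
    by (auto simp: mem_bundle_class)
  have "w = conj_tuple (matrix_inv s ** t) (conj_tuple s z)" "B = conj_mat (matrix_inv s ** t) (conj_mat s A)"
    using s t by (simp_all add: conj_tuple_compose[symmetric] conj_mat_compose[symmetric] invertible_matrix_inv)
  then show "(w, B) \<in> bundle_class (conj_tuple s z) (conj_mat s A)"
    using s t invertible_mult invertible_matrix_inv mem_bundle_class by blast
qed

lemma bundle_class_functional:
  assumes "z \<in> generating_tuples" "(w, B) \<in> bundle_class z A" "w = conj_tuple s z" "invertible s"
  shows "B = conj_mat s A"
  using assms conj_mat_eqI_generating unfolding mem_bundle_class by metis

lemma bundle_class_inj:
  assumes "z \<in> generating_tuples" "bundle_class z A = bundle_class z B"
  shows "A = B"
  using bundle_class_functional[OF assms(1), of z A B "mat 1"] assms(2) self_mem_bundle_class[of z A]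
  by simp

lemma bundle_proj_class:
  assumes "z \<in> generating_tuples"
  shows "bundle_proj (bundle_class z A) = pi0 z"
  unfolding bundle_proj_def
proof (rule the_equality)
  show "\<exists>w B. w \<in> generating_tuples \<and> bundle_class z A = bundle_class w B \<and> pi0 z = pi0 w"
    using assms by blast
  fix q assume "\<exists>w B. w \<in> generating_tuples \<and> bundle_class z A = bundle_class w B \<and> q = pi0 w"
  then obtain w B where "bundle_class z A = bundle_class w B" "q = pi0 w" by blast
  then show "q = pi0 z" using self_mem_bundle_class[of z A] by (auto simp: mem_bundle_class)
qed

text \<open>Fibrewise operations on orbits are given by operations on representatives that commute with
  conjugation.\<close>

lemma bundle_class_binary_op:
  assumes z: "z \<in> generating_tuples"
    and f: "\<And>s A B. invertible s \<Longrightarrow> conj_mat s (f A B) = f (conj_mat s A) (conj_mat s B)"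
  shows "{(w, f A' B') | w A' B'. (w, A') \<in> bundle_class z A \<and> (w, B') \<in> bundle_class z B}
    = bundle_class z (f A B)" (is "?L = _")
proof (intro equalityI subsetI)
  fix x assume "x \<in> ?L"
  then obtain w A' B' where w: "x = (w, f A' B')" "(w, A') \<in> bundle_class z A" "(w, B') \<in> bundle_class z B"
    by auto
  then obtain s where "invertible s" "w = conj_tuple s z" by (auto simp: mem_bundle_class)
  with bundle_class_functional[OF z w(2) this(2,1)] bundle_class_functional[OF z w(3) this(2,1)]
  show "x \<in> bundle_class z (f A B)" using w(1) by (auto simp: mem_bundle_class f)
next
  fix x assume "x \<in> bundle_class z (f A B)"
  then obtain s where "invertible s" "x = (conj_tuple s z, f (conj_mat s A) (conj_mat s B))"
    by (auto simp: bundle_class_def f)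
  then show "x \<in> ?L" using mem_bundle_class by blast
qed

lemma fibre_add_class:
  "z \<in> generating_tuples \<Longrightarrow> fibre_add (bundle_class z A) (bundle_class z B) = bundle_class z (A + B)"
  unfolding fibre_add_def by (rule bundle_class_binary_op) (auto simp: conj_mat_add)

lemma fibre_mult_class:
  "z \<in> generating_tuples \<Longrightarrow> fibre_mult (bundle_class z A) (bundle_class z B) = bundle_class z (A ** B)"
  unfolding fibre_mult_def by (rule bundle_class_binary_op) (auto simp: conj_mat_mult)

lemma fibre_scale_class: "fibre_scale c (bundle_class z A) = bundle_class z (mat_scale c A)"
  unfolding fibre_scale_def bundle_class_def by (auto simp: conj_mat_scale)

lemma orbit_eq:
  assumes "z \<in> generating_tuples"
  shows "w \<in> generating_tuples \<and> pi0 w = pi0 z \<longleftrightarrow> (\<exists>s. invertible s \<and> w = conj_tuple s z)"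
  using pi0_eq_imp_conj[OF assms] generating_tuples_conj[OF assms] pi0_conj by metis

lemma fibre_zero_class: "z \<in> generating_tuples \<Longrightarrow> fibre_zero (pi0 z) = bundle_class z 0"
  unfolding fibre_zero_def bundle_class_def by (auto simp: orbit_eq)

lemma fibre_one_class: "z \<in> generating_tuples \<Longrightarrow> fibre_one (pi0 z) = bundle_class z (mat 1)"
  unfolding fibre_one_def bundle_class_def by (auto simp: orbit_eq)

lemma Q0_cases:
  assumes "q \<in> Q0"
  obtains z where "z \<in> generating_tuples" "q = pi0 z"
  using assms by (auto simp: Q0_def)

lemma section_of_pi0:
  assumes \<phi>: "\<phi> \<in> concomitants generating_tuples" and z: "z \<in> generating_tuples"
  shows "section_of \<phi> (pi0 z) = bundle_class z (\<phi> z)"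
proof -
  have "(THE x. \<exists>w\<in>generating_tuples. pi0 w = pi0 z \<and> x = bundle_class w (\<phi> w)) = bundle_class z (\<phi> z)"
  proof (rule the_equality)
    fix x assume "\<exists>w\<in>generating_tuples. pi0 w = pi0 z \<and> x = bundle_class w (\<phi> w)"
    then obtain w where w: "w \<in> generating_tuples \<and> pi0 w = pi0 z" "x = bundle_class w (\<phi> w)" by blast
    then obtain s where "invertible s" "x = bundle_class (conj_tuple s z) (\<phi> (conj_tuple s z))"
      using orbit_eq[OF z, of w] by blast
    then show "x = bundle_class z (\<phi> z)"
      using \<phi> z by (simp add: concomitants_def bundle_class_conj)
  qed (use z in blast)
  then show ?thesis using z by (simp add: section_of_def pi0_in_Q0)
qed

lemma section_of_cross_section:
  fixes \<phi> :: "('d::finite, 'n::finite) mtuple \<Rightarrow> 'n cmat"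
  assumes \<phi>: "\<phi> \<in> concomitants generating_tuples"
  shows "section_of \<phi> \<in> cross_sections"
  unfolding cross_sections_def
proof (intro CollectI conjI ballI)
  show "section_of \<phi> \<in> extensional Q0" by (simp add: section_of_def)
  fix q :: "('d, 'n) qpoint" assume "q \<in> Q0"
  then obtain z where z: "z \<in> generating_tuples" "q = pi0 z" by (rule Q0_cases)
  then show "section_of \<phi> q \<in> bundle_space" "bundle_proj (section_of \<phi> q) = q"
    by (auto simp: section_of_pi0[OF \<phi>] bundle_space_def bundle_proj_class)
qed

lemma concomitant_of_class:
  assumes \<sigma>: "\<sigma> \<in> cross_sections" and z: "z \<in> generating_tuples"
  shows "\<sigma> (pi0 z) = bundle_class z (concomitant_of \<sigma> z)"
proof -
  have "\<sigma> (pi0 z) \<in> bundle_space" and proj: "bundle_proj (\<sigma> (pi0 z)) = pi0 z"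
    using \<sigma> z by (auto simp: cross_sections_def pi0_in_Q0)
  then obtain w A where w: "w \<in> generating_tuples" "\<sigma> (pi0 z) = bundle_class w A"
    by (auto simp: bundle_space_def)
  then have "pi0 z = pi0 w" using proj by (simp add: bundle_proj_class)
  then obtain s where s: "invertible s" "z = conj_tuple s w" using pi0_eq_imp_conj[OF w(1)] by metis
  have ex: "\<sigma> (pi0 z) = bundle_class z (conj_mat s A)" using w s by (simp add: bundle_class_conj)
  have "concomitant_of \<sigma> z = (THE A. \<sigma> (pi0 z) = bundle_class z A)"
    using z by (simp add: concomitant_of_def)
  also have "\<dots> = conj_mat s A"
    by (rule the_equality) (use ex bundle_class_inj[OF z] in auto)
  finally show ?thesis using ex by simp
qed

lemma concomitant_of_eqI:
  assumes "\<sigma> \<in> cross_sections" "z \<in> generating_tuples" "\<sigma> (pi0 z) = bundle_class z A"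
  shows "concomitant_of \<sigma> z = A"
  using concomitant_of_class[OF assms(1,2)] assms(3) bundle_class_inj[OF assms(2)] by metis

lemma concomitant_of_concomitant:
  fixes \<sigma> :: "('d::finite, 'n::finite) qpoint \<Rightarrow> (('d, 'n) mtuple \<times> 'n cmat) set"
  assumes \<sigma>: "\<sigma> \<in> cross_sections"
  shows "concomitant_of \<sigma> \<in> concomitants generating_tuples"
  unfolding concomitants_def
proof (intro CollectI conjI allI impI)
  show "concomitant_of \<sigma> \<in> extensional generating_tuples" by (simp add: concomitant_of_def)
  fix s :: "'n cmat" and z :: "('d, 'n) mtuple"
  assume s: "invertible s" and z: "z \<in> generating_tuples"
  show "concomitant_of \<sigma> (conj_tuple s z) = conj_mat s (concomitant_of \<sigma> z)"
    by (rule concomitant_of_eqI[OF \<sigma> generating_tuples_conj[OF z s]])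
      (simp add: s bundle_class_conj concomitant_of_class[OF \<sigma> z])
qed

lemma concomitant_of_section_of:
  assumes \<phi>: "\<phi> \<in> concomitants generating_tuples"
  shows "concomitant_of (section_of \<phi>) = \<phi>"
proof (rule extensionalityI)
  show "concomitant_of (section_of \<phi>) \<in> extensional generating_tuples" by (simp add: concomitant_of_def)
  show "\<phi> \<in> extensional generating_tuples" using \<phi> by (simp add: concomitants_def)
  show "concomitant_of (section_of \<phi>) z = \<phi> z" if "z \<in> generating_tuples" for z
    by (rule concomitant_of_eqI[OF section_of_cross_section[OF \<phi>] that section_of_pi0[OF \<phi> that]])
qed

lemma section_of_concomitant_of:
  assumes \<sigma>: "\<sigma> \<in> cross_sections"
  shows "section_of (concomitant_of \<sigma>) = \<sigma>"
proof (rule extensionalityI)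
  show "section_of (concomitant_of \<sigma>) \<in> extensional Q0" by (simp add: section_of_def)
  show "\<sigma> \<in> extensional Q0" using \<sigma> by (simp add: cross_sections_def)
  show "section_of (concomitant_of \<sigma>) q = \<sigma> q" if "q \<in> Q0" for q
    using that
    by (rule Q0_cases)
      (simp add: section_of_pi0[OF concomitant_of_concomitant[OF \<sigma>]] concomitant_of_class[OF \<sigma>])
qed

lemma section_of_holomorphic:
  fixes \<phi> :: "('d::finite, 'n::finite) mtuple \<Rightarrow> 'n cmat"
  assumes \<phi>: "\<phi> \<in> hol_concomitants generating_tuples"
  shows "section_of \<phi> \<in> hol_sections"
proof -
  have con: "\<phi> \<in> concomitants generating_tuples" and hol: "holomorphic_fun generating_tuples (\<lambda>z. \<phi> z $ i $ j)" for i j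
    using \<phi> by (auto simp: hol_concomitants_def holomorphic_mat_def)
  show ?thesis unfolding hol_sections_def
  proof (intro CollectI conjI ballI section_of_cross_section con)
    fix q0 :: "('d, 'n) qpoint" assume "q0 \<in> Q0"
    then obtain U and s :: "('d, 'n) qpoint \<Rightarrow> ('d, 'n) mtuple" where U: "q0 \<in> U" "local_trivialisation U s"
      using exists_local_trivialisation by blast
    then have s: "\<And>q. q \<in> U \<Longrightarrow> s q \<in> generating_tuples" "\<And>q. q \<in> U \<Longrightarrow> pi0 (s q) = q"
      "\<And>k i j. holomorphic_on_quotient U (\<lambda>q. s q $ k $ i $ j)" by (auto simp: local_trivialisation_def)
    show "\<exists>U s a. q0 \<in> U \<and> local_trivialisation U s \<and>
        (\<forall>i j. holomorphic_on_quotient U (\<lambda>q. a q $ i $ j)) \<and> (\<forall>q\<in>U. section_of \<phi> q = bundle_class (s q) (a q))"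
    proof (intro exI[of _ U] exI[of _ s] exI[of _ "\<lambda>q. \<phi> (s q)"] conjI allI ballI U)
      show "holomorphic_on_quotient U (\<lambda>q. \<phi> (s q) $ i $ j)" for i j
        by (rule holomorphic_on_quotient_compose_tuple[OF hol open_generating_tuples s(1,3)])
      show "section_of \<phi> q = bundle_class (s q) (\<phi> (s q))" if "q \<in> U" for q
        using section_of_pi0[OF con s(1)[OF that]] s(2)[OF that] by simp
    qed
  qed
qed

lemma holo_at_polynomial_compose:
  assumes "polynomial_fun f" "\<And>k i j. holo_at (\<lambda>z. S z $ k $ i $ j) z"
  shows "holo_at (\<lambda>z. f (S z)) z"
  using assms by (induction rule: polynomial_fun.induct) (auto intro: holo_at_const holo_at_add holo_at_mult)

lemma det_value_matrix_iff:
  "det (value_matrix X z) \<noteq> 0 \<longleftrightarrow> (\<forall>c. (\<Sum>p\<in>UNIV. mat_scale (c p) (X p z)) = 0 \<longrightarrow> (\<forall>p. c p = 0))"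
proof -
  have "(\<Sum>p\<in>UNIV. c p *s row p (value_matrix X z)) = 0 \<longleftrightarrow> (\<Sum>p\<in>UNIV. mat_scale (c p) (X p z)) = 0" for c
    by (auto simp: vec_eq_iff row_def value_matrix_def)
  then show ?thesis
    unfolding invertible_det_nz[symmetric] invertible_right_inverse matrix_right_invertible_independent_rows
    by simp
qed

lemma det_value_matrix_conj:
  assumes "\<And>p. nc_polynomial (X p)" "invertible s" "det (value_matrix X z) \<noteq> 0"
  shows "det (value_matrix X (conj_tuple s z)) \<noteq> 0"
  unfolding det_value_matrix_iff
proof (intro allI impI)
  fix c p assume "(\<Sum>p\<in>UNIV. mat_scale (c p) (X p (conj_tuple s z))) = 0"
  then have "conj_mat s (\<Sum>p\<in>UNIV. mat_scale (c p) (X p z)) = 0"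
    by (simp add: nc_polynomial_conj assms conj_mat_def matrix_mult_sum_left matrix_mult_sum_right
        mat_scale_mult_left mat_scale_mult_right)
  then have "(\<Sum>p\<in>UNIV. mat_scale (c p) (X p z)) = 0"
    by (metis assms(2) conj_mat_cancel(1) conj_mat_zero)
  then show "c p = 0" using assms(3) unfolding det_value_matrix_iff by blast
qed

lemma conj_mat_sum: "conj_mat s (\<Sum>p\<in>S. f p) = (\<Sum>p\<in>S. conj_mat s (f p))"
  by (simp add: conj_mat_def matrix_mult_sum_left matrix_mult_sum_right)

text \<open>With respect to a basis of noncommutative polynomials, a concomitant has the same coordinates at
  all points of an orbit. So it is holomorphic if its values on a local section are.\<close>

lemma concomitant_of_holomorphic:
  fixes \<sigma> :: "('d::finite, 'n::finite) qpoint \<Rightarrow> (('d, 'n) mtuple \<times> 'n cmat) set"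
  assumes \<sigma>: "\<sigma> \<in> hol_sections"
  shows "concomitant_of \<sigma> \<in> hol_concomitants generating_tuples"
proof -
  have cs: "\<sigma> \<in> cross_sections" using \<sigma> by (simp add: hol_sections_def)
  have "holo_at (\<lambda>z. concomitant_of \<sigma> z $ i $ j) z1" if z1: "z1 \<in> generating_tuples" for i j z1
  proof -
    obtain U s a where U: "pi0 z1 \<in> U" "local_trivialisation U s"
      and a: "\<And>i j. holomorphic_on_quotient U (\<lambda>q. a q $ i $ j)"
      and \<sigma>eq: "\<And>q. q \<in> U \<Longrightarrow> \<sigma> q = bundle_class (s q) (a q)"
      using bspec[OF conjunct2[OF CollectD[OF \<sigma>[unfolded hol_sections_def]]] pi0_in_Q0[OF z1]] by blast
    have op: "openin Q0_topology U" and s: "\<And>q. q \<in> U \<Longrightarrow> s q \<in> generating_tuples"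
      "\<And>q. q \<in> U \<Longrightarrow> pi0 (s q) = q" "\<And>k i j. holomorphic_on_quotient U (\<lambda>q. s q $ k $ i $ j)"
      using U by (auto simp: local_trivialisation_def)
    from exists_value_matrix[OF z1] obtain X :: "'n \<times> 'n \<Rightarrow> ('d, 'n) mtuple \<Rightarrow> 'n cmat"
      where X: "\<forall>p. nc_polynomial (X p)" "det (value_matrix X z1) \<noteq> 0" .
    have Xp: "nc_polynomial (X p)" for p using X(1) by blast
    define \<alpha> where "\<alpha> = (\<lambda>z p. value_coord X (s (pi0 z)) (a (pi0 z)) p)"
    define O1 where "O1 = {z \<in> generating_tuples. pi0 z \<in> U} \<inter> {z. det (value_matrix X z) \<noteq> 0}"
    have O1: "open O1" unfolding O1_def
    proof (intro open_Int open_pi0_preimage op open_Collect_neq)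
      show "continuous_on UNIV (\<lambda>z. det (value_matrix X z))"
        by (rule polynomial_fun_continuous[OF polynomial_fun_det_value_matrix]) (use X in auto)
    qed auto
    have z1O: "z1 \<in> O1" using z1 U X by (simp add: O1_def)
    have nz: "det (value_matrix X (s (pi0 z))) \<noteq> 0"
      and eq: "concomitant_of \<sigma> z = (\<Sum>p\<in>UNIV. mat_scale (\<alpha> z p) (X p z))" if z: "z \<in> O1" for z
    proof -
      have zV: "z \<in> generating_tuples" and zU: "pi0 z \<in> U" and zX: "det (value_matrix X z) \<noteq> 0"
        using z by (auto simp: O1_def)
      obtain h where h: "invertible h" "s (pi0 z) = conj_tuple h z"
        using pi0_eq_imp_conj[OF zV s(2)[OF zU]] by metis
      show nz: "det (value_matrix X (s (pi0 z))) \<noteq> 0"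
        unfolding h(2) using det_value_matrix_conj h(1) zX X(1) by blast
      have "\<sigma> (pi0 z) = bundle_class (conj_tuple h z) (conj_mat h (conj_mat (matrix_inv h) (a (pi0 z))))"
        using \<sigma>eq[OF zU] h by simp
      then have "\<sigma> (pi0 z) = bundle_class z (conj_mat (matrix_inv h) (a (pi0 z)))"
        by (simp only: bundle_class_conj[OF h(1)])
      then have "concomitant_of \<sigma> z = conj_mat (matrix_inv h) (a (pi0 z))"
        by (rule concomitant_of_eqI[OF cs zV])
      also have "a (pi0 z) = (\<Sum>p\<in>UNIV. mat_scale (\<alpha> z p) (X p (s (pi0 z))))"
        unfolding \<alpha>_def by (rule value_coord[OF nz])
      also have "conj_mat (matrix_inv h) \<dots> = (\<Sum>p\<in>UNIV. mat_scale (\<alpha> z p) (X p z))"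
        by (simp only: conj_mat_sum h(2) conj_mat_scale nc_polynomial_conj[OF Xp h(1)] conj_mat_cancel[OF h(1)])
      finally show "concomitant_of \<sigma> z = (\<Sum>p\<in>UNIV. mat_scale (\<alpha> z p) (X p z))" .
    qed
    have hs: "holo_at (\<lambda>z. s (pi0 z) $ k $ i $ j) z1" for k i j
      by (rule holo_at_pi0[OF s(3) op z1 U(1)])
    have ha: "holo_at (\<lambda>z. a (pi0 z) $ i $ j) z1" for i j
      by (rule holo_at_pi0[OF a op z1 U(1)])
    have hX: "holo_at (\<lambda>z. X p (s (pi0 z)) $ i $ j) z1" for p i j
      by (rule holo_at_polynomial_compose[OF nc_polynomial_entry[OF Xp] hs])
    have "holo_at (\<lambda>z. \<alpha> z p) z1" for p unfolding \<alpha>_def value_coord_def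
    proof (intro holo_at_divide holo_at_det)
      show "holo_at (\<lambda>z. (\<chi> i j. if j = p then a (pi0 z) $ fst i $ snd i else X j (s (pi0 z)) $ fst i $ snd i) $ i $ j) z1" for i j
        by (cases "j = p") (simp_all add: ha hX)
      show "holo_at (\<lambda>z. value_matrix X (s (pi0 z)) $ i $ j) z1" for i j
        by (simp add: value_matrix_def hX)
    qed (use nz z1O in auto)
    then have "holo_at (\<lambda>z. \<Sum>p\<in>UNIV. \<alpha> z p * X p z $ i $ j) z1"
      by (intro holo_at_sum holo_at_mult holo_at_polynomial[OF nc_polynomial_entry[OF Xp]])
    then show ?thesis by (rule holo_at_cong[OF _ O1 z1O]) (simp add: eq)
  qed
  then show ?thesis
    by (simp add: hol_concomitants_def concomitant_of_concomitant[OF cs] holomorphic_mat_def holomorphic_fun_iff)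
qed

lemma bij_betw_section_of:
  "bij_betw section_of (hol_concomitants generating_tuples)
    (hol_sections :: (('d::finite, 'n::finite) qpoint \<Rightarrow> (('d, 'n) mtuple \<times> 'n cmat) set) set)"
proof (rule bij_betwI[where g = concomitant_of])
  show "section_of \<in> hol_concomitants generating_tuples \<rightarrow> hol_sections"
    using section_of_holomorphic by blast
  show "concomitant_of \<in> hol_sections \<rightarrow> hol_concomitants generating_tuples"
    using concomitant_of_holomorphic by blast
qed (auto simp: hol_concomitants_def hol_sections_def concomitant_of_section_of section_of_concomitant_of)


section \<open>The algebras\<close>

lemma cring_complex_ring: "cring complex_ring"
proof (rule cringI)
  show "abelian_group complex_ring"
  proof (rule abelian_groupI)
    show "\<exists>y\<in>carrier complex_ring. y \<oplus>\<^bsub>complex_ring\<^esub> x = \<zero>\<^bsub>complex_ring\<^esub>" for x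
      by (rule bexI[of _ "- x"]) (auto simp: complex_ring_def)
  qed (auto simp: complex_ring_def)
  show "comm_monoid complex_ring"
    by (rule comm_monoidI) (auto simp: complex_ring_def)
qed (auto simp: complex_ring_def algebra_simps)

lemma hol_concomitantsI:
  assumes "f \<in> extensional D" "\<And>s z. invertible s \<Longrightarrow> z \<in> D \<Longrightarrow> f (conj_tuple s z) = conj_mat s (f z)"
    "\<And>i j z. z \<in> D \<Longrightarrow> holo_at (\<lambda>z. f z $ i $ j) z"
  shows "f \<in> hol_concomitants D"
  using assms by (simp add: hol_concomitants_def concomitants_def holomorphic_mat_def holomorphic_fun_iff)

lemma hol_concomitantsD:
  assumes "f \<in> hol_concomitants D"
  shows "f \<in> extensional D" "\<And>s z. invertible s \<Longrightarrow> z \<in> D \<Longrightarrow> f (conj_tuple s z) = conj_mat s (f z)"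
    "\<And>i j z. z \<in> D \<Longrightarrow> holo_at (\<lambda>z. f z $ i $ j) z"
  using assms by (simp_all add: hol_concomitants_def concomitants_def holomorphic_mat_def holomorphic_fun_iff)

lemma hol_concomitant_restrictI:
  assumes "open D" "\<And>s z. invertible s \<Longrightarrow> z \<in> D \<Longrightarrow> conj_tuple s z \<in> D"
    "\<And>s z. invertible s \<Longrightarrow> z \<in> D \<Longrightarrow> f (conj_tuple s z) = conj_mat s (f z)"
    "\<And>i j z. z \<in> D \<Longrightarrow> holo_at (\<lambda>z. f z $ i $ j) z"
  shows "(\<lambda>z\<in>D. f z) \<in> hol_concomitants D"
proof (rule hol_concomitantsI)
  show "holo_at (\<lambda>z. (\<lambda>z\<in>D. f z) z $ i $ j) z" if "z \<in> D" for i j z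
    by (rule holo_at_cong[OF assms(4)[OF that] assms(1) that]) simp
qed (use assms in auto)

lemma complex_algebra_hol_concomitants:
  fixes D :: "('d::finite, 'n::finite) mtuple set"
  assumes D: "open D" "\<And>s z. invertible s \<Longrightarrow> z \<in> D \<Longrightarrow> conj_tuple s z \<in> D"
  shows "complex_algebra (hol_concomitant_algebra D)"
proof -
  let ?A = "hol_concomitant_algebra D" and ?H = "hol_concomitants D"
  define P where "P = (\<lambda>(f :: ('d, 'n) mtuple \<Rightarrow> 'n cmat) (g :: ('d, 'n) mtuple \<Rightarrow> 'n cmat). \<lambda>z\<in>D. f z + g z)"
  define M where "M = (\<lambda>(f :: ('d, 'n) mtuple \<Rightarrow> 'n cmat) (g :: ('d, 'n) mtuple \<Rightarrow> 'n cmat). \<lambda>z\<in>D. f z ** g z)"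
  define S where "S = (\<lambda>c (f :: ('d, 'n) mtuple \<Rightarrow> 'n cmat). \<lambda>z\<in>D. mat_scale c (f z))"
  define Z where "Z = (\<lambda>z :: ('d, 'n) mtuple \<in> D. 0 :: 'n cmat)"
  define I where "I = (\<lambda>z :: ('d, 'n) mtuple \<in> D. mat 1 :: 'n cmat)"
  have A: "?A = \<lparr>carrier = ?H, monoid.mult = M, one = I, zero = Z, add = P, smult = S\<rparr>"
    by (simp add: hol_concomitant_algebra_def P_def M_def S_def Z_def I_def)
  have app: "P f g z = f z + g z" "M f g z = f z ** g z" "S c f z = mat_scale c (f z)" "Z z = 0" "I z = mat 1"
    if "z \<in> D" for f g c z
    using that by (simp_all add: P_def M_def S_def Z_def I_def)
  have ext: "f = g" if "f \<in> ?H" "g \<in> ?H" "\<And>z. z \<in> D \<Longrightarrow> f z = g z" for f g :: "('d, 'n) mtuple \<Rightarrow> 'n cmat"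
    using that extensionalityI[OF hol_concomitantsD(1) hol_concomitantsD(1)] by blast
  have "P f g \<in> ?H" "M f g \<in> ?H" if "f \<in> ?H" "g \<in> ?H" for f g
    unfolding P_def M_def using hol_concomitantsD[OF that(1)] hol_concomitantsD[OF that(2)]
    by (intro hol_concomitant_restrictI D;
        auto simp: conj_mat_add conj_mat_mult matrix_mult_nth intro!: holo_at_add holo_at_sum holo_at_mult)+
  moreover have "S c f \<in> ?H" if "f \<in> ?H" for f c
    unfolding S_def using hol_concomitantsD[OF that]
    by (intro hol_concomitant_restrictI D) (auto simp: conj_mat_scale intro!: holo_at_const holo_at_mult)
  moreover have "Z \<in> ?H" "I \<in> ?H"
    unfolding Z_def I_def by (intro hol_concomitant_restrictI D; auto intro: holo_at_const)+
  ultimately have closed: "\<And>f g. f \<in> ?H \<Longrightarrow> g \<in> ?H \<Longrightarrow> P f g \<in> ?H" "\<And>f g. f \<in> ?H \<Longrightarrow> g \<in> ?H \<Longrightarrow> M f g \<in> ?H"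
      "\<And>c f. f \<in> ?H \<Longrightarrow> S c f \<in> ?H" "Z \<in> ?H" "I \<in> ?H" by blast+
  have ag: "abelian_group ?A"
  proof (rule abelian_groupI)
    fix f assume "f \<in> carrier ?A"
    then have f: "f \<in> ?H" by (simp add: A)
    have "P (S (- 1) f) f = Z"
      by (intro ext closed f) (simp add: app vec_eq_iff)
    then show "\<exists>g\<in>carrier ?A. g \<oplus>\<^bsub>?A\<^esub> f = \<zero>\<^bsub>?A\<^esub>"
      using closed(3)[OF f] by (auto simp: A)
  qed (auto intro!: ext closed simp: A app add.assoc add.commute)
  have ring: "Ring.ring ?A"
  proof (rule ringI[OF ag])
    show "monoid ?A"
      by (rule monoidI) (auto intro!: ext closed simp: A app matrix_mul_assoc)
  qed (auto intro!: ext closed simp: A app matrix_add_ldistrib matrix_add_rdistrib)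
  have "Module.module complex_ring ?A"
    by (rule moduleI[OF cring_complex_ring ag])
      (auto intro!: ext closed simp: A app complex_ring_def mat_scale_add mat_scale_add_left)
  moreover have "(c \<odot>\<^bsub>?A\<^esub> f) \<otimes>\<^bsub>?A\<^esub> g = c \<odot>\<^bsub>?A\<^esub> (f \<otimes>\<^bsub>?A\<^esub> g) \<and> f \<otimes>\<^bsub>?A\<^esub> (c \<odot>\<^bsub>?A\<^esub> g) = c \<odot>\<^bsub>?A\<^esub> (f \<otimes>\<^bsub>?A\<^esub> g)"
    if "f \<in> carrier ?A" "g \<in> carrier ?A" for c f g
    using that by (auto intro!: ext closed simp: A app mat_scale_mult_left mat_scale_mult_right)
  ultimately show ?thesis using ring unfolding complex_algebra_def by blast
qed

text \<open>The image of an algebra under a map that is compatible with the operations is an algebra.\<close>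

lemma complex_algebra_image:
  fixes A :: "(complex, 'a) module" and B :: "(complex, 'b) module"
  assumes A: "complex_algebra A" and h: "h ` carrier A = carrier B"
    and mult: "\<And>x y. x \<in> carrier A \<Longrightarrow> y \<in> carrier A \<Longrightarrow> h (x \<otimes>\<^bsub>A\<^esub> y) = h x \<otimes>\<^bsub>B\<^esub> h y"
    and add: "\<And>x y. x \<in> carrier A \<Longrightarrow> y \<in> carrier A \<Longrightarrow> h (x \<oplus>\<^bsub>A\<^esub> y) = h x \<oplus>\<^bsub>B\<^esub> h y"
    and smult: "\<And>c x. x \<in> carrier A \<Longrightarrow> h (c \<odot>\<^bsub>A\<^esub> x) = c \<odot>\<^bsub>B\<^esub> h x"
    and one: "h \<one>\<^bsub>A\<^esub> = \<one>\<^bsub>B\<^esub>" and zero: "h \<zero>\<^bsub>A\<^esub> = \<zero>\<^bsub>B\<^esub>"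
  shows "complex_algebra B"
proof -
  interpret A: Ring.ring A using A by (simp add: complex_algebra_def)
  interpret M: Module.module complex_ring A using A by (simp add: complex_algebra_def)
  have cA: "c \<in> carrier complex_ring" for c by (simp add: complex_ring_def)
  have ops: "c \<oplus>\<^bsub>complex_ring\<^esub> d = c + d" "c \<otimes>\<^bsub>complex_ring\<^esub> d = c * d" "\<one>\<^bsub>complex_ring\<^esub> = 1" for c d
    by (simp_all add: complex_ring_def)
  have sc: "c \<odot>\<^bsub>A\<^esub> x \<in> carrier A" if "x \<in> carrier A" for c x using M.smult_closed[OF cA that] .
  have img: "\<exists>x'\<in>carrier A. x = h x'" if "x \<in> carrier B" for x using that h by blast
  have hc: "h x \<in> carrier B" if "x \<in> carrier A" for x using that h by blast
  have "h \<in> ring_hom A B"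
    unfolding ring_hom_def using hc mult add one by auto
  from A.ring_hom_imp_img_ring[OF this] have ring: "Ring.ring B" by (simp add: h zero)
  then have ag: "abelian_group B" by (rule ring.is_abelian_group)
  have "Module.module complex_ring B"
  proof (rule moduleI[OF cring_complex_ring ag])
    fix c d x assume "x \<in> carrier B"
    then obtain x' where x': "x' \<in> carrier A" "x = h x'" using img by blast
    show "c \<odot>\<^bsub>B\<^esub> x \<in> carrier B" using smult[OF x'(1)] hc[OF sc[OF x'(1)]] x' by metis
    show "(c \<oplus>\<^bsub>complex_ring\<^esub> d) \<odot>\<^bsub>B\<^esub> x = c \<odot>\<^bsub>B\<^esub> x \<oplus>\<^bsub>B\<^esub> d \<odot>\<^bsub>B\<^esub> x"
      using M.smult_l_distr[OF cA cA x'(1), of c d] smult[OF x'(1)] add[OF sc sc, OF x'(1) x'(1)] x' by metis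
    show "c \<otimes>\<^bsub>complex_ring\<^esub> d \<odot>\<^bsub>B\<^esub> x = c \<odot>\<^bsub>B\<^esub> (d \<odot>\<^bsub>B\<^esub> x)"
      using M.smult_assoc1[OF cA cA x'(1), of c d] smult[OF x'(1)] smult[OF sc[OF x'(1)]] x' by metis
    show "\<one>\<^bsub>complex_ring\<^esub> \<odot>\<^bsub>B\<^esub> x = x"
      using M.smult_one[OF x'(1)] smult[OF x'(1)] x' by metis
    fix y assume "y \<in> carrier B"
    then obtain y' where y': "y' \<in> carrier A" "y = h y'" using img by blast
    show "c \<odot>\<^bsub>B\<^esub> (x \<oplus>\<^bsub>B\<^esub> y) = c \<odot>\<^bsub>B\<^esub> x \<oplus>\<^bsub>B\<^esub> c \<odot>\<^bsub>B\<^esub> y"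
      using M.smult_r_distr[OF cA x'(1) y'(1), of c] smult add sc x' y' A.a_closed by metis
  qed
  moreover have "(c \<odot>\<^bsub>B\<^esub> x) \<otimes>\<^bsub>B\<^esub> y = c \<odot>\<^bsub>B\<^esub> (x \<otimes>\<^bsub>B\<^esub> y) \<and> x \<otimes>\<^bsub>B\<^esub> (c \<odot>\<^bsub>B\<^esub> y) = c \<odot>\<^bsub>B\<^esub> (x \<otimes>\<^bsub>B\<^esub> y)"
    if xy: "x \<in> carrier B" "y \<in> carrier B" for c x y
  proof -
    obtain x' where x': "x' \<in> carrier A" "x = h x'" using xy img by blast
    obtain y' where y': "y' \<in> carrier A" "y = h y'" using xy img by blast
    have "(c \<odot>\<^bsub>A\<^esub> x') \<otimes>\<^bsub>A\<^esub> y' = c \<odot>\<^bsub>A\<^esub> (x' \<otimes>\<^bsub>A\<^esub> y')" "x' \<otimes>\<^bsub>A\<^esub> (c \<odot>\<^bsub>A\<^esub> y') = c \<odot>\<^bsub>A\<^esub> (x' \<otimes>\<^bsub>A\<^esub> y')"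
      using A x' y' by (auto simp: complex_algebra_def)
    then show ?thesis
      using mult[OF sc[OF x'(1)] y'(1)] mult[OF x'(1) sc[OF y'(1)]] mult[OF x'(1) y'(1)]
        smult[OF x'(1)] smult[OF y'(1)] smult[OF A.m_closed[OF x'(1) y'(1)]] x' y' by metis
  qed
  ultimately show ?thesis using ring unfolding complex_algebra_def by blast
qed

lemma section_of_operations:
  fixes \<phi> \<psi> :: "('d::finite, 'n::finite) mtuple \<Rightarrow> 'n cmat"
  defines "A \<equiv> hol_concomitant_algebra (generating_tuples :: ('d, 'n) mtuple set)"
  defines "B \<equiv> hol_section_algebra :: (complex, ('d, 'n) qpoint \<Rightarrow> (('d, 'n) mtuple \<times> 'n cmat) set) module"
  assumes \<phi>: "\<phi> \<in> carrier A" and \<psi>: "\<psi> \<in> carrier A"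
  shows "section_of (\<phi> \<otimes>\<^bsub>A\<^esub> \<psi>) = section_of \<phi> \<otimes>\<^bsub>B\<^esub> section_of \<psi>"
    and "section_of (\<phi> \<oplus>\<^bsub>A\<^esub> \<psi>) = section_of \<phi> \<oplus>\<^bsub>B\<^esub> section_of \<psi>"
    and "section_of (c \<odot>\<^bsub>A\<^esub> \<phi>) = c \<odot>\<^bsub>B\<^esub> section_of \<phi>"
    and "section_of \<one>\<^bsub>A\<^esub> = \<one>\<^bsub>B\<^esub>" and "section_of \<zero>\<^bsub>A\<^esub> = \<zero>\<^bsub>B\<^esub>"
proof -
  have alg: "complex_algebra A"
    unfolding A_def by (intro complex_algebra_hol_concomitants open_generating_tuples generating_tuples_conj)
  interpret A: Ring.ring A using alg by (simp add: complex_algebra_def)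
  interpret M: Module.module complex_ring A using alg by (simp add: complex_algebra_def)
  have con: "f \<in> concomitants generating_tuples" if "f \<in> carrier A" for f
    using that by (simp add: A_def hol_concomitant_algebra_def hol_concomitants_def)
  have eqI: "section_of f = (\<lambda>q\<in>Q0. g q)"
    if f: "f \<in> carrier A" and g: "\<And>z. z \<in> generating_tuples \<Longrightarrow> bundle_class z (f z) = g (pi0 z)"
    for f and g :: "('d, 'n) qpoint \<Rightarrow> (('d, 'n) mtuple \<times> 'n cmat) set"
  proof (rule extensionalityI[of _ Q0])
    show "section_of f \<in> extensional Q0" by (simp add: section_of_def)
    show "section_of f q = (\<lambda>q\<in>Q0. g q) q" if "q \<in> Q0" for q
      using that
      by (rule Q0_cases) (simp add: section_of_pi0[OF con[OF f]] g pi0_in_Q0)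
  qed simp
  note op = A_def B_def hol_concomitant_algebra_def hol_section_algebra_def
  have sc: "c \<odot>\<^bsub>A\<^esub> \<phi> \<in> carrier A" by (rule M.smult_closed[OF _ \<phi>]) (simp add: complex_ring_def)
  have c: "\<phi> \<in> concomitants generating_tuples" "\<psi> \<in> concomitants generating_tuples"
    using con \<phi> \<psi> by blast+
  have "section_of (\<phi> \<otimes>\<^bsub>A\<^esub> \<psi>) = (\<lambda>q\<in>Q0. fibre_mult (section_of \<phi> q) (section_of \<psi> q))"
    by (rule eqI[OF A.m_closed[OF \<phi> \<psi>]]) (simp add: op section_of_pi0 c fibre_mult_class)
  then show "section_of (\<phi> \<otimes>\<^bsub>A\<^esub> \<psi>) = section_of \<phi> \<otimes>\<^bsub>B\<^esub> section_of \<psi>"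
    by (simp add: B_def hol_section_algebra_def)
  have "section_of (\<phi> \<oplus>\<^bsub>A\<^esub> \<psi>) = (\<lambda>q\<in>Q0. fibre_add (section_of \<phi> q) (section_of \<psi> q))"
    by (rule eqI[OF A.a_closed[OF \<phi> \<psi>]]) (simp add: op section_of_pi0 c fibre_add_class)
  then show "section_of (\<phi> \<oplus>\<^bsub>A\<^esub> \<psi>) = section_of \<phi> \<oplus>\<^bsub>B\<^esub> section_of \<psi>"
    by (simp add: B_def hol_section_algebra_def)
  have "section_of (c \<odot>\<^bsub>A\<^esub> \<phi>) = (\<lambda>q\<in>Q0. fibre_scale c (section_of \<phi> q))"
    by (rule eqI[OF sc]) (simp add: op section_of_pi0 c fibre_scale_class)
  then show "section_of (c \<odot>\<^bsub>A\<^esub> \<phi>) = c \<odot>\<^bsub>B\<^esub> section_of \<phi>"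
    by (simp add: B_def hol_section_algebra_def)
  have "section_of \<one>\<^bsub>A\<^esub> = (\<lambda>q\<in>Q0. fibre_one q)"
    by (rule eqI[OF A.one_closed]) (simp add: op fibre_one_class)
  then show "section_of \<one>\<^bsub>A\<^esub> = \<one>\<^bsub>B\<^esub>" by (simp add: B_def hol_section_algebra_def)
  have "section_of \<zero>\<^bsub>A\<^esub> = (\<lambda>q\<in>Q0. fibre_zero q)"
    by (rule eqI[OF A.zero_closed]) (simp add: op fibre_zero_class)
  then show "section_of \<zero>\<^bsub>A\<^esub> = \<zero>\<^bsub>B\<^esub>" by (simp add: B_def hol_section_algebra_def)
qed

lemma section_of_algebra_iso:
  fixes V :: "('d::finite, 'n::finite) mtuple set"
  assumes V: "V = generating_tuples"
  shows "complex_algebra (hol_concomitant_algebra V)"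
    and "complex_algebra (hol_section_algebra ::
      (complex, ('d, 'n) qpoint \<Rightarrow> (('d, 'n) mtuple \<times> 'n cmat) set) module)"
    and "section_of \<in> complex_algebra_iso (hol_concomitant_algebra V) hol_section_algebra"
proof -
  let ?A = "hol_concomitant_algebra (generating_tuples :: ('d, 'n) mtuple set)"
  let ?B = "hol_section_algebra :: (complex, ('d, 'n) qpoint \<Rightarrow> (('d, 'n) mtuple \<times> 'n cmat) set) module"
  show alg: "complex_algebra (hol_concomitant_algebra V)"
    unfolding V by (intro complex_algebra_hol_concomitants open_generating_tuples generating_tuples_conj)
  interpret A: Ring.ring ?A using alg by (simp add: V complex_algebra_def)
  have bij: "bij_betw section_of (carrier ?A) (carrier ?B)"
    using bij_betw_section_of by (simp add: hol_concomitant_algebra_def hol_section_algebra_def)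
  note ops = section_of_operations[where 'd = 'd and 'n = 'n]
  show "complex_algebra ?B"
    by (rule complex_algebra_image[OF alg[unfolded V] bij_betw_imp_surj_on[OF bij]])
      (auto intro: ops ops(4,5)[OF A.zero_closed A.zero_closed])
  show "section_of \<in> complex_algebra_iso (hol_concomitant_algebra V) hol_section_algebra"
    unfolding V complex_algebra_iso_def ring_iso_def ring_hom_def
    using bij ops ops(4)[OF A.zero_closed A.zero_closed] by (auto simp: bij_betw_def)
qed


section \<open>Extension of concomitants\<close>

lemma bounded_linear_conj_mat: "bounded_linear (conj_mat (s :: 'n::finite cmat))"
proof (intro linear_conv_bounded_linear[THEN iffD1] linearI)
  fix r :: real and A :: "'n cmat"
  have "r *\<^sub>R B = mat_scale (of_real r) B" for B :: "'n cmat"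
    by (simp add: vec_eq_iff) (simp add: scaleR_conv_of_real)
  then show "conj_mat s (r *\<^sub>R A) = r *\<^sub>R conj_mat s A" by (simp add: conj_mat_scale)
qed (rule conj_mat_add)

lemma continuous_on_conj_tuple:
  "continuous_on S (conj_tuple s :: ('d::finite, 'n::finite) mtuple \<Rightarrow> ('d, 'n) mtuple)"
  unfolding conj_tuple_def
  by (intro continuous_on_vec_lambda continuous_on_compose2[OF linear_continuous_on[OF bounded_linear_conj_mat, of UNIV]]
      continuous_intros) auto

lemma hol_concomitant_continuous:
  assumes "\<psi> \<in> hol_concomitants UNIV"
  shows "continuous_on S \<psi>"
proof -
  have "continuous_on S (\<lambda>z. \<chi> i j. \<psi> z $ i $ j)"
    using hol_concomitantsD(3)[OF assms]
    by (intro continuous_on_vec_lambda continuous_at_imp_continuous_on ballI holo_at_continuous) auto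
  then show ?thesis by simp
qed

text \<open>Every entry extends; the equivariance of the extension and its uniqueness follow by density.\<close>

lemma hol_concomitant_unique_extension:
  fixes \<phi> :: "('d::finite, 'n::finite) mtuple \<Rightarrow> 'n cmat"
  assumes card: "CARD('d) \<ge> 2" "CARD('n) \<ge> 2" "CARD('d) > 2 \<or> CARD('n) > 2"
    and \<phi>: "\<phi> \<in> hol_concomitants generating_tuples"
  shows "\<exists>!\<psi>. \<psi> \<in> hol_concomitants UNIV \<and> (\<forall>z\<in>generating_tuples. \<psi> z = \<phi> z)"
proof -
  from exists_generating_line[OF card] obtain v z0 :: "('d, 'n) mtuple"
    where v: "v \<in> generating_tuples" and z0: "\<And>t. z0 + tuple_scale t v \<in> generating_tuples" by blast
  have dense: "closure (generating_tuples :: ('d, 'n) mtuple set) = UNIV"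
    by (rule closure_generating_tuples[OF v])
  have "\<exists>F. holomorphic_fun UNIV F \<and> (\<forall>z\<in>generating_tuples. F z = \<phi> z $ i $ j)" for i j
  proof -
    have "holomorphic_fun generating_tuples (\<lambda>z. \<phi> z $ i $ j)"
      using hol_concomitantsD(3)[OF \<phi>] by (simp add: holomorphic_fun_iff)
    then show ?thesis by (rule extension_of_avoiding_line[OF _ v z0]) blast
  qed
  then obtain F where "\<And>i j. holomorphic_fun UNIV (F i j) \<and> (\<forall>z\<in>generating_tuples. F i j z = \<phi> z $ i $ j)"
    by metis
  then have F: "\<And>i j. holomorphic_fun UNIV (F i j)"
    "\<And>i j z. z \<in> generating_tuples \<Longrightarrow> F i j z = \<phi> z $ i $ j" by blast+
  define \<psi> where "\<psi> = (\<lambda>z. \<chi> i j. F i j z)"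
  have eq: "\<psi> z = \<phi> z" if "z \<in> generating_tuples" for z
    using that by (simp add: \<psi>_def F(2) vec_eq_iff)
  have hol: "holo_at (\<lambda>z. \<psi> z $ i $ j) z" for i j z
    using F(1) by (simp add: \<psi>_def holomorphic_fun_iff)
  have cont: "continuous_on UNIV \<psi>"
    unfolding \<psi>_def by (intro continuous_on_vec_lambda holomorphic_fun_continuous_on F)
  have "\<psi> \<in> hol_concomitants UNIV"
  proof (rule hol_concomitantsI)
    fix s :: "'n cmat" and z :: "('d, 'n) mtuple" assume s: "invertible s"
    show "\<psi> (conj_tuple s z) = conj_mat s (\<psi> z)"
    proof (rule continuous_eq_on_dense[where U = UNIV and z = z and f = "\<lambda>z. \<psi> (conj_tuple s z)"
          and g = "\<lambda>z. conj_mat s (\<psi> z)", OF _ _ _ dense])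
      show "continuous_on UNIV (\<lambda>z. \<psi> (conj_tuple s z))"
        by (rule continuous_on_compose2[OF cont continuous_on_conj_tuple]) auto
      show "continuous_on UNIV (\<lambda>z. conj_mat s (\<psi> z))"
        by (rule continuous_on_compose2[OF linear_continuous_on[OF bounded_linear_conj_mat, of UNIV] cont]) auto
      fix w :: "('d, 'n) mtuple" assume "w \<in> UNIV \<inter> generating_tuples"
      then show "\<psi> (conj_tuple s w) = conj_mat s (\<psi> w)"
        using hol_concomitantsD(2)[OF \<phi> s] by (simp add: eq generating_tuples_conj s)
    qed auto
  qed (auto simp: hol)
  moreover have "\<psi>' = \<psi>"
    if "\<psi>' \<in> hol_concomitants UNIV" "\<forall>z\<in>generating_tuples. \<psi>' z = \<phi> z" for \<psi>'
  proof
    fix z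
    show "\<psi>' z = \<psi> z"
      by (rule continuous_eq_on_dense[OF open_UNIV hol_concomitant_continuous[OF that(1)] cont dense])
        (use that(2) eq in auto)
  qed
  ultimately show ?thesis using eq by blast
qed


section \<open>Pairs of two by two matrices\<close>

lemma two_elements:
  assumes "CARD('a::finite) = 2"
  obtains a b :: "'a::finite" where "a \<noteq> b" "UNIV = {a, b}"
  using assms by (auto simp: card_2_iff)

text \<open>Pairs of matrices with entries indexed by \<open>a\<close>, \<open>b\<close>; the components of a pair are indexed by
  \<open>k\<close>, \<open>l\<close>. The trace of the square of the commutator decides whether a pair generates.\<close>

definition commutator :: "'d \<Rightarrow> 'd \<Rightarrow> ('d::finite, 'n::finite) mtuple \<Rightarrow> 'n cmat" where
  "commutator k l z = z $ k ** z $ l - z $ l ** z $ k"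

lemma nc_polynomial_commutator:
  "nc_polynomial (commutator k l :: ('d::finite, 'n::finite) mtuple \<Rightarrow> 'n cmat)"
proof -
  have "(commutator k l :: ('d, 'n) mtuple \<Rightarrow> 'n cmat) = (\<lambda>z. z $ k ** z $ l + mat_scale (- 1) (z $ l ** z $ k))"
    by (simp add: fun_eq_iff commutator_def vec_eq_iff)
  then show ?thesis
    by (simp only:) (intro nc_polynomial.add nc_polynomial.scale nc_polynomial.mult nc_polynomial.gen)
qed

lemma mult_two:
  assumes "UNIV = {a, b}" "a \<noteq> (b :: 'n::finite)"
  shows "((A :: 'n cmat) ** B) $ i $ j = A $ i $ a * B $ a $ j + A $ i $ b * B $ b $ j"
  unfolding matrix_mult_nth assms(1) using assms(2) by simp

lemma trace_square_commutator:
  assumes "UNIV = {a, b}" "a \<noteq> (b :: 'n::finite)"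
  shows "trace (commutator k l z ** commutator k l z) =
    2 * ((commutator k l z $ a $ a)\<^sup>2 + commutator k l z $ a $ b * commutator k l z $ b $ a)"
proof -
  have "commutator k l z $ b $ b = - commutator k l z $ a $ a"
    by (simp add: commutator_def mult_two[OF assms])
  then show ?thesis unfolding trace_def assms(1) using assms(2)
    by (simp add: mult_two[OF assms] power2_eq_square)
qed

lemma generating_pair_if:
  fixes z :: "('d::finite, 'n::finite) mtuple"
  assumes ab: "UNIV = {a, b}" "a \<noteq> (b :: 'n)"
    and nz: "trace (commutator k l z ** commutator k l z) \<noteq> 0"
  shows "z \<in> generating_tuples"
proof -
  define X :: "'n \<times> 'n \<Rightarrow> ('d, 'n) mtuple \<Rightarrow> 'n cmat"
    where "X = (\<lambda>p. if p = (a, a) then (\<lambda>z. mat 1) else if p = (a, b) then (\<lambda>z. z $ k)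
      else if p = (b, a) then (\<lambda>z. z $ l) else commutator k l)"
  have X: "nc_polynomial (X p)" for p
    by (simp add: X_def nc_polynomial.one nc_polynomial.gen nc_polynomial_commutator)
  have UNIV4: "(UNIV :: ('n \<times> 'n) set) = {(a, a), (a, b), (b, a), (b, b)}"
    using ab(1) by (auto simp: UNIV_Times_UNIV[symmetric] simp del: UNIV_Times_UNIV)
  have "det (value_matrix X z) \<noteq> 0" unfolding det_value_matrix_iff
  proof (intro allI impI)
    fix c :: "'n \<times> 'n \<Rightarrow> complex" and p
    assume 0: "(\<Sum>p\<in>UNIV. mat_scale (c p) (X p z)) = 0"
    let ?C = "commutator k l z"
    obtain c1 c2 c3 c4 where c: "c (a, a) = c1" "c (a, b) = c2" "c (b, a) = c3" "c (b, b) = c4" by blast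
    have "mat_scale c1 (mat 1) + mat_scale c2 (z $ k) + mat_scale c3 (z $ l) + mat_scale c4 ?C = 0"
      using 0 ab(2) unfolding UNIV4 by (simp add: X_def c add.assoc)
    then have entry: "c1 * mat 1 $ i $ j + c2 * z $ k $ i $ j + c3 * z $ l $ i $ j + c4 * ?C $ i $ j = 0" for i j
      by (simp add: vec_eq_iff)
    obtain p1 q1 r1 s1 where A: "z $ k $ a $ a = p1" "z $ k $ a $ b = q1" "z $ k $ b $ a = r1" "z $ k $ b $ b = s1"
      by blast
    obtain p2 q2 r2 s2 where B: "z $ l $ a $ a = p2" "z $ l $ a $ b = q2" "z $ l $ b $ a = r2" "z $ l $ b $ b = s2"
      by blast
    obtain x m n where C: "x = q1 * r2 - q2 * r1" "m = p1 * q2 + q1 * s2 - p2 * q1 - q2 * s1"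
      "n = r1 * p2 + s1 * r2 - r2 * p1 - s2 * r1" by blast
    have Ce: "?C $ a $ a = x" "?C $ a $ b = m" "?C $ b $ a = n" "?C $ b $ b = - x"
      by (simp_all add: commutator_def mult_two[OF ab] A B C algebra_simps)
    have nz': "x\<^sup>2 + m * n \<noteq> 0"
      using nz unfolding trace_square_commutator[OF ab] Ce by (metis mult_zero_right)
    have e: "c1 + c2 * p1 + c3 * p2 + c4 * x = 0" "c2 * q1 + c3 * q2 + c4 * m = 0"
        "c2 * r1 + c3 * r2 + c4 * n = 0" "c1 + c2 * s1 + c3 * s2 - c4 * x = 0"
      using entry[of a a] entry[of a b] entry[of b a] entry[of b b] ab(2)
      by (simp_all add: Ce A B mat_nth)
    \<comment> \<open>the trace of the product of the relation with the commutator\<close>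
    have "x * (c1 + c2 * p1 + c3 * p2 + c4 * x) + m * (c2 * r1 + c3 * r2 + c4 * n)
        + n * (c2 * q1 + c3 * q2 + c4 * m) - x * (c1 + c2 * s1 + c3 * s2 - c4 * x)
        = 2 * c4 * (x\<^sup>2 + m * n)"
      unfolding C by (simp add: power2_eq_square algebra_simps)
    then have "2 * c4 * (x\<^sup>2 + m * n) = 0"
      unfolding e by (simp only: mult_zero_right add_0_right diff_0_right)
    then have "2 * c4 = 0 \<or> x\<^sup>2 + m * n = 0" by (simp only: mult_eq_0_iff)
    then have c4: "c4 = 0" using nz' by simp
    have e': "c1 + c2 * p1 + c3 * p2 = 0" "c2 * q1 + c3 * q2 = 0" "c2 * r1 + c3 * r2 = 0"
        "c1 + c2 * s1 + c3 * s2 = 0"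
      using e c4 by simp_all
    \<comment> \<open>entries of the commutators of the relation with the two components\<close>
    have "c2 * x = (c2 * q1 + c3 * q2) * r2 - (c2 * r1 + c3 * r2) * q2"
      "c2 * m = (p2 - s2) * - (c2 * q1 + c3 * q2) + ((c1 + c2 * p1 + c3 * p2) - (c1 + c2 * s1 + c3 * s2)) * q2"
      "c2 * n = (p2 - s2) * (c2 * r1 + c3 * r2) - ((c1 + c2 * p1 + c3 * p2) - (c1 + c2 * s1 + c3 * s2)) * r2"
      "c3 * x = (c2 * r1 + c3 * r2) * q1 - (c2 * q1 + c3 * q2) * r1"
      "c3 * m = (p1 - s1) * (c2 * q1 + c3 * q2) - ((c1 + c2 * p1 + c3 * p2) - (c1 + c2 * s1 + c3 * s2)) * q1"
      "c3 * n = (p1 - s1) * - (c2 * r1 + c3 * r2) + ((c1 + c2 * p1 + c3 * p2) - (c1 + c2 * s1 + c3 * s2)) * r1"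
      unfolding C by (simp_all add: algebra_simps)
    then have "c2 * x = 0" "c2 * m = 0" "c2 * n = 0" "c3 * x = 0" "c3 * m = 0" "c3 * n = 0"
      unfolding e' by simp_all
    then have c23: "c2 = 0" "c3 = 0" using nz' by auto
    then have "c1 = 0" using e(1) c4 by simp
    moreover have "p \<in> {(a, a), (a, b), (b, a), (b, b)}" unfolding UNIV4[symmetric] by simp
    ultimately show "c p = 0" using c c23 c4 by auto
  qed
  from value_matrix_generating[OF X this] show ?thesis .
qed

lemma generating_pair_only_if:
  fixes z :: "('d::finite, 'n::finite) mtuple"
  assumes ab: "UNIV = {a, b}" "a \<noteq> (b :: 'n)" and kl: "UNIV = {k, l :: 'd}"
    and z: "z \<in> generating_tuples"
  shows "trace (commutator k l z ** commutator k l z) \<noteq> 0"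
proof
  assume tr: "trace (commutator k l z ** commutator k l z) = 0"
  let ?C = "commutator k l z"
  have all: "M \<in> generated_algebra z" for M using z by (simp add: generating_tuples_def)
  have UN: "k' = k \<or> k' = l" for k' :: 'd using kl by auto
  show False
  proof (cases "?C = 0")
    case True
    then have comm: "z $ k ** z $ l = z $ l ** z $ k" by (simp add: commutator_def)
    \<comment> \<open>commuting components generate a commutative algebra\<close>
    have 1: "M ** z $ k' = z $ k' ** M" if "M \<in> generated_algebra z" for M k'
      using that
    proof induction
      case (gen j)
      then show ?case using comm UN[of k'] UN[of j] by auto
    qed (simp_all add: mat_scale_mult_left mat_scale_mult_right matrix_add_ldistrib matrix_add_rdistrib,
        metis matrix_mul_assoc)
    have 2: "M ** N = N ** M" if "M \<in> generated_algebra z" for M N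
      using that
    proof induction
      case (gen j)
      then show ?case using 1[OF all] by metis
    qed (simp_all add: mat_scale_mult_left mat_scale_mult_right matrix_add_ldistrib matrix_add_rdistrib,
        metis matrix_mul_assoc)
    have "matrix_unit a b ** matrix_unit b a = matrix_unit b a ** matrix_unit a b" by (rule 2[OF all])
    then have "matrix_unit a a = matrix_unit b b" by (simp add: matrix_unit_mult)
    then have "matrix_unit a a $ a $ a = matrix_unit b b $ a $ a" by simp
    then show False using ab(2) by (simp add: matrix_unit_nth)
  next
    case False
    \<comment> \<open>the kernel of the nilpotent commutator is spanned by a common eigenvector\<close>
    obtain x m n where C: "x = ?C $ a $ a" "m = ?C $ a $ b" "n = ?C $ b $ a" by blast
    have Cbb: "?C $ b $ b = - x" by (simp add: C commutator_def mult_two[OF ab])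
    have "(2 :: complex) = 0 \<or> x\<^sup>2 + m * n = 0"
      using tr unfolding trace_square_commutator[OF ab] by (simp only: C mult_eq_0_iff)
    then have nil: "x * x + m * n = 0" by (simp add: power2_eq_square)
    have orth: "x * (z $ k' $ a $ a - z $ k' $ b $ b) + m * z $ k' $ b $ a + n * z $ k' $ a $ b = 0" for k'
      using UN[of k'] unfolding C by (auto simp: commutator_def mult_two[OF ab] algebra_simps)
    obtain u w where uw: "u \<noteq> 0 \<or> w \<noteq> 0" "u = m \<and> w = - x \<or> u = x \<and> w = n"
    proof -
      have "m \<noteq> 0 \<or> x \<noteq> 0 \<or> n \<noteq> 0"
      proof (rule ccontr)
        assume "\<not> (m \<noteq> 0 \<or> x \<noteq> 0 \<or> n \<noteq> 0)"
        then have "?C $ i $ j = 0" if "i = a \<or> i = b" "j = a \<or> j = b" for i j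
          using Cbb C that by auto
        then have "?C = 0" using ab(1) by (auto simp: vec_eq_iff)
        then show False using False by simp
      qed
      then show ?thesis using that[of m "- x"] that[of x n] by auto
    qed
    \<comment> \<open>\<open>orth\<close> says that the trace of the product of \<open>z $ k'\<close> with the commutator is \<open>0\<close>; as the latter
      has rank one, \<open>z $ k'\<close> maps the vector \<open>(u, w)\<close> that spans its kernel to a multiple of \<open>(u, w)\<close>\<close>
    have quad: "z $ k' $ b $ a * (u * u) + (z $ k' $ b $ b - z $ k' $ a $ a) * (u * w) - z $ k' $ a $ b * (w * w) = 0" for k'
    proof (cases "u = m \<and> w = - x")
      case True
      have "z $ k' $ b $ a * (m * m) + (z $ k' $ b $ b - z $ k' $ a $ a) * (m * - x) - z $ k' $ a $ b * (x * x)
        = m * (x * (z $ k' $ a $ a - z $ k' $ b $ b) + m * z $ k' $ b $ a + n * z $ k' $ a $ b)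
          - z $ k' $ a $ b * (x * x + m * n)"
        by (simp add: algebra_simps)
      then show ?thesis using True by (simp add: nil orth)
    next
      case False
      then have uw': "u = x" "w = n" using uw by auto
      have "z $ k' $ b $ a * (x * x) + (z $ k' $ b $ b - z $ k' $ a $ a) * (x * n) - z $ k' $ a $ b * (n * n)
        = z $ k' $ b $ a * (x * x + m * n)
          - n * (x * (z $ k' $ a $ a - z $ k' $ b $ b) + m * z $ k' $ b $ a + n * z $ k' $ a $ b)"
        by (simp add: algebra_simps)
      then show ?thesis using uw' by (simp add: nil orth)
    qed
    have eig: "\<exists>c. M $ a $ a * u + M $ a $ b * w = c * u \<and> M $ b $ a * u + M $ b $ b * w = c * w"
      if "M \<in> generated_algebra z" for M
      using that
    proof induction
      case (gen k')
      show ?case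
      proof (cases "u = 0")
        case True
        then have "w \<noteq> 0" "z $ k' $ a $ b = 0" using uw quad[of k'] by auto
        then show ?thesis using True by (intro exI[of _ "z $ k' $ b $ b"]) simp
      next
        case False
        then show ?thesis using quad[of k']
          by (intro exI[of _ "(z $ k' $ a $ a * u + z $ k' $ a $ b * w) / u"]) (simp add: field_simps)
      qed
    next
      case one
      show ?case using ab(2) by (intro exI[of _ 1]) (simp add: mat_nth)
    next
      case (scale M c)
      then obtain d where "M $ a $ a * u + M $ a $ b * w = d * u" "M $ b $ a * u + M $ b $ b * w = d * w" by blast
      then show ?case by (intro exI[of _ "c * d"]) (simp add: mult.assoc flip: distrib_left)
    next
      case (add M N)
      then obtain d e where "M $ a $ a * u + M $ a $ b * w = d * u" "M $ b $ a * u + M $ b $ b * w = d * w"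
        "N $ a $ a * u + N $ a $ b * w = e * u" "N $ b $ a * u + N $ b $ b * w = e * w" by blast
      then show ?case by (intro exI[of _ "d + e"]) (simp add: algebra_simps, algebra)
    next
      case (mult M N)
      then obtain d e where de: "M $ a $ a * u + M $ a $ b * w = d * u" "M $ b $ a * u + M $ b $ b * w = d * w"
        "N $ a $ a * u + N $ a $ b * w = e * u" "N $ b $ a * u + N $ b $ b * w = e * w" by blast
      have "(M ** N) $ i $ a * u + (M ** N) $ i $ b * w
          = M $ i $ a * (N $ a $ a * u + N $ a $ b * w) + M $ i $ b * (N $ b $ a * u + N $ b $ b * w)" for i
        by (simp add: mult_two[OF ab] algebra_simps)
      also have "\<dots> i = e * (M $ i $ a * u + M $ i $ b * w)" for i
        unfolding de by (simp add: algebra_simps)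
      finally show ?case using de by (intro exI[of _ "e * d"]) simp
    qed
    from eig[OF all, of "matrix_unit a b"] obtain c where "w = c * u" "0 = c * w"
      using ab(2) by (auto simp: matrix_unit_nth)
    moreover from eig[OF all, of "matrix_unit b a"] obtain d where "0 = d * u" "u = d * w"
      using ab(2) by (auto simp: matrix_unit_nth)
    ultimately show False using uw(1) by auto
  qed
qed

lemma generating_pairs:
  assumes d: "CARD('d::finite) = 2" and n: "CARD('n::finite) = 2"
  obtains \<Delta> :: "('d::finite, 'n::finite) mtuple \<Rightarrow> complex"
  where "\<Delta> \<in> invariants" "\<And>z. z \<in> generating_tuples \<longleftrightarrow> \<Delta> z \<noteq> 0" "\<Delta> 0 = 0" "\<exists>z. \<Delta> z \<noteq> 0"
proof -
  obtain a b :: 'n where ab: "a \<noteq> b" "UNIV = {a, b}" using two_elements[OF n] by blast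
  obtain k l :: 'd where kl: "k \<noteq> l" "UNIV = {k, l}" using two_elements[OF d] by blast
  let ?\<Delta> = "\<lambda>z :: ('d, 'n) mtuple. trace (commutator k l z ** commutator k l z)"
  show ?thesis
  proof (rule that)
    show "?\<Delta> \<in> invariants"
      by (intro invariants_trace nc_polynomial.mult nc_polynomial_commutator)
    show "z \<in> generating_tuples \<longleftrightarrow> ?\<Delta> z \<noteq> 0" for z
      using generating_pair_if[OF ab(2,1)] generating_pair_only_if[OF ab(2,1) kl(2)] by blast
    show "?\<Delta> 0 = 0" by (simp add: commutator_def trace_def)
    let ?z = "(\<chi> j. if j = k then matrix_unit a b else matrix_unit b a) :: ('d, 'n) mtuple"
    have "?\<Delta> ?z = 2"
      unfolding trace_square_commutator[OF ab(2,1)]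
      using ab kl by (simp add: commutator_def matrix_unit_mult matrix_unit_nth)
    then show "\<exists>z. ?\<Delta> z \<noteq> 0" by (metis zero_neq_numeral)
  qed
qed

text \<open>If \<open>1 / \<Delta>\<close> is continued to \<open>g\<close>, then \<open>g z * \<Delta> z = 1\<close> on the whole connected domain of \<open>g\<close>.\<close>

lemma domain_of_holomorphy_generating_pairs:
  assumes d: "CARD('d::finite) = 2" and n: "CARD('n::finite) = 2"
  shows "domain_of_holomorphy (generating_tuples :: ('d, 'n) mtuple set)"
    and "\<exists>\<phi>\<in>hol_concomitants (generating_tuples :: ('d, 'n) mtuple set).
      \<not> (\<exists>\<psi>\<in>hol_concomitants UNIV. \<forall>z\<in>generating_tuples. \<psi> z = \<phi> z)"
proof -
  from generating_pairs[OF d n] obtain \<Delta> :: "('d, 'n) mtuple \<Rightarrow> complex"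
    where \<Delta>: "\<Delta> \<in> invariants" "\<And>z. z \<in> generating_tuples \<longleftrightarrow> \<Delta> z \<noteq> 0" "\<Delta> 0 = 0" "\<exists>z. \<Delta> z \<noteq> 0"
    by blast
  have hol\<Delta>: "holo_at \<Delta> z" for z
    using \<Delta>(1) by (auto simp: invariants_def intro: holo_at_polynomial)
  have hol: "holo_at (\<lambda>z. 1 / \<Delta> z) z" if "z \<in> generating_tuples" for z
    using that \<Delta>(2) by (intro holo_at_divide holo_at_const hol\<Delta>) auto
  obtain z1 where z1: "z1 \<in> (generating_tuples :: ('d, 'n) mtuple set)" using \<Delta>(2,4) by auto
  show "domain_of_holomorphy (generating_tuples :: ('d, 'n) mtuple set)"
    unfolding domain_of_holomorphy_def
  proof (intro conjI open_generating_tuples connected_generating_tuples notI)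
    assume "\<exists>W' W. open W' \<and> open W \<and> W' \<noteq> {} \<and> W' \<subseteq> W \<inter> generating_tuples \<and> connected W \<and>
      \<not> W \<subseteq> (generating_tuples :: ('d, 'n) mtuple set) \<and> (\<forall>f. holomorphic_fun generating_tuples f \<longrightarrow>
             (\<exists>g. holomorphic_fun W g \<and> (\<forall>z\<in>W'. g z = f z)))"
    then obtain W' W :: "('d, 'n) mtuple set" where W: "open W'" "open W" "W' \<noteq> {}" "W' \<subseteq> W \<inter> generating_tuples"
      "connected W" "\<not> W \<subseteq> generating_tuples"
      and ext: "\<And>f. holomorphic_fun generating_tuples f \<Longrightarrow> \<exists>g. holomorphic_fun W g \<and> (\<forall>z\<in>W'. g z = f z)"
      by blast
    have "holomorphic_fun generating_tuples (\<lambda>z. 1 / \<Delta> z)" using hol by (simp add: holomorphic_fun_iff)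
    then obtain g where g: "holomorphic_fun W g" "\<And>z. z \<in> W' \<Longrightarrow> g z = 1 / \<Delta> z" using ext by blast
    have "g z * \<Delta> z - 1 = 0" if "z \<in> W" for z
    proof (rule holo_identity_connected[OF _ W(2,5,1,3) _ _ that])
      show "holomorphic_fun W (\<lambda>z. g z * \<Delta> z - 1)"
        using g(1) hol\<Delta> by (auto simp: holomorphic_fun_iff intro!: holo_at_diff holo_at_mult holo_at_const)
      show "g w * \<Delta> w - 1 = 0" if "w \<in> W'" for w
        using that W(4) \<Delta>(2)[of w] g(2)[OF that] by auto
    qed (use W(4) in auto)
    then have "\<Delta> z \<noteq> 0" if "z \<in> W" for z using that by fastforce
    then show False using W(6) \<Delta>(2) by blast
  qed (use z1 in auto)
  let ?\<phi> = "\<lambda>z :: ('d, 'n) mtuple \<in> generating_tuples. mat_scale (1 / \<Delta> z) (mat 1) :: 'n cmat"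
  have "?\<phi> \<in> hol_concomitants generating_tuples"
  proof (rule hol_concomitant_restrictI[OF open_generating_tuples generating_tuples_conj])
    show "mat_scale (1 / \<Delta> (conj_tuple s z)) (mat 1) = conj_mat s (mat_scale (1 / \<Delta> z) (mat 1))"
      if "invertible s" for s z
      using \<Delta>(1) that by (simp add: invariants_def conj_mat_scale)
    show "holo_at (\<lambda>z. mat_scale (1 / \<Delta> z) (mat 1) $ i $ j) z" if "z \<in> generating_tuples" for i j z
      using hol[OF that] holo_at_mult[OF hol[OF that] holo_at_const[of "mat 1 $ i $ j"]] by simp
  qed
  moreover have "\<not> (\<exists>\<psi>\<in>hol_concomitants UNIV. \<forall>z\<in>generating_tuples. \<psi> z = ?\<phi> z)"
  proof
    assume "\<exists>\<psi>\<in>hol_concomitants UNIV. \<forall>z\<in>generating_tuples. \<psi> z = ?\<phi> z"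
    then obtain \<psi> where \<psi>: "\<psi> \<in> hol_concomitants UNIV" "\<And>z. z \<in> generating_tuples \<Longrightarrow> \<psi> z = ?\<phi> z" by blast
    fix i :: 'n
    have "\<psi> 0 $ i $ i * \<Delta> 0 = 1"
    proof (rule continuous_eq_on_dense[where U = UNIV and z = 0 and f = "\<lambda>z. \<psi> z $ i $ i * \<Delta> z" and g = "\<lambda>z. 1",
          OF _ _ _ closure_generating_tuples[OF z1]])
      show "continuous_on UNIV (\<lambda>z. \<psi> z $ i $ i * \<Delta> z)"
        by (intro continuous_at_imp_continuous_on ballI holo_at_continuous holo_at_mult hol\<Delta>
            hol_concomitantsD(3)[OF \<psi>(1)]) auto
      show "\<psi> z $ i $ i * \<Delta> z = 1" if "z \<in> UNIV \<inter> generating_tuples" for z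
        using that \<psi>(2)[of z] \<Delta>(2)[of z] by (simp add: mat_nth)
    qed auto
    then show False by (simp add: \<Delta>(3))
  qed
  ultimately show "\<exists>\<phi>\<in>hol_concomitants (generating_tuples :: ('d, 'n) mtuple set).
      \<not> (\<exists>\<psi>\<in>hol_concomitants UNIV. \<forall>z\<in>generating_tuples. \<psi> z = \<phi> z)" by blast
qed

theorem theorem1p2:
  fixes V :: "('d::finite, 'n::finite) mtuple set"
  assumes "CARD('d) \<ge> 2" and "CARD('n) \<ge> 2"
    and "V = generating_tuples"
  shows
    "((\<forall>\<phi>\<in>hol_concomitants V. \<forall>z\<in>V. section_of \<phi> (pi0 z) = bundle_class z (\<phi> z)) \<and>
      (\<forall>\<sigma>\<in>cross_sections. concomitant_of \<sigma> \<in> concomitants V \<and>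
         (\<forall>z\<in>V. \<sigma> (pi0 z) = bundle_class z (concomitant_of \<sigma> z))) \<and>
      complex_algebra (hol_concomitant_algebra V) \<and>
      complex_algebra (hol_section_algebra ::
        (complex, ('d, 'n) qpoint \<Rightarrow> (('d, 'n) mtuple \<times> 'n cmat) set) module) \<and>
      section_of \<in> complex_algebra_iso (hol_concomitant_algebra V) hol_section_algebra \<and>
      (\<forall>\<phi>\<in>hol_concomitants V. concomitant_of (section_of \<phi>) = \<phi>) \<and>
      (\<forall>\<sigma>\<in>(hol_sections :: (('d, 'n) qpoint \<Rightarrow> (('d, 'n) mtuple \<times> 'n cmat) set) set).
         concomitant_of \<sigma> \<in> hol_concomitants V \<and> section_of (concomitant_of \<sigma>) = \<sigma>)) \<and>
     (CARD('d) > 2 \<or> CARD('n) > 2 \<longrightarrow>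
       (\<forall>\<phi>\<in>hol_concomitants V.
          \<exists>!\<psi>. \<psi> \<in> hol_concomitants UNIV \<and> (\<forall>z\<in>V. \<psi> z = \<phi> z))) \<and>
     (CARD('d) = 2 \<and> CARD('n) = 2 \<longrightarrow>
       domain_of_holomorphy V \<and>
       (\<exists>\<phi>\<in>hol_concomitants V. \<not> (\<exists>\<psi>\<in>hol_concomitants UNIV. \<forall>z\<in>V. \<psi> z = \<phi> z)))"
proof (intro conjI impI ballI)
  fix \<phi> :: "('d, 'n) mtuple \<Rightarrow> 'n cmat" and z assume \<phi>: "\<phi> \<in> hol_concomitants V" and z: "z \<in> V"
  then show "section_of \<phi> (pi0 z) = bundle_class z (\<phi> z)"
    using section_of_pi0 assms(3) by (auto simp: hol_concomitants_def)
next
  fix \<sigma> :: "('d, 'n) qpoint \<Rightarrow> (('d, 'n) mtuple \<times> 'n cmat) set" assume \<sigma>: "\<sigma> \<in> cross_sections"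
  show "concomitant_of \<sigma> \<in> concomitants V" using concomitant_of_concomitant[OF \<sigma>] assms(3) by simp
  show "\<sigma> (pi0 z) = bundle_class z (concomitant_of \<sigma> z)" if "z \<in> V" for z
    using concomitant_of_class[OF \<sigma>] that assms(3) by simp
next
  fix \<phi> :: "('d, 'n) mtuple \<Rightarrow> 'n cmat" assume "\<phi> \<in> hol_concomitants V"
  then show "concomitant_of (section_of \<phi>) = \<phi>"
    using concomitant_of_section_of assms(3) by (auto simp: hol_concomitants_def)
next
  fix \<sigma> :: "('d, 'n) qpoint \<Rightarrow> (('d, 'n) mtuple \<times> 'n cmat) set" assume \<sigma>: "\<sigma> \<in> hol_sections"
  show "concomitant_of \<sigma> \<in> hol_concomitants V" using concomitant_of_holomorphic[OF \<sigma>] assms(3) by simp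
  show "section_of (concomitant_of \<sigma>) = \<sigma>"
    using section_of_concomitant_of \<sigma> by (auto simp: hol_sections_def)
next
  fix \<phi> :: "('d, 'n) mtuple \<Rightarrow> 'n cmat"
  assume "CARD('d) > 2 \<or> CARD('n) > 2" "\<phi> \<in> hol_concomitants V"
  then show "\<exists>!\<psi>. \<psi> \<in> hol_concomitants UNIV \<and> (\<forall>z\<in>V. \<psi> z = \<phi> z)"
    using hol_concomitant_unique_extension[OF assms(1,2)] assms(3) by simp
qed (use section_of_algebra_iso[OF assms(3)] domain_of_holomorphy_generating_pairs assms(3) in \<open>auto\<close>)

end
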